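(* If $H>K$ and $H>1/2$, then $$\dim_{\rm H}\,\mathrm{graph}(Y)=2-K\qquad\mathbb P\text{-a.s.}$$
   Context: Let $(\Omega,\mathcal F,\mathbb P)$ be a probability space, $H\in(0,1)$, and let $W_H=\{W_H(t):0\le t\le 1\}$ be a continuous fractional Brownian motion with Hurst parameter $H$, i.e. a continuous centered Gaussian process with $\mathbb E[W_H(s)W_H(t)]=\frac12(s^{2H}+t^{2H}-|t-s|^{2H})$. Let $\kappa:[0,1]\to[0,1]$ be a deterministic function with $\kappa(0)=0$, $\kappa(1)=1$, Hölder continuous with some exponent $\tau\in(H,1]$, and put $B_H(u):=W_H(u)-\kappa(u)W_H(1)$, $0\le u\le1$. Let $\alpha\in(0,1)$ and $b\in\{2,3,\dots\}$. The fractional Wiener--Weierstrass bridge with parameters $\alpha,b,H$ is $$Y(t):=\sum_{n=0}^\infty\alpha^nB_H(\{b^nt\}),\qquad 0\le t\le1,$$ where $\{x\}$ denotes the fractional part of $x\ge0$. Put $K:=\min\{1,-\log_b\alpha\}$. Here $\dim_{\rm H}$ denotes Hausdorff dimension and $\mathrm{graph}(Y)=\{(t,Y(t)):t\in[0,1]\}\subset\mathbb R^2$ is the graph of the sample path. *)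

theory Defs
  imports "HOL-Probability.Probability"
begin

section \<open>Hausdorff dimension\<close>

text \<open>The gauge \<open>diam(U)\<^sup>s\<close>, with the usual conventions that \<open>\<emptyset>\<close> contributes 0 for every
  \<open>s\<close> and that \<open>diam(U)\<^sup>0 = 1\<close> for nonempty \<open>U\<close>. The case \<open>s = 0\<close> is separated because
  \<open>0 powr 0 = 0\<close>.\<close>

definition diam_powr :: "real \<Rightarrow> 'a::metric_space set \<Rightarrow> real" where
  "diam_powr s U = (if U = {} then 0 else if s = 0 then 1 else diameter U powr s)"

text \<open>Boundedness is required explicitly, since \<^const>\<open>diameter\<close> is unspecified on unbounded sets.\<close>

definition delta_cover :: "real \<Rightarrow> 'a::metric_space set \<Rightarrow> (nat \<Rightarrow> 'a set) \<Rightarrow> bool" where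
  "delta_cover \<delta> A U \<longleftrightarrow> A \<subseteq> (\<Union>i. U i) \<and> (\<forall>i. bounded (U i) \<and> diameter (U i) \<le> \<delta>)"

definition hausdorff_premeasure :: "real \<Rightarrow> real \<Rightarrow> 'a::metric_space set \<Rightarrow> ennreal" where
  "hausdorff_premeasure s \<delta> A = (INF U \<in> {U. delta_cover \<delta> A U}. \<Sum>i. ennreal (diam_powr s (U i)))"

definition hausdorff_measure :: "real \<Rightarrow> 'a::metric_space set \<Rightarrow> ennreal" where
  "hausdorff_measure s A = (SUP \<delta> \<in> {0<..}. hausdorff_premeasure s \<delta> A)"

definition hausdorff_dim :: "'a::metric_space set \<Rightarrow> ereal" where
  "hausdorff_dim A = Inf {ereal s |s. 0 \<le> s \<and> hausdorff_measure s A = 0}"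


section \<open>Hoelder continuity\<close>

definition holder_on :: "real \<Rightarrow> 'a::metric_space set \<Rightarrow> ('a \<Rightarrow> 'b::metric_space) \<Rightarrow> bool" where
  "holder_on \<tau> S f \<longleftrightarrow>
     (\<exists>C\<ge>0. \<forall>x\<in>S. \<forall>y\<in>S. dist (f x) (f y) \<le> C * dist x y powr \<tau>)"


section \<open>Gaussian processes and fractional Brownian motion\<close>

text \<open>Point masses count as (degenerate) Gaussian laws.\<close>

definition gaussian_rv :: "'w measure \<Rightarrow> ('w \<Rightarrow> real) \<Rightarrow> bool" where
  "gaussian_rv M X \<longleftrightarrow> X \<in> borel_measurable M \<and>
     (\<exists>\<mu> \<sigma>. (\<sigma> > 0 \<and> distributed M lborel X (normal_density \<mu> \<sigma>)) \<or>
             distr M borel X = return borel \<mu>)"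

definition gaussian_process :: "'w measure \<Rightarrow> 't set \<Rightarrow> ('t \<Rightarrow> 'w \<Rightarrow> real) \<Rightarrow> bool" where
  "gaussian_process M T X \<longleftrightarrow>
     (\<forall>F c. finite F \<and> F \<subseteq> T \<longrightarrow> gaussian_rv M (\<lambda>\<omega>. \<Sum>t\<in>F. c t * X t \<omega>))"

definition fractional_brownian_motion :: "'w measure \<Rightarrow> real \<Rightarrow> (real \<Rightarrow> 'w \<Rightarrow> real) \<Rightarrow> bool" where
  "fractional_brownian_motion M H W \<longleftrightarrow>
     gaussian_process M {0..1} W \<and>
     (\<forall>t\<in>{0..1}. (\<integral>\<omega>. W t \<omega> \<partial>M) = 0) \<and>
     (\<forall>s\<in>{0..1}. \<forall>t\<in>{0..1}. (\<integral>\<omega>. W s \<omega> * W t \<omega> \<partial>M) =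
        (s powr (2 * H) + t powr (2 * H) - \<bar>t - s\<bar> powr (2 * H)) / 2) \<and>
     (\<forall>\<omega>\<in>space M. continuous_on {0..1} (\<lambda>t. W t \<omega>))"


section \<open>The fractional Wiener--Weierstrass bridge\<close>

definition fractional_bridge ::
    "(real \<Rightarrow> real) \<Rightarrow> (real \<Rightarrow> 'w \<Rightarrow> real) \<Rightarrow> real \<Rightarrow> 'w \<Rightarrow> real" where
  "fractional_bridge \<kappa> W u \<omega> = W u \<omega> - \<kappa> u * W 1 \<omega>"

definition wiener_weierstrass_bridge ::
    "real \<Rightarrow> nat \<Rightarrow> (real \<Rightarrow> real) \<Rightarrow> (real \<Rightarrow> 'w \<Rightarrow> real) \<Rightarrow> real \<Rightarrow> 'w \<Rightarrow> real" where
  "wiener_weierstrass_bridge \<alpha> b \<kappa> W t \<omega> =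
     (\<Sum>n. \<alpha> ^ n * fractional_bridge \<kappa> W (frac (real b ^ n * t)) \<omega>)"

definition path_graph :: "(real \<Rightarrow> real) \<Rightarrow> (real \<times> real) set" where
  "path_graph y = {(t, y t) |t. t \<in> {0..1}}"

end

theory Submission
  imports Defs
begin

text \<open>Since \<open>\<alpha> = b powr (-K)\<close> and the paths of \<open>B\<^sub>H\<close> are \<open>h\<close>-Hoelder for some \<open>h > K\<close> (Kolmogorov), the
  series \<open>Y\<close> is \<open>K\<close>-Hoelder, which gives the upper bound \<open>2 - K\<close>.

  The lower bound is an energy estimate for the graph over a random point of a Cantor set.
  Base-\<open>b\<close> digits are grouped into blocks of length \<open>l\<^sup>2\<close>; each block starts with \<open>l\<close> zeros and has
  no other run of \<open>l\<close> zeros, so that \<open>{b\<^sup>n t}\<close> is close to 0 only at the block boundaries, while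
  the number of admissible blocks is still \<open>b\<close> to the power \<open>(l - 1)(l - 2)\<close>. If \<open>s, t\<close> first differ in
  block \<open>j\<close>, then a trapezoid \<open>h\<close> supported near the \<open>j\<close>-th block of \<open>s\<close> detects that block:
  \<open>\<Sum>\<alpha>\<^sup>n (h{b\<^sup>n s} - h{b\<^sup>n t})\<close> is at least of order \<open>\<alpha>\<close> to the power \<open>j l\<^sup>2\<close>. As \<open>h\<close> lies in the Cameron--Martin space
  of \<open>W\<^sub>H\<close> and vanishes at 0 and 1, this bounds the standard deviation of \<open>Y s - Y t\<close> from below,
  independently of \<open>\<kappa>\<close>, and hence the expected energy of every order less than \<open>2 - K\<close> is finite
  when \<open>l\<close> is large.\<close>

section \<open>Hausdorff dimension of graphs\<close>

text \<open>The summands of \<open>Y s - Y t\<close> are correlated, so the variance is not computed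
  but bounded by duality: for \<open>h\<close> of finite Cameron--Martin norm, the square of the sum
  of \<open>c t * h t\<close> is at most the squared norm times the variance of the sum of
  \<open>c t * W t\<close>. The function \<open>h\<close> may depend on the pair of points as long
  as the norm bound does not. Trapezoids are convenient because each is a combination of four
  functions |x - p|; the norm bound then reduces to a Cauchy--Schwarz inequality between finite
  sums.

  The zeros at the head of a block push the support of \<open>h\<close> below \<open>b^(-l)\<close>,
  where only shifts by whole blocks can land. All other terms of the series are invisible to
  \<open>h\<close>, so they cannot cancel the detected block.

  The exponent arises as follows. With \<open>B = b^(l^2)\<close>, two points that separate in block
  j contribute at most a constant times \<open>B^(j (\<gamma> - 1 + K))\<close> to the expected
  energy of order \<gamma>, while a random pair agrees on j blocks with a probability that decays
  like the number of blocks to the power -j. Restricting the blocks costs order l in an exponent of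
  order l^2, so every \<gamma> < 2 - K is reached.\<close>

lemma diam_powr_antimono:
  assumes "0 \<le> s" "s \<le> r" "bounded U" "diameter U \<le> 1"
  shows "diam_powr r U \<le> diam_powr s U"
proof (cases "s = 0")
  case True
  have "diameter U powr r \<le> 1 powr r"
    using assms diameter_ge_0[of U] by (intro powr_mono2) auto
  then show ?thesis using True by (auto simp: diam_powr_def)
next
  case False
  have "diameter U powr r \<le> diameter U powr s"
    using assms diameter_ge_0[of U] by (intro powr_mono') auto
  then show ?thesis using False assms by (auto simp: diam_powr_def)
qed

text \<open>The delicate case is a covering set of diameter 0, where \<open>c = 0\<close> and the
  inverse is infinite: finiteness of \<open>R\<close> then forces \<open>e = 0\<close>, so such a
  set carries no mass.\<close>

lemma ennreal_le_mult_of_mult_inverse_le: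
  fixes e R :: ennreal and c :: real
  assumes "e * inverse (ennreal c) \<le> R" "R < \<infinity>"
  shows "e \<le> R * ennreal c"
proof (cases "ennreal c = 0")
  case True
  with assms have "e * \<infinity> < \<infinity>" by (auto simp: top_unique)
  then have "e = 0" by (metis ennreal_mult_top infinity_ennreal_def less_irrefl mult.commute)
  then show ?thesis by simp
next
  case False
  then have "c > 0" by (simp add: ennreal_eq_0_iff)
  then have "inverse (ennreal c) * ennreal c = 1"
    by (simp add: inverse_ennreal ennreal_mult[symmetric])
  then have "e = e * (inverse (ennreal c) * ennreal c)" by simp
  also have "\<dots> \<le> R * ennreal c"
    using assms(1) by (simp add: mult.assoc[symmetric] mult_right_mono)
  finally show ?thesis .
qed

lemma inverse_ennreal_antimono:
  fixes a b :: ennreal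
  assumes "a \<le> b"
  shows "inverse b \<le> inverse a"
proof (cases "a = 0 \<or> b = \<top>")
  case False
  then obtain x y where xy: "a = ennreal x" "b = ennreal y" "0 < x" "0 \<le> y"
    using assms by (cases a; cases b) (auto simp: top_unique)
  then have "x \<le> y" using assms by simp
  then show ?thesis using xy by (simp add: inverse_ennreal ennreal_leI le_imp_inverse_le)
qed auto

text \<open>Energy method. Finite energy makes the potential \<open>\<phi>\<close> finite almost
  everywhere, so for some n the points with \<open>\<phi> x \<le> n\<close> carry positive mass. A
  ball of radius r around such a point has mass at most n r^\<gamma>, because the kernel is at least
  r^(-\<gamma>) on it. Summed over a cover, this keeps the sums of diameters to the power s away
  from 0 for every s < \<gamma>.\<close>

lemma hausdorff_dim_ge_of_energy:
  fixes g :: "'b \<Rightarrow> 'a::{metric_space, second_countable_topology}"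
  assumes "prob_space N" and [measurable]: "g \<in> borel_measurable N"
    and gA: "\<And>x. x \<in> space N \<Longrightarrow> g x \<in> A" and "0 < \<gamma>"
    and energy: "(\<integral>\<^sup>+x. \<integral>\<^sup>+y. inverse (ennreal (dist (g x) (g y) powr \<gamma>)) \<partial>N \<partial>N) < \<infinity>"
  shows "ereal \<gamma> \<le> hausdorff_dim A"
proof -
  interpret prob_space N by fact
  define \<phi> where "\<phi> x = (\<integral>\<^sup>+y. inverse (ennreal (dist (g x) (g y) powr \<gamma>)) \<partial>N)" for x
  have [measurable]: "\<phi> \<in> borel_measurable N"
    unfolding \<phi>_def by measurable
  define G where "G n = {x \<in> space N. \<phi> x \<le> of_nat n}" for n :: nat
  have [measurable]: "G n \<in> sets N" for n
    unfolding G_def by measurable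
  have "\<exists>n. emeasure N (G n) > 0"
  proof (rule ccontr)
    assume "\<not> ?thesis"
    then have "G n \<in> null_sets N" for n by (auto intro!: null_setsI simp: zero_less_iff_neq_zero)
    then have "(\<Union>n. G n) \<in> null_sets N" by (rule null_sets_UN)
    then have "AE x in N. x \<notin> (\<Union>n. G n)" by (rule AE_not_in)
    moreover have "AE x in N. \<phi> x \<noteq> \<infinity>"
      by (rule nn_integral_noteq_infinite) (use energy in \<open>auto simp: \<phi>_def\<close>)
    ultimately have "AE x in N. False"
      using AE_space
    proof eventually_elim
      case (elim x)
      then have "\<phi> x < top" by (simp add: less_top)
      then obtain n :: nat where "\<phi> x < of_nat n"
        using ennreal_Ex_less_of_nat by blast
      with elim show ?case by (auto simp: G_def dest: less_imp_le)
    qed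
    then show False by (simp add: AE_False)
  qed
  then obtain n where n: "emeasure N (G n) > 0" by blast
  show ?thesis
    unfolding hausdorff_dim_def
  proof (intro Inf_greatest, clarify)
    fix s :: real assume s: "0 \<le> s" and H0: "hausdorff_measure s A = 0"
    show "ereal \<gamma> \<le> ereal s"
    proof (rule ccontr)
      assume "\<not> ?thesis"
      then have "s < \<gamma>" by simp
      \<comment> \<open>Scale 1 is enough: the premeasure lies below the measure, and for diameters
        at most 1 the power \<gamma> may be replaced by the smaller power s.\<close>
      have "hausdorff_premeasure s 1 A \<le> hausdorff_measure s A"
        unfolding hausdorff_measure_def by (rule SUP_upper) auto
      then have P0: "hausdorff_premeasure s 1 A = 0" using H0 by simp
      \<comment> \<open>\<open>Suc n\<close> keeps the divisor nonzero when \<open>n = 0\<close>. A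
        cover with sum below \<open>e\<close> is too small to carry the mass of
        \<open>G n\<close>.\<close>
      define e where "e = emeasure N (G n) / of_nat (Suc n)"
      have "e > 0" using n by (simp add: e_def ennreal_zero_less_divide ennreal_of_nat_eq_real_of_nat del: of_nat_Suc)
      then obtain U where U: "delta_cover 1 A U" "(\<Sum>i. ennreal (diam_powr s (U i))) < e"
        using P0 unfolding hausdorff_premeasure_def
        by (metis (no_types, lifting) INF_less_iff mem_Collect_eq)
      \<comment> \<open>The sets \<open>U i\<close> are arbitrary and need not be measurable. Each
        one that meets the image of \<open>G n\<close> is replaced by a closed ball of radius
        \<open>diameter (U i)\<close> whose centre is a point of small potential; its preimage is
        measurable.\<close>
      define V where "V i = (if \<exists>x\<in>G n. g x \<in> U i
        then {y \<in> space N. dist (g (SOME x. x \<in> G n \<and> g x \<in> U i)) (g y) \<le> diameter (U i)} else {})" for i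
      have [measurable]: "V i \<in> sets N" for i
      proof -
        have [measurable]: "{y \<in> space N. dist z (g y) \<le> d} \<in> sets N" for z d by measurable
        show ?thesis unfolding V_def by simp
      qed
      have GV: "G n \<subseteq> (\<Union>i. V i)"
      proof
        fix x assume x: "x \<in> G n"
        then have "g x \<in> A" using gA by (auto simp: G_def)
        then obtain i where i: "g x \<in> U i" using U by (auto simp: delta_cover_def)
        then have "\<exists>x. x \<in> G n \<and> g x \<in> U i" using x by blast
        then have "g (SOME x. x \<in> G n \<and> g x \<in> U i) \<in> U i" by (metis (mono_tags, lifting) someI_ex)
        then have "dist (g (SOME x. x \<in> G n \<and> g x \<in> U i)) (g x) \<le> diameter (U i)"
          using i U by (intro diameter_bounded_bound) (auto simp: delta_cover_def)
        then have "x \<in> V i" using x i by (auto simp: V_def G_def)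
        then show "x \<in> (\<Union>i. V i)" by blast
      qed
      have Vle: "emeasure N (V i) \<le> of_nat n * ennreal (diam_powr s (U i))" for i
      proof (cases "\<exists>x\<in>G n. g x \<in> U i")
        case False
        then show ?thesis by (simp add: V_def)
      next
        case True
        define x where "x = (SOME x. x \<in> G n \<and> g x \<in> U i)"
        have x: "x \<in> G n" "g x \<in> U i"
          using True someI_ex[of "\<lambda>x. x \<in> G n \<and> g x \<in> U i"] by (auto simp: x_def)
        have V: "V i = {y \<in> space N. dist (g x) (g y) \<le> diameter (U i)}"
          using True by (auto simp: V_def x_def)
        have "emeasure N (V i) * inverse (ennreal (diameter (U i) powr \<gamma>))
            = (\<integral>\<^sup>+y. inverse (ennreal (diameter (U i) powr \<gamma>)) * indicator (V i) y \<partial>N)"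
          by (subst nn_integral_cmult_indicator) (simp_all add: mult.commute)
        also have "\<dots> \<le> \<phi> x"
          unfolding \<phi>_def
        proof (intro nn_integral_mono)
          fix y assume "y \<in> space N"
          show "inverse (ennreal (diameter (U i) powr \<gamma>)) * indicator (V i) y
            \<le> inverse (ennreal (dist (g x) (g y) powr \<gamma>))"
            using \<open>0 < \<gamma>\<close> by (auto simp: V indicator_def intro!: inverse_ennreal_antimono ennreal_leI powr_mono2)
        qed
        also have "\<dots> \<le> of_nat n" using x by (auto simp: G_def)
        finally have "emeasure N (V i) \<le> of_nat n * ennreal (diameter (U i) powr \<gamma>)"
          by (rule ennreal_le_mult_of_mult_inverse_le) (simp add: ennreal_of_nat_eq_real_of_nat)
        also have "diameter (U i) powr \<gamma> = diam_powr \<gamma> (U i)"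
          using x \<open>0 < \<gamma>\<close> by (auto simp: diam_powr_def)
        also have "ennreal \<dots> \<le> ennreal (diam_powr s (U i))"
          using U s \<open>s < \<gamma>\<close> by (intro ennreal_leI diam_powr_antimono) (auto simp: delta_cover_def)
        finally show ?thesis by (simp add: mult_left_mono)
      qed
      have "emeasure N (G n) \<le> emeasure N (\<Union>i. V i)" using GV by (intro emeasure_mono) auto
      also have "\<dots> \<le> (\<Sum>i. emeasure N (V i))" by (rule emeasure_subadditive_countably) auto
      also have "\<dots> \<le> (\<Sum>i. of_nat n * ennreal (diam_powr s (U i)))" by (intro suminf_le Vle) auto
      also have "\<dots> = of_nat n * (\<Sum>i. ennreal (diam_powr s (U i)))" by simp
      also have "\<dots> \<le> of_nat (Suc n) * (\<Sum>i. ennreal (diam_powr s (U i)))"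
        by (intro mult_right_mono) auto
      also have "\<dots> < of_nat (Suc n) * e"
        using U(2) by (intro ennreal_mult_strict_left_mono) (auto simp: ennreal_of_nat_eq_real_of_nat simp del: of_nat_Suc)
      also have "\<dots> = emeasure N (G n)"
      proof -
        have "of_nat (Suc n) * e = emeasure N (G n) * of_nat (Suc n) / of_nat (Suc n)"
          unfolding e_def by (simp only: ennreal_times_divide mult.commute)
        also have "\<dots> = emeasure N (G n)"
          by (intro ennreal_mult_divide_eq) (auto simp: ennreal_of_nat_eq_real_of_nat simp del: of_nat_Suc)
        finally show ?thesis .
      qed
      finally show False by simp
    qed
  qed
qed

text \<open>Cut [0,1] into m columns of width 1/m. Over a column the graph stays in a strip of
  height 2 C m^(-K), which is covered by order m^(1 - K) squares of side 1/m. The m^(2 - K) squares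
  contribute order m^(-\<epsilon>) for the exponent 2 - K + \<epsilon>.\<close>

lemma hausdorff_dim_path_graph_le:
  fixes y :: "real \<Rightarrow> real"
  assumes "0 < K" "K \<le> 1" and "holder_on K {0..1} y"
  shows "hausdorff_dim (path_graph y) \<le> ereal (2 - K)"
proof (rule ereal_le_epsilon2)
  obtain C where C0: "C \<ge> 0" and C: "\<And>u v. u \<in> {0..1} \<Longrightarrow> v \<in> {0..1} \<Longrightarrow> \<bar>y u - y v\<bar> \<le> C * \<bar>u - v\<bar> powr K"
    using assms(3) by (auto simp: holder_on_def dist_real_def)
  fix \<epsilon> :: real assume \<epsilon>: "0 < \<epsilon>"
  show "hausdorff_dim (path_graph y) \<le> ereal (2 - K) + ereal \<epsilon>"
  proof -
    define s where "s = 2 - K + \<epsilon>"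
    have s: "s > 0" using assms \<epsilon> by (simp add: s_def)
    have bound: "hausdorff_premeasure s \<delta> (path_graph y) \<le> ennreal ((2 * C + 2) * 2 powr s * real m powr (-\<epsilon>))"
      if "\<delta> > 0" "m \<ge> 1" "2 / real m \<le> \<delta>" for \<delta> and m :: nat
    proof -
      define J where "J = nat \<lfloor>2 * C * real m powr (1 - K)\<rfloor> + 1"
      have J: "real J \<le> 2 * C * real m powr (1 - K) + 1" "2 * C * real m powr (1 - K) < real J" "J > 0"
        using C0 by (auto simp: J_def) linarith+
      define sq where "sq i j = {real i / m .. (real i + 1) / m} \<times>
        {y (real i / m) - C * real m powr (-K) + real j / m .. y (real i / m) - C * real m powr (-K) + (real j + 1) / m}" for i j :: nat
      have m0: "real m > 0" using that by simp
      have nrm: "norm (p - q) \<le> 2 / real m" if "p \<in> sq i j" "q \<in> sq i j" for p q i j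
      proof -
        have "norm (p - q) \<le> \<bar>fst p - fst q\<bar> + \<bar>snd p - snd q\<bar>"
          by (cases p; cases q) (simp add: norm_Pair sqrt_sum_squares_le_sum_abs)
        also have "\<dots> \<le> 1 / m + 1 / m"
          using that by (intro add_mono) (auto simp: sq_def add_divide_distrib abs_le_iff)
        finally show ?thesis by simp
      qed
      have ds: "diameter (sq i j) \<le> 2 / real m" for i j
        by (rule diameter_le) (use nrm m0 in auto)
      have bs: "bounded (sq i j)" for i j
        by (auto simp: sq_def intro!: bounded_Times)
      \<comment> \<open>The square in column i and row j gets the index \<open>i * J + j\<close>;
        the rest of the sequence is empty and contributes 0.\<close>
      define U where "U n = (if n < m * J then sq (n div J) (n mod J) else {})" for n
      have cov: "path_graph y \<subseteq> (\<Union>n. U n)"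
      proof (clarsimp simp: path_graph_def)
        fix t :: real assume t: "0 \<le> t" "t \<le> 1"
        \<comment> \<open>The minimum puts t = 1 into the last column, where the floor alone would
          give the index m.\<close>
        define i where "i = min (m - 1) (nat \<lfloor>m * t\<rfloor>)"
        have i: "i < m" using \<open>m \<ge> 1\<close> by (auto simp: i_def)
        have it: "real i \<le> m * t" "m * t \<le> real i + 1"
        proof -
          have "real (nat \<lfloor>m * t\<rfloor>) = of_int \<lfloor>m * t\<rfloor>" using t by simp
          then show "real i \<le> m * t" by (simp add: i_def min_def) linarith
          show "m * t \<le> real i + 1"
          proof (cases "nat \<lfloor>m * t\<rfloor> \<le> m - 1")
            case True
            then have "i = nat \<lfloor>m * t\<rfloor>" by (simp add: i_def)
            then show ?thesis using \<open>real (nat \<lfloor>m * t\<rfloor>) = of_int \<lfloor>m * t\<rfloor>\<close> by linarith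
          next
            case False
            then have "real i = real m - 1" using \<open>m \<ge> 1\<close> by (simp add: i_def of_nat_diff)
            moreover have "m * t \<le> m" using t by (simp add: mult_left_le)
            ultimately show ?thesis by simp
          qed
        qed
        have im: "real i / m \<in> {0..1}" using i by auto
        have d: "\<bar>t - real i / m\<bar> \<le> 1 / m"
        proof -
          have "t - real i / m = (m * t - i) / m" using m0 by (simp add: field_simps)
          then show ?thesis using it m0 by (simp add: abs_mult abs_divide divide_right_mono)
        qed
        have "\<bar>y t - y (real i / m)\<bar> \<le> C * \<bar>t - real i / m\<bar> powr K" using C t im by auto
        also have "\<dots> \<le> C * (1 / m) powr K" using d C0 assms(1) by (intro mult_left_mono powr_mono2) auto
        also have "(1 / real m) powr K = real m powr (-K)" by (simp add: powr_minus powr_divide inverse_eq_divide)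
        finally have yd: "\<bar>y t - y (real i / m)\<bar> \<le> C * real m powr (-K)" .
        define z where "z = y t - y (real i / m) + C * real m powr (-K)"
        have z: "0 \<le> z" "z \<le> 2 * C * real m powr (-K)" using yd by (auto simp: z_def)
        define j where "j = nat \<lfloor>m * z\<rfloor>"
        have j1: "real j = of_int \<lfloor>m * z\<rfloor>" using z by (simp add: j_def)
        have "m * z \<le> m * (2 * C * real m powr (-K))" using z m0 by simp
        also have "\<dots> = 2 * C * real m powr (1 - K)" using m0 by (simp add: powr_diff powr_minus field_simps)
        also have "\<dots> < J" by (rule J)
        finally have "j < J" using j1 by linarith
        have "real j \<le> m * z" "m * z \<le> real j + 1" using j1 by linarith+
        then have "real j / m \<le> z" "z \<le> (real j + 1) / m" using m0 by (auto simp: field_simps)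
        then have "(t, y t) \<in> sq i j"
          using it m0 by (auto simp: sq_def z_def field_simps)
        moreover have "i * J + j < m * J"
        proof -
          have "i * J + j < Suc i * J" using \<open>j < J\<close> by simp
          also have "\<dots> \<le> m * J" using i by (intro mult_right_mono) auto
          finally show ?thesis .
        qed
        ultimately have "(t, y t) \<in> U (i * J + j)" using \<open>j < J\<close> by (simp add: U_def)
        then show "\<exists>n. (t, y t) \<in> U n" by blast
      qed
      have "delta_cover \<delta> (path_graph y) U"
        unfolding delta_cover_def
        using cov bs that order_trans[OF ds that(3)] by (auto simp: U_def)
      then have "hausdorff_premeasure s \<delta> (path_graph y) \<le> (\<Sum>n. ennreal (diam_powr s (U n)))"
        unfolding hausdorff_premeasure_def by (intro INF_lower) auto
      also have "\<dots> = (\<Sum>n<m * J. ennreal (diam_powr s (U n)))"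
        by (intro suminf_finite) (auto simp: U_def diam_powr_def)
      also have "\<dots> \<le> (\<Sum>n<m * J. ennreal ((2 / real m) powr s))"
      proof (intro sum_mono ennreal_leI)
        fix n assume "n \<in> {..<m * J}"
        then show "diam_powr s (U n) \<le> (2 / real m) powr s"
          using s ds diameter_ge_0[OF bs] by (auto simp: diam_powr_def U_def intro!: powr_mono2)
      qed
      also have "\<dots> = ennreal (real (m * J) * (2 / real m) powr s)"
        by (simp add: ennreal_mult ennreal_of_nat_eq_real_of_nat)
      also have "\<dots> \<le> ennreal ((2 * C + 2) * 2 powr s * real m powr (-\<epsilon>))"
      proof (intro ennreal_leI)
        have "1 \<le> real m powr (1 - K)" using that assms by (intro ge_one_powr_ge_zero) auto
        then have "real J \<le> (2 * C + 2) * real m powr (1 - K)" using J by (simp add: algebra_simps)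
        then have "real (m * J) * (2 / real m) powr s \<le> real m * ((2 * C + 2) * real m powr (1 - K)) * (2 / real m) powr s"
          by (simp add: mult_left_mono mult_right_mono)
        also have "\<dots> = (2 * C + 2) * 2 powr s * (real m powr 1 * real m powr (1 - K) / real m powr s)"
          using m0 by (simp add: powr_divide)
        also have "real m powr 1 * real m powr (1 - K) / real m powr s = real m powr (-\<epsilon>)"
          unfolding powr_add[symmetric] powr_diff[symmetric] by (simp add: s_def)
        finally show "real (m * J) * (2 / real m) powr s \<le> (2 * C + 2) * 2 powr s * real m powr (-\<epsilon>)" .
      qed
      finally show ?thesis .
    qed
    have "hausdorff_premeasure s \<delta> (path_graph y) = 0" if "\<delta> > 0" for \<delta>
    proof -
      have "(\<lambda>m. (2 * C + 2) * 2 powr s * real m powr (-\<epsilon>)) \<longlonglongrightarrow> (2 * C + 2) * 2 powr s * 0"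
        using \<epsilon> by (intro tendsto_mult tendsto_const tendsto_neg_powr filterlim_real_sequentially) auto
      then have "(\<lambda>m. ennreal ((2 * C + 2) * 2 powr s * real m powr (-\<epsilon>))) \<longlonglongrightarrow> ennreal 0"
        by (intro tendsto_ennrealI) simp
      moreover have "eventually (\<lambda>m::nat. hausdorff_premeasure s \<delta> (path_graph y) \<le> ennreal ((2 * C + 2) * 2 powr s * real m powr (-\<epsilon>))) sequentially"
      proof -
        have "eventually (\<lambda>m::nat. m \<ge> nat \<lceil>2 / \<delta>\<rceil> + 1) sequentially" by (rule eventually_ge_at_top)
        then show ?thesis
        proof eventually_elim
          case (elim m)
          then have "real m \<ge> 2 / \<delta>" "m \<ge> 1" by linarith+
          then show ?case using bound[of \<delta> m] that by (auto simp: field_simps)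
        qed
      qed
      ultimately have "hausdorff_premeasure s \<delta> (path_graph y) \<le> ennreal 0"
        by (intro tendsto_lowerbound[where F=sequentially]) auto
      then show ?thesis by simp
    qed
    then have "hausdorff_measure s (path_graph y) = 0"
      unfolding hausdorff_measure_def by (intro antisym SUP_least) auto
    then have "hausdorff_dim (path_graph y) \<le> ereal s"
      unfolding hausdorff_dim_def using s by (intro Inf_lower) auto
    then show ?thesis by (simp add: s_def)
  qed
qed

section \<open>Hoelder continuity of fractional Brownian paths\<close>

lemma floor_double_cases:
  fixes x :: real
  shows "\<lfloor>2 * x\<rfloor> = 2 * \<lfloor>x\<rfloor> \<or> \<lfloor>2 * x\<rfloor> = 2 * \<lfloor>x\<rfloor> + 1"
  by linarith

text \<open>Chaining. Successive dyadic approximations from below are equal or differ by one step of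
  the finer grid, so the distance from \<open>f (d t m)\<close> to \<open>f t\<close> is a geometric
  tail in \<open>q = 2 powr (-h)\<close>; continuity is used only to pass to the limit. Two points
  at distance of order 2^(-m) have equal or adjacent approximations at level m.\<close>

lemma holder_on_of_dyadic_increments:
  fixes f :: "real \<Rightarrow> real"
  assumes h: "0 < h" "h \<le> 1" and cont: "continuous_on {0..1} f" and A: "A \<ge> 0"
    and inc: "\<And>m i. i < 2 ^ m \<Longrightarrow> \<bar>f ((real i + 1) / 2 ^ m) - f (real i / 2 ^ m)\<bar> \<le> A * (2 powr (-h)) ^ m"
  shows "holder_on h {0..1} f"
proof -
  define q where "q = 2 powr (-h)"
  have q: "0 < q" "q < 1" using h by (auto simp: q_def powr_less_one)
  define d where "d t m = real (nat \<lfloor>2 ^ m * t\<rfloor>) / 2 ^ m" for t :: real and m :: nat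
  have d_le: "0 \<le> d t m" "d t m \<le> t" "t - d t m \<le> 1 / 2 ^ m" if "t \<in> {0..1}" for t m
  proof -
    have fl: "real (nat \<lfloor>2 ^ m * t\<rfloor>) = of_int \<lfloor>2 ^ m * t\<rfloor>" using that by simp
    have "of_int \<lfloor>2 ^ m * t\<rfloor> \<le> 2 ^ m * t" "2 ^ m * t \<le> of_int \<lfloor>2 ^ m * t\<rfloor> + 1" by linarith+
    moreover have "t - of_int \<lfloor>2 ^ m * t\<rfloor> / 2 ^ m = (2 ^ m * t - of_int \<lfloor>2 ^ m * t\<rfloor>) / 2 ^ m"
      by (simp add: field_simps)
    ultimately show "0 \<le> d t m" "d t m \<le> t" "t - d t m \<le> 1 / 2 ^ m"
      unfolding d_def fl using that by (simp_all add: divide_right_mono pos_divide_le_eq mult.commute) linarith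
  qed
  have step: "\<bar>f (d t (Suc m)) - f (d t m)\<bar> \<le> A * q ^ Suc m" if "t \<in> {0..1}" for t m
  proof -
    define i where "i = nat \<lfloor>2 ^ m * t\<rfloor>"
    have "\<lfloor>2 ^ m * t\<rfloor> \<ge> 0" using that by simp
    then have "nat \<lfloor>2 ^ Suc m * t\<rfloor> = 2 * i \<or> nat \<lfloor>2 ^ Suc m * t\<rfloor> = 2 * i + 1"
      using floor_double_cases[of "2 ^ m * t"] by (auto simp: i_def mult.assoc nat_add_distrib nat_mult_distrib)
    then consider "d t (Suc m) = d t m" | "d t (Suc m) = (real (2 * i) + 1) / 2 ^ Suc m" "nat \<lfloor>2 ^ Suc m * t\<rfloor> = 2 * i + 1"
      by (auto simp: d_def i_def)
    then show ?thesis
    proof cases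
      case 1
      then show ?thesis using A q by simp
    next
      case 2
      have dm: "d t m = real (2 * i) / 2 ^ Suc m" by (simp add: d_def i_def)
      have "real (2 * i + 1) \<le> 2 ^ Suc m * t" using 2(2) that by linarith
      also have "\<dots> \<le> 2 ^ Suc m" using that by (simp add: mult_left_le)
      finally have "real (2 * i + 1) \<le> real (2 ^ Suc m)" by simp
      then have "2 * i < 2 ^ Suc m" unfolding of_nat_le_iff by simp
      then show ?thesis using inc[of "2 * i" "Suc m"] unfolding 2(1) dm q_def by simp
    qed
  qed
  have tail: "\<bar>f (d t (m + n)) - f (d t m)\<bar> \<le> A * q ^ m / (1 - q)" if "t \<in> {0..1}" for t m n
  proof -
    have "\<bar>f (d t (m + n)) - f (d t m)\<bar> \<le> A * q ^ m * (\<Sum>j<n. q ^ j)"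
    proof (induction n)
      case (Suc n)
      have "A * q ^ Suc (m + n) \<le> A * q ^ m * q ^ n"
        using A q by (simp add: power_add mult_left_mono mult_left_le_one_le mult.assoc)
      then show ?case using Suc step[OF that, of "m + n"] by (simp add: distrib_left)
    qed simp
    also have "(\<Sum>j<n. q ^ j) \<le> 1 / (1 - q)"
      using q by (simp add: sum_gp_strict divide_right_mono)
    finally show ?thesis using A q by (simp add: mult_left_mono)
  qed
  have lim: "(\<lambda>n. f (d t (m + n))) \<longlonglongrightarrow> f t" if t: "t \<in> {0..1}" for t m
  proof -
    have "(\<lambda>n. d t n) \<longlonglongrightarrow> t"
    proof (rule tendsto_sandwich[where f = "\<lambda>n. t - (1/2) ^ n" and h = "\<lambda>_. t"])
      show "(\<lambda>n. t - (1/2) ^ n) \<longlonglongrightarrow> t"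
        by (rule tendsto_eq_intros LIMSEQ_power_zero | simp)+
    qed (use d_le[OF t] in \<open>auto simp: power_one_over algebra_simps\<close>)
    then have "(\<lambda>n. f (d t n)) \<longlonglongrightarrow> f t"
      using d_le[OF t] t
      by (intro continuous_on_tendsto_compose[OF cont]) (auto intro!: eventuallyI intro: order_trans)
    then show ?thesis using LIMSEQ_ignore_initial_segment[of _ _ m] by (simp add: add.commute)
  qed
  have near: "\<bar>f t - f (d t m)\<bar> \<le> A * q ^ m / (1 - q)" if "t \<in> {0..1}" for t m
  proof (rule tendsto_upperbound)
    show "(\<lambda>n. \<bar>f (d t (m + n)) - f (d t m)\<bar>) \<longlonglongrightarrow> \<bar>f t - f (d t m)\<bar>"
      by (intro tendsto_intros lim that)
  qed (use tail[OF that] in auto)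
  \<comment> \<open>Two tails and one grid step; the division by \<open>q\<close> pays for replacing
    \<open>q ^ m\<close> by \<open>q ^ Suc m\<close>.\<close>
  define C where "C = (2 * A / (1 - q) + A) / q"
  have C: "C \<ge> 0" using A q by (simp add: C_def)
  have main: "\<bar>f t - f s\<bar> \<le> C * \<bar>t - s\<bar> powr h" if st: "s \<in> {0..1}" "t \<in> {0..1}" "s < t" for s t
  proof -
    \<comment> \<open>The level with 2^(-(m + 1)) < t - s \<le> 2^(-m): the upper estimate makes the
      approximations adjacent, the lower one turns \<open>q ^ Suc m\<close> into a power of the
      distance.\<close>
    define m where "m = nat \<lfloor>- log 2 (t - s)\<rfloor>"
    have l0: "- log 2 (t - s) \<ge> 0" using st by simp
    have m: "real m \<le> - log 2 (t - s)" "- log 2 (t - s) < real m + 1"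
      using l0 by (auto simp: m_def)
    have "t - s = 2 powr (log 2 (t - s))" using st by simp
    also have "\<dots> \<le> 2 powr (- real m)" using m by simp
    finally have ts: "t - s \<le> 1 / 2 ^ m" by (simp add: powr_minus powr_realpow inverse_eq_divide)
    have qts: "q ^ Suc m \<le> (t - s) powr h"
    proof -
      have "q ^ Suc m = q powr (real (Suc m))" using q by (simp only: powr_realpow)
      also have "\<dots> = 2 powr (- h * real (Suc m))" by (simp only: q_def powr_powr)
      also have "\<dots> \<le> 2 powr (log 2 (t - s) * h)"
      proof (intro powr_mono)
        have "h * (- log 2 (t - s)) \<le> h * real (Suc m)" using m h by (intro mult_left_mono) auto
        then show "- h * real (Suc m) \<le> log 2 (t - s) * h" by (simp only: mult_minus_left mult_minus_right mult.commute)
      qed simp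
      also have "\<dots> = (t - s) powr h" using st by (simp add: powr_powr[symmetric])
      finally show ?thesis .
    qed
    have "\<bar>f (d t m) - f (d s m)\<bar> \<le> A * q ^ m"
    proof -
      define i where "i = nat \<lfloor>2 ^ m * s\<rfloor>"
      have ms: "2 ^ m * s \<ge> 0" using st by simp
      have "2 ^ m * t \<le> 2 ^ m * s + 1" "2 ^ m * s \<le> 2 ^ m * t" using ts st by (simp_all add: field_simps)
      then have "nat \<lfloor>2 ^ m * t\<rfloor> = i \<or> nat \<lfloor>2 ^ m * t\<rfloor> = i + 1" using ms unfolding i_def by linarith
      then show ?thesis
      proof
        assume "nat \<lfloor>2 ^ m * t\<rfloor> = i"
        then show ?thesis using A q by (simp add: d_def i_def)
      next
        assume *: "nat \<lfloor>2 ^ m * t\<rfloor> = i + 1"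
        then have "real (i + 1) \<le> 2 ^ m * t" using st by linarith
        also have "\<dots> \<le> 2 ^ m" using st by (simp add: mult_left_le)
        finally have "real (i + 1) \<le> real (2 ^ m)" by simp
        then have "i < 2 ^ m" unfolding of_nat_le_iff by simp
        moreover have "d t m = (real i + 1) / 2 ^ m" "d s m = real i / 2 ^ m"
          by (simp_all add: d_def * i_def[symmetric] add.commute)
        ultimately show ?thesis using inc[of i m] by (simp add: q_def)
      qed
    qed
    then have "\<bar>f t - f s\<bar> \<le> A * q ^ m / (1 - q) + A * q ^ m / (1 - q) + A * q ^ m"
      using near[OF st(1), of m] near[OF st(2), of m] by linarith
    also have "\<dots> = (2 * A / (1 - q) + A) * q ^ m" by (simp add: algebra_simps)
    also have "\<dots> = C * q ^ Suc m" using q by (simp add: C_def)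
    also have "\<dots> \<le> C * (t - s) powr h" using C qts by (rule mult_left_mono[rotated])
    finally show ?thesis using st by simp
  qed
  show ?thesis
    unfolding holder_on_def dist_real_def
  proof (intro exI[of _ C] conjI ballI C)
    fix x y :: real assume "x \<in> {0..1}" "y \<in> {0..1}"
    then show "\<bar>f x - f y\<bar> \<le> C * \<bar>x - y\<bar> powr h"
      using main[of x y] main[of y x] by (cases x y rule: linorder_cases) (auto simp: abs_minus_commute)
  qed
qed

section \<open>Centred Gaussian variables and linear combinations of the process\<close>

lemma gaussian_rv_centered_cases:
  assumes "prob_space M" "gaussian_rv M X" "(\<integral>\<omega>. X \<omega> \<partial>M) = 0" "(\<integral>\<omega>. (X \<omega>)\<^sup>2 \<partial>M) = v"
  shows "(v > 0 \<and> distributed M lborel X (normal_density 0 (sqrt v))) \<or> (v = 0 \<and> (AE \<omega> in M. X \<omega> = 0))"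
proof -
  interpret prob_space M by fact
  have [measurable]: "X \<in> borel_measurable M" using assms by (simp add: gaussian_rv_def)
  from assms(2) obtain \<mu> \<sigma> where "(\<sigma> > 0 \<and> distributed M lborel X (normal_density \<mu> \<sigma>)) \<or> distr M borel X = return borel \<mu>"
    by (auto simp: gaussian_rv_def)
  then show ?thesis
  proof
    assume *: "\<sigma> > 0 \<and> distributed M lborel X (normal_density \<mu> \<sigma>)"
    then have "\<mu> = 0" using normal_distributed_expectation[of \<sigma> X \<mu>] assms(3) by simp
    moreover have "variance X = \<sigma>\<^sup>2" using normal_distributed_variance[of \<sigma> X \<mu>] * by simp
    ultimately show ?thesis using * assms(3,4) by (auto simp: real_sqrt_unique)
  next
    assume *: "distr M borel X = return borel \<mu>"
    have "AE x in distr M borel X. x = \<mu>" unfolding * by (simp add: AE_return)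
    then have ae: "AE \<omega> in M. X \<omega> = \<mu>" by (subst (asm) AE_distr_iff) auto
    then have "(\<integral>\<omega>. X \<omega> \<partial>M) = (\<integral>\<omega>. \<mu> \<partial>M)" by (intro integral_cong_AE) auto
    then have "\<mu> = 0" using assms(3) by (simp add: prob_space)
    with ae have ae0: "AE \<omega> in M. X \<omega> = 0" by simp
    then have "(\<integral>\<omega>. (X \<omega>)\<^sup>2 \<partial>M) = (\<integral>\<omega>. 0 \<partial>M)" by (intro integral_cong_AE) auto
    then show ?thesis using ae0 assms(4) by simp
  qed
qed

text \<open>The exact moment is \<open>fact (2 * k) / (2 ^ k * fact k) * v ^ k\<close>; the
  denominator is at least 1 and is dropped. The bound is for the nonnegative integral, so that it
  yields integrability as well.\<close>

lemma nn_integral_even_moment_le: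
  assumes "prob_space M" "gaussian_rv M X" "(\<integral>\<omega>. X \<omega> \<partial>M) = 0" "(\<integral>\<omega>. (X \<omega>)\<^sup>2 \<partial>M) = v" "k > 0"
  shows "(\<integral>\<^sup>+\<omega>. ennreal ((X \<omega>) ^ (2 * k)) \<partial>M) \<le> ennreal (fact (2 * k) * v ^ k)"
proof -
  have [measurable]: "X \<in> borel_measurable M" using assms by (simp add: gaussian_rv_def)
  from gaussian_rv_centered_cases[OF assms(1-4)] show ?thesis
  proof (elim disjE conjE)
    assume v: "v > 0" and D: "distributed M lborel X (normal_density 0 (sqrt v))"
    have "(\<integral>\<^sup>+\<omega>. ennreal ((X \<omega>) ^ (2 * k)) \<partial>M) = (\<integral>\<^sup>+x. ennreal (normal_density 0 (sqrt v) x) * ennreal (x ^ (2 * k)) \<partial>lborel)"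
      by (rule distributed_nn_integral[OF D, symmetric]) auto
    also have "\<dots> = (\<integral>\<^sup>+x. ennreal (normal_density 0 (sqrt v) x * (x - 0) ^ (2 * k)) \<partial>lborel)"
      by (simp add: ennreal_mult)
    also have "\<dots> = ennreal (fact (2 * k) / ((2 / (sqrt v)\<^sup>2) ^ k * fact k))"
      using normal_moment_even[of "sqrt v" 0 k] v
      by (subst nn_integral_eq_integral) (auto simp: has_bochner_integral_iff zero_le_even_power)
    also have "\<dots> \<le> ennreal (fact (2 * k) * v ^ k)"
    proof (intro ennreal_leI)
      have "(1::real) * 1 \<le> 2 ^ k * fact k" by (intro mult_mono) (auto simp: fact_ge_1)
      then have "fact (2 * k) * v ^ k / (2 ^ k * fact k) \<le> fact (2 * k) * v ^ k / 1"
        using v by (intro divide_left_mono) auto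
      then show "fact (2 * k) / ((2 / (sqrt v)\<^sup>2) ^ k * fact k) \<le> fact (2 * k) * v ^ k"
        using v by (simp add: power_divide)
    qed
    finally show ?thesis .
  next
    assume v: "v = 0" and "AE \<omega> in M. X \<omega> = 0"
    then have "(\<integral>\<^sup>+\<omega>. ennreal ((X \<omega>) ^ (2 * k)) \<partial>M) = (\<integral>\<^sup>+\<omega>. 0 \<partial>M)"
      using assms(5) by (intro nn_integral_cong_AE) auto
    then show ?thesis by simp
  qed
qed

text \<open>The prescribed mean and covariance are Bochner integrals, which by themselves do not
  give integrability. That comes from the Gaussian laws: second moments are finite, and products are
  dominated by sums of squares. Only then may the square of the sum be integrated term by
  term.\<close>

lemma fbm_combination:
  assumes "fractional_brownian_motion M H W" "prob_space M" "finite F" "F \<subseteq> {0..1}"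
  shows "gaussian_rv M (\<lambda>\<omega>. \<Sum>t\<in>F. c t * W t \<omega>)"
    and "(\<integral>\<omega>. (\<Sum>t\<in>F. c t * W t \<omega>) \<partial>M) = 0"
    and "(\<integral>\<omega>. (\<Sum>t\<in>F. c t * W t \<omega>)\<^sup>2 \<partial>M)
      = (\<Sum>s\<in>F. \<Sum>t\<in>F. c s * c t * ((s powr (2 * H) + t powr (2 * H) - \<bar>t - s\<bar> powr (2 * H)) / 2))"
proof -
  interpret prob_space M by fact
  have gp: "\<And>F c. finite F \<Longrightarrow> F \<subseteq> {0..1} \<Longrightarrow> gaussian_rv M (\<lambda>\<omega>. \<Sum>t\<in>F. c t * W t \<omega>)"
    and mean: "\<And>t. t \<in> {0..1} \<Longrightarrow> (\<integral>\<omega>. W t \<omega> \<partial>M) = 0"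
    and cov: "\<And>s t. s \<in> {0..1} \<Longrightarrow> t \<in> {0..1} \<Longrightarrow> (\<integral>\<omega>. W s \<omega> * W t \<omega> \<partial>M)
      = (s powr (2 * H) + t powr (2 * H) - \<bar>t - s\<bar> powr (2 * H)) / 2"
    using assms(1) by (auto simp: fractional_brownian_motion_def gaussian_process_def)
  show "gaussian_rv M (\<lambda>\<omega>. \<Sum>t\<in>F. c t * W t \<omega>)" using gp assms by simp
  have g1: "gaussian_rv M (W t)" if "t \<in> {0..1}" for t
    using gp[of "{t}" "\<lambda>_. 1"] that by simp
  have [measurable]: "W t \<in> borel_measurable M" if "t \<in> {0..1}" for t
    using g1[OF that] by (simp add: gaussian_rv_def)
  have sq: "integrable M (\<lambda>\<omega>. (W t \<omega>)\<^sup>2)" if "t \<in> {0..1}" for t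
  proof (rule integrableI_nonneg)
    have "(\<integral>\<^sup>+\<omega>. ennreal ((W t \<omega>) ^ (2 * 1)) \<partial>M) \<le> ennreal (fact (2 * 1) * (\<integral>\<omega>. (W t \<omega>)\<^sup>2 \<partial>M) ^ 1)"
      by (rule nn_integral_even_moment_le[OF assms(2) g1[OF that] mean[OF that] refl]) simp
    also have "\<dots> < \<infinity>" by simp
    finally show "(\<integral>\<^sup>+\<omega>. ennreal ((W t \<omega>)\<^sup>2) \<partial>M) < \<infinity>" by simp
  qed (use that in auto)
  have int2: "integrable M (\<lambda>\<omega>. W s \<omega> * W t \<omega>)" if "s \<in> {0..1}" "t \<in> {0..1}" for s t
  proof (rule Bochner_Integration.integrable_bound)
    show "integrable M (\<lambda>\<omega>. (W s \<omega>)\<^sup>2 + (W t \<omega>)\<^sup>2)" using sq that by simp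
    have "\<bar>x * y\<bar> \<le> x\<^sup>2 + y\<^sup>2" for x y :: real
      using sum_squares_bound[of "\<bar>x\<bar>" "\<bar>y\<bar>"] mult_nonneg_nonneg[of "\<bar>x\<bar>" "\<bar>y\<bar>"]
      unfolding abs_mult power2_abs mult.assoc by linarith
    then show "AE \<omega> in M. norm (W s \<omega> * W t \<omega>) \<le> norm ((W s \<omega>)\<^sup>2 + (W t \<omega>)\<^sup>2)" by simp
  qed (use that in auto)
  have int1: "integrable M (W t)" if "t \<in> {0..1}" for t
    by (rule square_integrable_imp_integrable) (use sq that in auto)
  show "(\<integral>\<omega>. (\<Sum>t\<in>F. c t * W t \<omega>) \<partial>M) = 0"
    using assms(4) int1 mean by (subst Bochner_Integration.integral_sum) (auto simp: subset_iff)
  have "(\<integral>\<omega>. (\<Sum>t\<in>F. c t * W t \<omega>)\<^sup>2 \<partial>M) = (\<integral>\<omega>. (\<Sum>s\<in>F. \<Sum>t\<in>F. c s * c t * (W s \<omega> * W t \<omega>)) \<partial>M)"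
    by (simp add: power2_eq_square sum_product mult_ac)
  also have "\<dots> = (\<Sum>s\<in>F. \<Sum>t\<in>F. c s * c t * (\<integral>\<omega>. W s \<omega> * W t \<omega> \<partial>M))"
    using assms(4) int2 by (subst Bochner_Integration.integral_sum) (auto simp: subset_iff intro!: Bochner_Integration.integrable_sum sum.cong)
  also have "\<dots> = (\<Sum>s\<in>F. \<Sum>t\<in>F. c s * c t * ((s powr (2 * H) + t powr (2 * H) - \<bar>t - s\<bar> powr (2 * H)) / 2))"
    using assms(4) by (intro sum.cong refl) (auto simp: cov subset_iff)
  finally show "(\<integral>\<omega>. (\<Sum>t\<in>F. c t * W t \<omega>)\<^sup>2 \<partial>M)
      = (\<Sum>s\<in>F. \<Sum>t\<in>F. c s * c t * ((s powr (2 * H) + t powr (2 * H) - \<bar>t - s\<bar> powr (2 * H)) / 2))" .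
qed

lemma fbm_increment_moment_le:
  assumes "fractional_brownian_motion M H W" "prob_space M" "s \<in> {0..1}" "t \<in> {0..1}" "k > 0"
  shows "(\<integral>\<^sup>+\<omega>. ennreal ((W t \<omega> - W s \<omega>) ^ (2 * k)) \<partial>M) \<le> ennreal (fact (2 * k) * (\<bar>t - s\<bar> powr (2 * H)) ^ k)"
proof (cases "s = t")
  case False
  define c where "c u = (if u = t then 1 else -1 :: real)" for u
  have X: "(\<lambda>\<omega>. \<Sum>u\<in>{s, t}. c u * W u \<omega>) = (\<lambda>\<omega>. W t \<omega> - W s \<omega>)"
    using False by (auto simp: c_def)
  note comb = fbm_combination[OF assms(1,2), of "{s, t}" c, unfolded X]
  have "(\<integral>\<omega>. (W t \<omega> - W s \<omega>)\<^sup>2 \<partial>M) = \<bar>t - s\<bar> powr (2 * H)"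
    using comb(3) assms(3,4) False by (simp add: c_def abs_minus_commute field_simps)
  then show ?thesis
    using comb(1,2) assms by (intro nn_integral_even_moment_le) auto
qed (use assms in \<open>simp add: zero_power\<close>)

text \<open>Kolmogorov's argument with all increments collected in one variable. \<open>Z\<close>
  sums the 2k-th powers of the dyadic increments with weight 2^(2 k h m) at level m; the 2^m
  increments there have 2k-th moments of order 2^(-2 k H m), so a geometric series of ratio
  \<open>r\<close> bounds the expectation. Wherever \<open>Z\<close> is finite it controls every
  increment at once.\<close>

lemma fbm_AE_holder:
  assumes W: "fractional_brownian_motion M H W" and M: "prob_space M" and h: "0 < h" "h < H" "H < 1"
  shows "AE \<omega> in M. holder_on h {0..1} (\<lambda>t. W t \<omega>)"
proof -
  interpret prob_space M by fact
  \<comment> \<open>The moment must be high enough that the gain 2^(-2 k (H - h) m) beats the number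
    2^m of increments, that is, \<open>r < 1\<close>.\<close>
  obtain k :: nat where k: "real k > 1 / (2 * (H - h))" using reals_Archimedean2 by blast
  have "1 / (2 * (H - h)) > 0" using h by simp
  with k have k0: "k > 0" by (metis less_trans of_nat_0_less_iff)
  have kH: "2 * real k * (H - h) > 1" using k h by (simp add: field_simps)
  have Wm [measurable]: "W t \<in> borel_measurable M" if "t \<in> {0..1}" for t
    using fbm_combination(1)[OF W M, of "{t}" "\<lambda>_. 1"] that by (simp add: gaussian_rv_def)
  have pts: "real i / 2 ^ m \<in> {0..1}" "(real i + 1) / 2 ^ m \<in> {0..1}" if "i < 2 ^ m" for i m :: nat
  proof -
    have "real (Suc i) \<le> real (2 ^ m)" using that by (simp only: of_nat_le_iff Suc_le_eq)
    then have "real i + 1 \<le> 2 ^ m" by simp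
    then show "real i / 2 ^ m \<in> {0..1}" "(real i + 1) / 2 ^ m \<in> {0..1}" using that by (auto simp: less_imp_le)
  qed
  define \<Delta> where "\<Delta> m i \<omega> = W ((real i + 1) / 2 ^ m) \<omega> - W (real i / 2 ^ m) \<omega>" for m i :: nat and \<omega>
  have \<Delta>m [measurable]: "\<Delta> m i \<in> borel_measurable M" if "i < 2 ^ m" for m i
    unfolding \<Delta>_def using pts[OF that] by measurable
  define a where "a m = (2 powr (2 * real k * h)) ^ m" for m :: nat
  define Z where "Z \<omega> = (\<Sum>m. \<Sum>i<2 ^ m. ennreal (a m) * ennreal (\<Delta> m i \<omega> ^ (2 * k)))" for \<omega>
  define r where "r = 2 powr (1 - 2 * real k * (H - h))"
  have r: "0 < r" "r < 1" using kH by (auto simp: r_def powr_less_one)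
  have Tm: "(\<lambda>\<omega>. \<Sum>i<2 ^ m. ennreal (a m) * ennreal (\<Delta> m i \<omega> ^ (2 * k))) \<in> borel_measurable M" for m
    by (intro borel_measurable_sum) auto
  have "(\<integral>\<^sup>+\<omega>. Z \<omega> \<partial>M) = (\<Sum>m. \<Sum>i<2 ^ m. ennreal (a m) * (\<integral>\<^sup>+\<omega>. ennreal (\<Delta> m i \<omega> ^ (2 * k)) \<partial>M))"
  proof -
    have "(\<integral>\<^sup>+\<omega>. Z \<omega> \<partial>M) = (\<Sum>m. \<integral>\<^sup>+\<omega>. (\<Sum>i<2 ^ m. ennreal (a m) * ennreal (\<Delta> m i \<omega> ^ (2 * k))) \<partial>M)"
      unfolding Z_def by (intro nn_integral_suminf Tm)
    also have "\<dots> = (\<Sum>m. \<Sum>i<2 ^ m. ennreal (a m) * (\<integral>\<^sup>+\<omega>. ennreal (\<Delta> m i \<omega> ^ (2 * k)) \<partial>M))"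
      by (intro suminf_cong) (subst nn_integral_sum, auto intro!: sum.cong nn_integral_cmult)
    finally show ?thesis .
  qed
  also have "\<dots> \<le> (\<Sum>m. ennreal (fact (2 * k) * r ^ m))"
  proof (intro suminf_le)
    fix m :: nat
    have "(\<Sum>i<2 ^ m. ennreal (a m) * (\<integral>\<^sup>+\<omega>. ennreal (\<Delta> m i \<omega> ^ (2 * k)) \<partial>M))
        \<le> (\<Sum>i<(2::nat) ^ m. ennreal (a m) * ennreal (fact (2 * k) * ((1 / 2 ^ m) powr (2 * H)) ^ k))"
    proof (intro sum_mono mult_left_mono)
      fix i assume "i \<in> {..<(2::nat) ^ m}"
      then have i: "i < 2 ^ m" by simp
      have "\<bar>(real i + 1) / 2 ^ m - real i / 2 ^ m\<bar> = 1 / 2 ^ m" by (simp add: diff_divide_distrib[symmetric])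
      then show "(\<integral>\<^sup>+\<omega>. ennreal (\<Delta> m i \<omega> ^ (2 * k)) \<partial>M) \<le> ennreal (fact (2 * k) * ((1 / 2 ^ m) powr (2 * H)) ^ k)"
        using fbm_increment_moment_le[OF W M pts[OF i] k0] by (simp add: \<Delta>_def)
    qed simp
    also have "\<dots> = ennreal (2 ^ m * (a m * (fact (2 * k) * ((1 / 2 ^ m) powr (2 * H)) ^ k)))"
      by (simp add: ennreal_mult a_def ennreal_of_nat_eq_real_of_nat)
    also have "2 ^ m * (a m * (fact (2 * k) * ((1 / 2 ^ m) powr (2 * H)) ^ k)) = fact (2 * k) * r ^ m"
    proof -
      have "((1 / 2 ^ m) powr (2 * H)) ^ k = ((1 / 2 ^ m) powr (2 * H)) powr (real k)"
        by (simp add: powr_realpow)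
      also have "\<dots> = (2 powr (- real m)) powr (2 * H * k)"
        by (simp add: powr_powr powr_minus powr_realpow inverse_eq_divide)
      also have "\<dots> = 2 powr (- (real m * (2 * H * k)))" by (simp add: powr_powr)
      finally have e1: "((1 / 2 ^ m) powr (2 * H)) ^ k = 2 powr (- (real m * (2 * H * k)))" .
      have e2: "a m = 2 powr (2 * real k * h * m)" by (simp add: a_def powr_powr powr_realpow[symmetric])
      have e3: "r ^ m = 2 powr ((1 - 2 * real k * (H - h)) * m)" by (simp add: r_def powr_powr powr_realpow[symmetric])
      have e4: "(2::real) ^ m = 2 powr m" by (simp add: powr_realpow)
      have "2 powr m * (2 powr (2 * real k * h * m) * 2 powr (- (real m * (2 * H * k)))) = 2 powr ((1 - 2 * real k * (H - h)) * m)"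
        unfolding powr_add[symmetric] by (simp add: algebra_simps)
      then show ?thesis unfolding e1 e2 e3 unfolding e4 by (simp add: mult_ac)
    qed
    finally show "(\<Sum>i<2 ^ m. ennreal (a m) * (\<integral>\<^sup>+\<omega>. ennreal (\<Delta> m i \<omega> ^ (2 * k)) \<partial>M)) \<le> ennreal (fact (2 * k) * r ^ m)" .
  qed auto
  also have "\<dots> < \<infinity>"
    using r by (subst suminf_ennreal2) (auto intro!: summable_mult summable_geometric)
  finally have "(\<integral>\<^sup>+\<omega>. Z \<omega> \<partial>M) < \<infinity>" .
  moreover have "Z \<in> borel_measurable M" unfolding Z_def by (rule borel_measurable_suminf_order[OF Tm])
  ultimately have "AE \<omega> in M. Z \<omega> \<noteq> \<infinity>" by (intro nn_integral_noteq_infinite) auto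
  then show ?thesis
    using AE_space
  proof eventually_elim
    case (elim \<omega>)
    define z where "z = enn2real (Z \<omega>)"
    have z: "Z \<omega> = ennreal z" "z \<ge> 0" using elim by (auto simp: z_def ennreal_enn2real_if)
    \<comment> \<open>The Hoelder constant depends on the path: each weighted increment is at most
      the 2k-th root of the value of \<open>Z\<close>.\<close>
    define A where "A = root (2 * k) z"
    have A: "A \<ge> 0" "A ^ (2 * k) = z" using z k0 by (auto simp: A_def)
    show ?case
    proof (rule holder_on_of_dyadic_increments[OF _ _ _ A(1)])
      show "continuous_on {0..1} (\<lambda>t. W t \<omega>)" using W elim by (auto simp: fractional_brownian_motion_def)
      fix m i :: nat assume i: "i < 2 ^ m"
      have "ennreal (a m) * ennreal (\<Delta> m i \<omega> ^ (2 * k)) \<le> (\<Sum>i<2 ^ m. ennreal (a m) * ennreal (\<Delta> m i \<omega> ^ (2 * k)))"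
        using i by (intro member_le_sum) auto
      also have "\<dots> \<le> Z \<omega>" unfolding Z_def
        using sum_le_suminf[of "\<lambda>m. \<Sum>i<2 ^ m. ennreal (a m) * ennreal (\<Delta> m i \<omega> ^ (2 * k))" "{m}"] by simp
      finally have "a m * \<Delta> m i \<omega> ^ (2 * k) \<le> z"
        using z by (simp add: ennreal_mult[symmetric] a_def zero_le_even_power)
      moreover have "a m * \<Delta> m i \<omega> ^ (2 * k) = ((2 powr h) ^ m * \<bar>\<Delta> m i \<omega>\<bar>) ^ (2 * k)"
      proof -
        have "2 powr (2 * real k * h) = (2 powr h) ^ (2 * k)"
          by (simp add: powr_powr powr_realpow[symmetric] mult_ac)
        then show ?thesis
          by (simp add: a_def power_mult_distrib power_even_abs power_mult[symmetric] mult.commute)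
      qed
      ultimately have "((2 powr h) ^ m * \<bar>\<Delta> m i \<omega>\<bar>) ^ (2 * k) \<le> A ^ (2 * k)" using A by simp
      then have "(2 powr h) ^ m * \<bar>\<Delta> m i \<omega>\<bar> \<le> A"
        using A k0 by (subst (asm) power_mono_iff) auto
      then have "\<bar>\<Delta> m i \<omega>\<bar> \<le> A * (2 powr (-h)) ^ m"
        by (simp add: powr_minus power_inverse field_simps)
      then show "\<bar>W ((real i + 1) / 2 ^ m) \<omega> - W (real i / 2 ^ m) \<omega>\<bar> \<le> A * (2 powr (-h)) ^ m"
        by (simp add: \<Delta>_def)
    qed (use h in auto)
  qed
qed

section \<open>Spectral representation of the covariance\<close>

lemma nn_integral_powr_unit:
  assumes "a > (-1::real)"
  shows "(\<integral>\<^sup>+x. ennreal (x powr a) * indicator {0..1} x \<partial>lborel) = ennreal (1 / (a + 1))"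
  using nn_integral_has_integral_lebesgue'[OF _ has_integral_powr_from_0[OF assms, of 1]] by simp

lemma nn_integral_powr_atLeast:
  assumes "e < (-1::real)" "a > 0"
  shows "(\<integral>\<^sup>+x. ennreal (x powr e) * indicator {a..} x \<partial>lborel) = ennreal (- (a powr (e + 1)) / (e + 1))"
  using nn_integral_has_integral_lebesgue'[OF _ has_integral_powr_to_inf[OF assms]] by simp

text \<open>Integrand of the representation of |x|^p as a mixture of the functions 1 - cos(\<xi> x)
  over \<xi> > 0. It is applied with p equal to 2 H, 1 and 2 - 2 H, all strictly between 0 and
  2.\<close>

definition spectral_density :: "real \<Rightarrow> real \<Rightarrow> real \<Rightarrow> real" where
  "spectral_density p x \<xi> = indicator {0<..} \<xi> * ((1 - cos (\<xi> * x)) * \<xi> powr (-1 - p))"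

definition spectral_const :: "real \<Rightarrow> real" where
  "spectral_const p = (LINT \<xi>|lborel. spectral_density p 1 \<xi>)"

lemma spectral_density_nonneg: "0 \<le> spectral_density p x \<xi>"
  by (auto simp: spectral_density_def indicator_def)

lemma spectral_density_measurable [measurable]: "spectral_density p x \<in> borel_measurable borel"
  unfolding spectral_density_def by measurable

lemma one_minus_cos_le: "1 - cos x \<le> (x::real)\<^sup>2"
proof -
  have "1 - cos x = 2 * (sin (x / 2))\<^sup>2" using cos_double_sin[of "x / 2"] by simp
  also have "(sin (x / 2))\<^sup>2 \<le> (x / 2)\<^sup>2"
    using abs_sin_x_le_abs_x[of "x / 2"] by (simp only: abs_le_square_iff)
  finally have "1 - cos x \<le> x\<^sup>2 / 2" by (simp add: power2_eq_square field_simps)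
  then show ?thesis using zero_le_power2[of x] by linarith
qed

text \<open>Near 0 the bound \<xi>^2 for 1 - cos \<xi> leaves \<xi>^(1 - p), integrable because p <
  2. At infinity the bound 2 leaves \<xi>^(-1 - p), integrable because p > 0.\<close>

lemma spectral_density_integrable_one:
  assumes "0 < p" "p < 2"
  shows "integrable lborel (spectral_density p 1)"
proof (rule integrableI_nonneg)
  have "(\<integral>\<^sup>+\<xi>. ennreal (spectral_density p 1 \<xi>) \<partial>lborel)
      \<le> (\<integral>\<^sup>+\<xi>. ennreal (\<xi> powr (1 - p)) * indicator {0..1} \<xi> + ennreal 2 * (ennreal (\<xi> powr (-1 - p)) * indicator {1..} \<xi>) \<partial>lborel)"
  proof (intro nn_integral_mono)
    fix \<xi> :: real
    consider "\<xi> \<le> 0" | "0 < \<xi>" "\<xi> \<le> 1" | "1 < \<xi>" by linarith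
    then show "ennreal (spectral_density p 1 \<xi>) \<le> ennreal (\<xi> powr (1 - p)) * indicator {0..1} \<xi> + ennreal 2 * (ennreal (\<xi> powr (-1 - p)) * indicator {1..} \<xi>)"
    proof cases
      case 1
      then show ?thesis by (simp add: spectral_density_def)
    next
      case 2
      have "(1 - cos \<xi>) * \<xi> powr (-1 - p) \<le> \<xi>\<^sup>2 * \<xi> powr (-1 - p)"
        by (intro mult_right_mono one_minus_cos_le) auto
      also have "\<dots> = \<xi> powr (1 - p)"
      proof -
        have "\<xi>\<^sup>2 = \<xi> powr 2" using 2 by simp
        then show ?thesis by (simp only: powr_add[symmetric]) simp
      qed
      finally have "ennreal (spectral_density p 1 \<xi>) \<le> ennreal (\<xi> powr (1 - p))"
        using 2 by (simp add: spectral_density_def ennreal_leI)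
      then show ?thesis using 2 by (simp add: indicator_def add_increasing2)
    next
      case 3
      have "(1 - cos \<xi>) * \<xi> powr (-1 - p) \<le> 2 * \<xi> powr (-1 - p)"
        using cos_ge_minus_one[of \<xi>] by (intro mult_right_mono) auto
      then have "ennreal (spectral_density p 1 \<xi>) \<le> ennreal 2 * ennreal (\<xi> powr (-1 - p))"
        using 3 by (simp add: spectral_density_def ennreal_leI ennreal_mult[symmetric] del: ennreal_numeral)
      then show ?thesis using 3 by (simp add: indicator_def)
    qed
  qed
  also have "\<dots> = ennreal (1 / (1 - p + 1)) + ennreal 2 * ennreal (- (1 powr (-1 - p + 1)) / (-1 - p + 1))"
    using assms by (subst nn_integral_add, simp, simp, subst nn_integral_cmult, simp,
        subst nn_integral_powr_unit, simp, subst nn_integral_powr_atLeast) auto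
  also have "\<dots> < \<infinity>" by (simp add: ennreal_mult_less_top)
  finally show "(\<integral>\<^sup>+\<xi>. ennreal (spectral_density p 1 \<xi>) \<partial>lborel) < \<infinity>" .
qed (auto simp: spectral_density_nonneg)

text \<open>The value of the constant is irrelevant, only its sign counts. On [pi/2, pi] the cosine
  is not positive, so the integrand is bounded below there by
  \<open>pi powr (-1 - p)\<close>.\<close>

lemma spectral_const_pos:
  assumes "0 < p" "p < 2"
  shows "spectral_const p > 0"
proof -
  have "0 < (pi / 2) * pi powr (-1 - p)" by simp
  also have "\<dots> = (LINT \<xi>|lborel. indicator {pi/2..pi} \<xi> * pi powr (-1 - p))"
    by simp
  also have "\<dots> \<le> spectral_const p"
    unfolding spectral_const_def
  proof (rule integral_mono)
    show "integrable lborel (\<lambda>\<xi>. indicator {pi/2..pi} \<xi> * pi powr (-1 - p))" by simp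
    show "integrable lborel (spectral_density p 1)" using assms by (rule spectral_density_integrable_one)
    fix \<xi> :: real
    show "indicator {pi/2..pi} \<xi> * pi powr (-1 - p) \<le> spectral_density p 1 \<xi>"
    proof (cases "\<xi> \<in> {pi/2..pi}")
      case True
      have "pi / 2 > 0" "pi / 2 \<le> \<xi>" using True by auto
      then have "\<xi> > 0" by linarith
      have "cos \<xi> \<le> cos (pi / 2)" using True by (intro cos_monotone_0_pi_le) auto
      then have "1 \<le> 1 - cos \<xi>" by simp
      moreover have "pi powr (-1 - p) \<le> \<xi> powr (-1 - p)"
        using True \<open>\<xi> > 0\<close> assms by (intro powr_mono2') auto
      ultimately have "1 * pi powr (-1 - p) \<le> (1 - cos \<xi>) * \<xi> powr (-1 - p)"
        by (intro mult_mono) auto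
      then show ?thesis using True \<open>\<xi> > 0\<close> by (simp add: spectral_density_def)
    qed (simp add: spectral_density_nonneg)
  qed
  finally show ?thesis .
qed

text \<open>Scaling: the substitution of |x| \<xi> for \<xi> reduces to x = 1. The density
  contributes |x|^(1 + p) and the Jacobian 1/|x|.\<close>

lemma has_bochner_integral_spectral_density:
  assumes "0 < p" "p < 2"
  shows "has_bochner_integral lborel (spectral_density p x) (spectral_const p * \<bar>x\<bar> powr p)"
proof (cases "x = 0")
  case True
  then have "spectral_density p x = (\<lambda>_. 0)" by (auto simp: spectral_density_def)
  then show ?thesis using True by (simp add: has_bochner_integral_zero)
next
  case False
  define y where "y = \<bar>x\<bar>"
  have y: "y > 0" using False by (simp add: y_def)
  have eq: "spectral_density p x \<xi> = y powr (1 + p) * spectral_density p 1 (0 + y * \<xi>)" for \<xi>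
  proof (cases "\<xi> > 0")
    case True
    have "cos (\<xi> * x) = cos (y * \<xi>)" by (cases "x \<ge> 0") (auto simp: y_def mult.commute)
    moreover have "y powr (1 + p) * (y * \<xi>) powr (-1 - p) = \<xi> powr (-1 - p)"
      using y True by (simp add: powr_mult mult.assoc[symmetric] powr_add[symmetric])
    ultimately show ?thesis using True y by (simp add: spectral_density_def)
  next
    case False
    then show ?thesis using y by (simp add: spectral_density_def indicator_def zero_less_mult_iff)
  qed
  have "has_bochner_integral lborel (\<lambda>\<xi>. spectral_density p 1 (0 + y * \<xi>)) (spectral_const p /\<^sub>R \<bar>y\<bar>)"
    using y spectral_density_integrable_one[OF assms]
    by (subst lborel_has_bochner_integral_real_affine_iff[symmetric])
       (auto simp: has_bochner_integral_iff spectral_const_def)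
  then have "has_bochner_integral lborel (\<lambda>\<xi>. y powr (1 + p) * spectral_density p 1 (0 + y * \<xi>)) (y powr (1 + p) * (spectral_const p /\<^sub>R \<bar>y\<bar>))"
    by (rule has_bochner_integral_mult_right)
  moreover have "y powr (1 + p) * (spectral_const p /\<^sub>R \<bar>y\<bar>) = spectral_const p * \<bar>x\<bar> powr p"
    using y by (simp add: powr_add y_def field_simps)
  ultimately show ?thesis unfolding eq[symmetric] by (simp only:)
qed

text \<open>The left-hand side is the real part of the trigonometric sum of \<open>c\<close> times
  the conjugate of that of \<open>a\<close>. Since the weights \<open>c\<close> sum to 0, the
  cosines of the differences may be replaced by cosine minus 1, which is what the spectral density
  contains.\<close>

lemma sum_prod_trig:
  fixes c a :: "_ \<Rightarrow> real"
  assumes "sum c I = 0"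
  shows "(\<Sum>i\<in>I. c i * cos (\<xi> * t i)) * (\<Sum>j\<in>J. a j * cos (\<xi> * p j))
       + (\<Sum>i\<in>I. c i * sin (\<xi> * t i)) * (\<Sum>j\<in>J. a j * sin (\<xi> * p j))
     = - (\<Sum>i\<in>I. \<Sum>j\<in>J. c i * a j * (1 - cos (\<xi> * (t i - p j))))"
proof -
  have "(\<Sum>i\<in>I. \<Sum>j\<in>J. c i * a j * (1 - cos (\<xi> * (t i - p j))))
      = (\<Sum>i\<in>I. \<Sum>j\<in>J. c i * a j) - ((\<Sum>i\<in>I. \<Sum>j\<in>J. (c i * cos (\<xi> * t i)) * (a j * cos (\<xi> * p j)))
        + (\<Sum>i\<in>I. \<Sum>j\<in>J. (c i * sin (\<xi> * t i)) * (a j * sin (\<xi> * p j))))"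
    unfolding sum_subtractf[symmetric] sum.distrib[symmetric]
    by (intro sum.cong refl) (simp add: right_diff_distrib cos_diff algebra_simps)
  also have "(\<Sum>i\<in>I. \<Sum>j\<in>J. c i * a j) = 0"
    using assms by (simp add: sum_product[symmetric])
  finally show ?thesis by (simp add: sum_product)
qed

lemma discriminant_le:
  fixes P L R :: real
  assumes "\<And>u. 0 \<le> u\<^sup>2 * P + 2 * u * L + R" "0 \<le> P"
  shows "L\<^sup>2 \<le> P * R"
proof (cases "P = 0")
  case True
  have "L = 0"
  proof (rule ccontr)
    assume "L \<noteq> 0"
    \<comment> \<open>With \<open>P = 0\<close> and this value of u the quadratic would equal
      -1.\<close>
    then have "2 * (- (R + 1) / (2 * L)) * L = - (R + 1)" by simp
    then show False using assms(1)[of "- (R + 1) / (2 * L)"] True by simp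
  qed
  then show ?thesis using True by simp
next
  case False
  then have "P > 0" using assms by simp
  have "(- L / P)\<^sup>2 * P + 2 * (- L / P) * L + R = R - L\<^sup>2 / P"
    using False by (simp add: power2_eq_square field_simps)
  then have "L\<^sup>2 / P \<le> R" using assms(1)[of "- L / P"] by simp
  then show ?thesis using \<open>P > 0\<close> by (simp add: field_simps)
qed

lemma has_bochner_integral_spectral_sum:
  fixes f u :: "'i \<Rightarrow> real" and g v :: "'j \<Rightarrow> real"
  assumes "0 < q" "q < 2"
  shows "has_bochner_integral lborel
      (\<lambda>\<xi>. - (\<Sum>i\<in>X. \<Sum>j\<in>Y. f i * g j * spectral_density q (u i - v j) \<xi>))
      (spectral_const q * - (\<Sum>i\<in>X. \<Sum>j\<in>Y. f i * g j * \<bar>u i - v j\<bar> powr q))"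
proof -
  have "has_bochner_integral lborel
      (\<lambda>\<xi>. - (\<Sum>i\<in>X. \<Sum>j\<in>Y. f i * g j * spectral_density q (u i - v j) \<xi>))
      (- (\<Sum>i\<in>X. \<Sum>j\<in>Y. f i * g j * (spectral_const q * \<bar>u i - v j\<bar> powr q)))"
    by (intro has_bochner_integral_minus has_bochner_integral_sum has_bochner_integral_mult_right
        has_bochner_integral_spectral_density assms)
  then show ?thesis by (simp add: sum_distrib_left mult_ac)
qed

lemma has_bochner_integral_ge_0:
  fixes f :: "'b \<Rightarrow> real"
  assumes "has_bochner_integral M f x" "\<And>y. 0 \<le> f y"
  shows "0 \<le> x"
  using assms Bochner_Integration.integral_nonneg[of M f] by (auto simp: has_bochner_integral_iff)

text \<open>In the spectral representation the integrand is the squared modulus of the trigonometric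
  sum of \<open>c\<close>, weighted by \<xi>^(-1 - q), hence nonnegative for every \<xi>. Dividing
  by the positive constant gives the claim.\<close>

lemma conditionally_negative_definite_powr:
  fixes c t :: "'i \<Rightarrow> real"
  assumes "0 < q" "q < 2" and c0: "sum c I = 0"
  shows "0 \<le> - (\<Sum>i\<in>I. \<Sum>j\<in>I. c i * c j * \<bar>t i - t j\<bar> powr q)"
proof -
  have "0 \<le> - (\<Sum>i\<in>I. \<Sum>j\<in>I. c i * c j * spectral_density q (t i - t j) \<xi>)" for \<xi>
  proof (cases "\<xi> > 0")
    case True
    have "- (\<Sum>i\<in>I. \<Sum>j\<in>I. c i * c j * spectral_density q (t i - t j) \<xi>)
        = \<xi> powr (-1 - q) * - (\<Sum>i\<in>I. \<Sum>j\<in>I. c i * c j * (1 - cos (\<xi> * (t i - t j))))"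
      using True by (simp add: spectral_density_def sum_distrib_left mult_ac)
    then show ?thesis unfolding sum_prod_trig[OF c0, symmetric] by simp
  qed (simp add: spectral_density_def)
  then have "0 \<le> spectral_const q * - (\<Sum>i\<in>I. \<Sum>j\<in>I. c i * c j * \<bar>t i - t j\<bar> powr q)"
    by (intro has_bochner_integral_ge_0[OF has_bochner_integral_spectral_sum] assms)
  then show ?thesis using spectral_const_pos[OF assms(1,2)] by (simp only: zero_le_mult_iff) linarith
qed

text \<open>Cauchy--Schwarz for the spectral representation
  \<open>\<bar>x\<bar>\<^sup>p = const \<cdot> \<integral>\<^sub>0\<^sup>\<infinity> (1 - cos (\<xi> x)) \<xi>\<^sup>-\<^sup>1\<^sup>-\<^sup>p d\<xi>\<close>: the exponents \<open>2 H\<close> and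
  \<open>2 - 2 H\<close> are dual to each other with respect to the exponent 1.\<close>

lemma spectral_cauchy_schwarz:
  fixes c :: "'i \<Rightarrow> real" and a :: "'j \<Rightarrow> real"
  assumes H: "0 < H" "H < 1" and c0: "sum c I = 0" and a0: "sum a J = 0"
  shows "(spectral_const 1 * (\<Sum>i\<in>I. \<Sum>j\<in>J. c i * a j * \<bar>t i - p j\<bar>))\<^sup>2
    \<le> (spectral_const (2 * H) * - (\<Sum>i\<in>I. \<Sum>j\<in>I. c i * c j * \<bar>t i - t j\<bar> powr (2 * H)))
     * (spectral_const (2 - 2 * H) * - (\<Sum>i\<in>J. \<Sum>j\<in>J. a i * a j * \<bar>p i - p j\<bar> powr (2 - 2 * H)))"
proof -
  define P where "P = spectral_const (2 * H) * - (\<Sum>i\<in>I. \<Sum>j\<in>I. c i * c j * \<bar>t i - t j\<bar> powr (2 * H))"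
  define L where "L = spectral_const 1 * - (\<Sum>i\<in>I. \<Sum>j\<in>J. c i * a j * \<bar>t i - p j\<bar> powr 1)"
  define R where "R = spectral_const (2 - 2 * H) * - (\<Sum>i\<in>J. \<Sum>j\<in>J. a i * a j * \<bar>p i - p j\<bar> powr (2 - 2 * H))"
  \<comment> \<open>For fixed \<xi> the quadratic in u is a sum of two squares, namely the squared
    modulus of u times the weighted trigonometric sum of \<open>c\<close> plus that of
    \<open>a\<close>.\<close>
  have pt: "0 \<le> u\<^sup>2 * (- (\<Sum>i\<in>I. \<Sum>j\<in>I. c i * c j * spectral_density (2 * H) (t i - t j) \<xi>))
      + 2 * u * (- (\<Sum>i\<in>I. \<Sum>j\<in>J. c i * a j * spectral_density 1 (t i - p j) \<xi>))
      + - (\<Sum>i\<in>J. \<Sum>j\<in>J. a i * a j * spectral_density (2 - 2 * H) (p i - p j) \<xi>)"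
    for u \<xi>
  proof (cases "\<xi> > 0")
    case True
    \<comment> \<open>Square roots of the weights for the exponents 2 H and 2 - 2 H. Their product
      is \<xi>^(-2), the weight for exponent 1, which is why the mixed term only involves |x -
      p|.\<close>
    define e where "e = \<xi> powr (-1/2 - H)"
    define f where "f = \<xi> powr (-3/2 + H)"
    have ef: "e * e = \<xi> powr (-1 - 2 * H)" "e * f = \<xi> powr (-1 - 1)" "f * f = \<xi> powr (-1 - (2 - 2 * H))"
      by (auto simp: e_def f_def powr_add[symmetric] algebra_simps)
    define c1 where "c1 = (\<Sum>i\<in>I. c i * cos (\<xi> * t i))"
    define c2 where "c2 = (\<Sum>i\<in>I. c i * sin (\<xi> * t i))"
    define a1 where "a1 = (\<Sum>i\<in>J. a i * cos (\<xi> * p i))"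
    define a2 where "a2 = (\<Sum>i\<in>J. a i * sin (\<xi> * p i))"
    have "- (\<Sum>i\<in>I. \<Sum>j\<in>I. c i * c j * spectral_density (2 * H) (t i - t j) \<xi>) = (e * e) * (c1 * c1 + c2 * c2)"
      unfolding c1_def c2_def sum_prod_trig[OF c0] ef using True
      by (simp add: spectral_density_def sum_distrib_left mult_ac)
    moreover have "- (\<Sum>i\<in>I. \<Sum>j\<in>J. c i * a j * spectral_density 1 (t i - p j) \<xi>) = (e * f) * (c1 * a1 + c2 * a2)"
      unfolding c1_def c2_def a1_def a2_def sum_prod_trig[OF c0] ef using True
      by (simp add: spectral_density_def sum_distrib_left mult_ac)
    moreover have "- (\<Sum>i\<in>J. \<Sum>j\<in>J. a i * a j * spectral_density (2 - 2 * H) (p i - p j) \<xi>) = (f * f) * (a1 * a1 + a2 * a2)"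
      unfolding a1_def a2_def sum_prod_trig[OF a0] ef using True
      by (simp add: spectral_density_def sum_distrib_left mult_ac)
    moreover have "u\<^sup>2 * ((e * e) * (c1 * c1 + c2 * c2)) + 2 * u * ((e * f) * (c1 * a1 + c2 * a2)) + (f * f) * (a1 * a1 + a2 * a2)
      = (u * e * c1 + f * a1)\<^sup>2 + (u * e * c2 + f * a2)\<^sup>2"
      by (simp add: power2_eq_square algebra_simps)
    ultimately show ?thesis by simp
  qed (simp add: spectral_density_def)
  have nn: "0 \<le> u\<^sup>2 * P + 2 * u * L + R" for u
  proof (rule has_bochner_integral_ge_0)
    show "has_bochner_integral lborel (\<lambda>\<xi>. u\<^sup>2 * (- (\<Sum>i\<in>I. \<Sum>j\<in>I. c i * c j * spectral_density (2 * H) (t i - t j) \<xi>))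
      + 2 * u * (- (\<Sum>i\<in>I. \<Sum>j\<in>J. c i * a j * spectral_density 1 (t i - p j) \<xi>))
      + - (\<Sum>i\<in>J. \<Sum>j\<in>J. a i * a j * spectral_density (2 - 2 * H) (p i - p j) \<xi>)) (u\<^sup>2 * P + 2 * u * L + R)"
      unfolding P_def L_def R_def
      by (intro has_bochner_integral_add has_bochner_integral_mult_right has_bochner_integral_spectral_sum)
        (use H in auto)
  qed (use pt in auto)
  have "0 \<le> P"
    unfolding P_def using H spectral_const_pos[of "2 * H"] conditionally_negative_definite_powr[OF _ _ c0, of "2 * H" t]
    by (intro mult_nonneg_nonneg) auto
  with nn have "L\<^sup>2 \<le> P * R" by (rule discriminant_le)
  then show ?thesis by (simp add: P_def L_def R_def)
qed

section \<open>Trapezoidal test functions\<close>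

definition fbm_cov :: "real \<Rightarrow> real \<Rightarrow> real \<Rightarrow> real" where
  "fbm_cov H s t = (s powr (2 * H) + t powr (2 * H) - \<bar>t - s\<bar> powr (2 * H)) / 2"

text \<open>Height 1 on the plateau from k/B to (k + 1/2)/B, with ramps of width 1/(4 B). The
  plateau is half a cell because the fractional part following a block never exceeds 1/2; the ramps
  end before the values reachable from blocks k - 1 and k + 1. The form with four kinks, whose
  weights sum to 0, is what the spectral Cauchy--Schwarz inequality takes as input.\<close>

definition trapezoid :: "real \<Rightarrow> real \<Rightarrow> real \<Rightarrow> real" where
  "trapezoid B k x = 2 * B * (\<bar>x - (k - 1/4) / B\<bar> - \<bar>x - k / B\<bar> - \<bar>x - (k + 1/2) / B\<bar> + \<bar>x - (k + 3/4) / B\<bar>)"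

lemma trapezoid_scale:
  assumes "B > 0"
  shows "trapezoid B k x = 2 * (\<bar>B * x - (k - 1/4)\<bar> - \<bar>B * x - k\<bar> - \<bar>B * x - (k + 1/2)\<bar> + \<bar>B * x - (k + 3/4)\<bar>)"
proof -
  have "B * \<bar>x - c / B\<bar> = \<bar>B * x - c\<bar>" for c
  proof -
    have "B * \<bar>x - c / B\<bar> = \<bar>B * (x - c / B)\<bar>" using assms by (simp add: abs_mult)
    then show ?thesis using assms by (simp add: right_diff_distrib)
  qed
  then show ?thesis unfolding trapezoid_def by (simp only: mult.assoc distrib_left right_diff_distrib)
qed

lemma trapezoid_eq_1:
  assumes "B > 0" "k / B \<le> x" "x \<le> (k + 1/2) / B"
  shows "trapezoid B k x = 1"
proof -
  have "k \<le> B * x" "B * x \<le> k + 1/2" using assms by (simp_all add: field_simps)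
  then show ?thesis unfolding trapezoid_scale[OF assms(1)] by (simp add: abs_if)
qed

lemma trapezoid_eq_0:
  assumes "B > 0" "x \<le> (k - 1/4) / B \<or> (k + 3/4) / B \<le> x"
  shows "trapezoid B k x = 0"
proof -
  have "B * x \<le> k - 1/4 \<or> k + 3/4 \<le> B * x" using assms by (auto simp add: field_simps)
  then show ?thesis unfolding trapezoid_scale[OF assms(1)] by (auto simp add: abs_if)
qed

text \<open>The trapezoid lies in the Cameron--Martin space of fractional Brownian motion, with a norm
  that does not depend on its position.\<close>

lemma trapezoid_fbm_cov_bound:
  assumes H: "0 < H" "H < 1" and B: "B > 0"
  obtains D where "D > 0"
    and "\<And>k F c. finite F \<Longrightarrow> F \<subseteq> {0..} \<Longrightarrow>
      (\<Sum>t\<in>F. c t * (trapezoid B k t - trapezoid B k 0))\<^sup>2 \<le> D * (\<Sum>s\<in>F. \<Sum>t\<in>F. c s * c t * fbm_cov H s t)"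
proof -
  define r :: "nat \<Rightarrow> real" where "r = (\<lambda>j. [-1/4, 0, 1/2, 3/4] ! j)"
  define a :: "nat \<Rightarrow> real" where "a = (\<lambda>j. [2 * B, - 2 * B, - 2 * B, 2 * B] ! j)"
  have trap: "trapezoid B k x = (\<Sum>j<4. a j * \<bar>x - (k + r j) / B\<bar>)" for k x
    by (simp add: trapezoid_def a_def r_def numeral_eq_Suc algebra_simps)
  have a0: "sum a {..<4} = 0" by (simp add: a_def numeral_eq_Suc)
  define R where "R = - (\<Sum>i<4. \<Sum>j<4. a i * a j * \<bar>(r i - r j) / B\<bar> powr (2 - 2 * H))"
  \<comment> \<open>The absolute value and the added 1 make \<open>D\<close> positive without a
    discussion of the sign of \<open>R\<close>.\<close>
  define D where "D = \<bar>2 * spectral_const (2 * H) * (spectral_const (2 - 2 * H) * R) / (spectral_const 1)\<^sup>2\<bar> + 1"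
  have D: "D > 0" unfolding D_def by (rule add_nonneg_pos) simp_all
  have c1: "spectral_const 1 > 0" by (rule spectral_const_pos) auto
  have "(\<Sum>t\<in>F. c t * (trapezoid B k t - trapezoid B k 0))\<^sup>2 \<le> D * (\<Sum>s\<in>F. \<Sum>t\<in>F. c s * c t * fbm_cov H s t)"
    if F: "finite F" "F \<subseteq> {0..}" for k F and c :: "real \<Rightarrow> real"
  proof -
    \<comment> \<open>A further node at 0 with weight \<open>- sum c F\<close> makes the weights sum
      to 0. It leaves the variance unchanged, since the process has variance 0 at time 0, and it
      produces the term \<open>trapezoid B k 0\<close> that is subtracted in the claim.\<close>
    define w where "w = case_option (- sum c F) c"
    define q where "q = case_option 0 (\<lambda>t::real. t)"
    define I where "I = insert None (Some ` F)"
    have sumI: "sum g I = g None + (\<Sum>t\<in>F. g (Some t))" for g :: "real option \<Rightarrow> real"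
      using F by (simp add: I_def sum.reindex)
    define V where "V = (\<Sum>s\<in>F. \<Sum>t\<in>F. c s * c t * fbm_cov H s t)"
    have w0: "sum w I = 0" by (simp add: sumI w_def)
    have L: "(\<Sum>i\<in>I. \<Sum>j<4. w i * a j * \<bar>q i - (k + r j) / B\<bar>) = (\<Sum>t\<in>F. c t * (trapezoid B k t - trapezoid B k 0))"
    proof -
      have "(\<Sum>i\<in>I. \<Sum>j<4. w i * a j * \<bar>q i - (k + r j) / B\<bar>) = (\<Sum>i\<in>I. w i * trapezoid B k (q i))"
        by (simp add: trap sum_distrib_left mult.assoc)
      also have "\<dots> = (\<Sum>t\<in>F. c t * (trapezoid B k t - trapezoid B k 0))"
        by (simp add: sumI w_def q_def right_diff_distrib sum_subtractf sum_distrib_right)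
      finally show ?thesis .
    qed
    \<comment> \<open>Only differences of nodes enter, so \<open>k\<close> cancels and one constant
      serves all trapezoids of the same width.\<close>
    have R: "- (\<Sum>i<4. \<Sum>j<4. a i * a j * \<bar>(k + r i) / B - (k + r j) / B\<bar> powr (2 - 2 * H)) = R"
      unfolding R_def by (simp add: diff_divide_distrib[symmetric])
    have V: "- (\<Sum>i\<in>I. \<Sum>j\<in>I. w i * w j * \<bar>q i - q j\<bar> powr (2 * H)) = 2 * V"
    proof -
      have ab: "\<bar>t\<bar> = t" if "t \<in> F" for t using F that by auto
      have *: "2 * (c s * c t * fbm_cov H s t) = c s * c t * s powr (2 * H) + c s * c t * t powr (2 * H)
          - c s * c t * \<bar>s - t\<bar> powr (2 * H)" for s t
      proof -
        have "2 * fbm_cov H s t = s powr (2 * H) + t powr (2 * H) - \<bar>s - t\<bar> powr (2 * H)"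
          by (simp add: fbm_cov_def abs_minus_commute)
        moreover have "2 * (c s * c t * fbm_cov H s t) = c s * c t * (2 * fbm_cov H s t)" by simp
        ultimately show ?thesis by (simp only: distrib_left right_diff_distrib)
      qed
      have "2 * V = (\<Sum>s\<in>F. \<Sum>t\<in>F. c s * c t * (s powr (2 * H))) + (\<Sum>s\<in>F. \<Sum>t\<in>F. c s * c t * (t powr (2 * H)))
          - (\<Sum>s\<in>F. \<Sum>t\<in>F. c s * c t * \<bar>s - t\<bar> powr (2 * H))"
        unfolding V_def sum_distrib_left sum.distrib[symmetric] sum_subtractf[symmetric]
        by (intro sum.cong refl *)
      also have "(\<Sum>s\<in>F. \<Sum>t\<in>F. c s * c t * (t powr (2 * H))) = sum c F * (\<Sum>t\<in>F. c t * t powr (2 * H))"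
        by (simp add: sum_product mult.assoc)
      also have "(\<Sum>s\<in>F. \<Sum>t\<in>F. c s * c t * (s powr (2 * H))) = sum c F * (\<Sum>t\<in>F. c t * t powr (2 * H))"
        by (subst sum.swap) (simp add: sum_product mult_ac)
      finally have 1: "2 * V = 2 * (sum c F * (\<Sum>t\<in>F. c t * t powr (2 * H)))
          - (\<Sum>s\<in>F. \<Sum>t\<in>F. c s * c t * \<bar>s - t\<bar> powr (2 * H))" by simp
      have "(\<Sum>j\<in>I. w None * w j * \<bar>q None - q j\<bar> powr (2 * H)) = - (sum c F * (\<Sum>t\<in>F. c t * t powr (2 * H)))"
        by (simp add: sumI w_def q_def ab sum_negf sum_distrib_left mult_ac)
      moreover have "(\<Sum>s\<in>F. \<Sum>j\<in>I. w (Some s) * w j * \<bar>q (Some s) - q j\<bar> powr (2 * H))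
          = (\<Sum>s\<in>F. - (sum c F * (c s * s powr (2 * H))) + (\<Sum>t\<in>F. c s * c t * \<bar>s - t\<bar> powr (2 * H)))"
        by (intro sum.cong refl) (simp add: sumI w_def q_def ab mult_ac)
      moreover have "\<dots> = - (sum c F * (\<Sum>t\<in>F. c t * t powr (2 * H))) + (\<Sum>s\<in>F. \<Sum>t\<in>F. c s * c t * \<bar>s - t\<bar> powr (2 * H))"
        by (simp only: sum.distrib sum_negf sum_distrib_left[symmetric])
      ultimately show ?thesis
        unfolding 1 sumI[of "\<lambda>i. \<Sum>j\<in>I. w i * w j * \<bar>q i - q j\<bar> powr (2 * H)"] by linarith
    qed
    have "(spectral_const 1 * (\<Sum>t\<in>F. c t * (trapezoid B k t - trapezoid B k 0)))\<^sup>2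
        \<le> (spectral_const (2 * H) * (2 * V)) * (spectral_const (2 - 2 * H) * R)"
      using spectral_cauchy_schwarz[OF H w0 a0, of q "\<lambda>j. (k + r j) / B"] unfolding L R V .
    then have "(\<Sum>t\<in>F. c t * (trapezoid B k t - trapezoid B k 0))\<^sup>2
        \<le> (2 * spectral_const (2 * H) * (spectral_const (2 - 2 * H) * R) / (spectral_const 1)\<^sup>2) * V"
      using c1 by (simp add: power_mult_distrib field_simps)
    also have "\<dots> \<le> D * V"
    proof (intro mult_right_mono)
      show "0 \<le> V" using conditionally_negative_definite_powr[OF _ _ w0, of "2 * H" q] H V by simp
      show "2 * spectral_const (2 * H) * (spectral_const (2 - 2 * H) * R) / (spectral_const 1)\<^sup>2 \<le> D"
        unfolding D_def by (rule order_trans[OF abs_ge_self]) simp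
    qed
    finally show ?thesis by (simp add: V_def)
  qed
  with D show ?thesis by (rule that)
qed

section \<open>Hoelder continuity of Weierstrass-type series\<close>

lemma holder_on_exponent_mono:
  assumes "holder_on \<tau> {0..1} f" "h \<le> \<tau>" "0 < h"
  shows "holder_on h {0..1::real} f"
proof -
  obtain C where C: "C \<ge> 0" "\<And>x y. x \<in> {0..1} \<Longrightarrow> y \<in> {0..1} \<Longrightarrow> dist (f x) (f y) \<le> C * dist x y powr \<tau>"
    using assms(1) by (auto simp: holder_on_def)
  have "dist (f x) (f y) \<le> C * dist x y powr h" if "x \<in> {0..1}" "y \<in> {0..1}" for x y
  proof -
    have "dist x y powr \<tau> \<le> dist x y powr h"
      using that assms by (intro powr_mono') (auto simp: dist_real_def)
    then show ?thesis using C that by (meson mult_left_mono order_trans)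
  qed
  with C(1) show ?thesis by (auto simp: holder_on_def)
qed

lemma holder_on_imp_continuous_on:
  assumes "holder_on \<tau> S f" "0 < \<tau>"
  shows "continuous_on S f"
proof -
  obtain C where C: "C \<ge> 0" "\<And>x y. x \<in> S \<Longrightarrow> y \<in> S \<Longrightarrow> dist (f x) (f y) \<le> C * dist x y powr \<tau>"
    using assms(1) by (auto simp: holder_on_def)
  show ?thesis
    unfolding continuous_on_def
  proof
    fix x assume x: "x \<in> S"
    show "(f \<longlongrightarrow> f x) (at x within S)"
    proof (rule metric_tendsto_imp_tendsto)
      have "((\<lambda>y. dist y x) \<longlongrightarrow> 0) (at x within S)"
        using tendsto_dist[OF tendsto_ident_at tendsto_const, of x x S] by simp
      then have "((\<lambda>y. dist y x powr \<tau>) \<longlongrightarrow> 0) (at x within S)"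
        by (rule tendsto_zero_powrI[OF _ tendsto_const]) (use assms in auto)
      then show "((\<lambda>y. C * dist y x powr \<tau>) \<longlongrightarrow> 0) (at x within S)"
        using tendsto_mult_right_zero by blast
      show "\<forall>\<^sub>F y in at x within S. dist (f y) (f x) \<le> dist (C * dist y x powr \<tau>) 0"
        unfolding eventually_at_filter using C x by (intro always_eventually) (auto simp: dist_real_def abs_mult)
    qed
  qed
qed

text \<open>If x and y lie in neighbouring unit cells, the path from one to the other passes through
  an integer, where the extension vanishes; the two pieces account for the factor 2. At distance at
  least 1 the fractional parts are closer to each other than the points.\<close>

lemma periodic_extension_holder:
  fixes g :: "real \<Rightarrow> real"
  assumes C: "C \<ge> 0" "\<And>x y. x \<in> {0..1} \<Longrightarrow> y \<in> {0..1} \<Longrightarrow> \<bar>g x - g y\<bar> \<le> C * \<bar>x - y\<bar> powr h"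
    and h: "h > 0" and g0: "g 0 = 0" "g 1 = 0"
  shows "\<bar>g (frac x) - g (frac y)\<bar> \<le> 2 * C * \<bar>x - y\<bar> powr h"
proof -
  have fr: "frac z \<in> {0..1}" for z :: real using frac_lt_1[of z] by (auto simp: less_imp_le)
  have *: "\<bar>g (frac x) - g (frac y)\<bar> \<le> 2 * C * \<bar>x - y\<bar> powr h" if "x \<le> y" for x y
  proof -
    have mono: "C * z powr h \<le> C * \<bar>x - y\<bar> powr h" if "0 \<le> z" "z \<le> \<bar>x - y\<bar>" for z
      using C h that by (intro mult_left_mono powr_mono2) auto
    have nn: "0 \<le> C * \<bar>x - y\<bar> powr h" using C by simp
    have fxy: "x = of_int \<lfloor>x\<rfloor> + frac x" "y = of_int \<lfloor>y\<rfloor> + frac y" by (simp_all add: frac_def)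
    consider "y - x \<ge> 1" | "\<lfloor>y\<rfloor> = \<lfloor>x\<rfloor>" | "\<lfloor>y\<rfloor> = \<lfloor>x\<rfloor> + 1" using \<open>x \<le> y\<close> by linarith
    then show ?thesis
    proof cases
      case 1
      then have "\<bar>frac x - frac y\<bar> \<le> \<bar>x - y\<bar>" using frac_ge_0[of x] frac_ge_0[of y] frac_lt_1[of x] frac_lt_1[of y] by linarith
      then show ?thesis using C(2)[OF fr fr, of x y] mono[of "\<bar>frac x - frac y\<bar>"] nn by linarith
    next
      case 2
      then have "\<bar>frac x - frac y\<bar> \<le> \<bar>x - y\<bar>" by (simp add: frac_def)
      then show ?thesis using C(2)[OF fr fr, of x y] mono[of "\<bar>frac x - frac y\<bar>"] nn by linarith
    next
      case 3
      have s: "(1 - frac x) + frac y = y - x" using 3 by (simp add: frac_def)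
      have "\<bar>g (frac x) - g 1\<bar> \<le> C * \<bar>frac x - 1\<bar> powr h" "\<bar>g (frac y) - g 0\<bar> \<le> C * \<bar>frac y - 0\<bar> powr h"
        by (intro C(2) fr; simp)+
      moreover have "C * \<bar>frac x - 1\<bar> powr h \<le> C * \<bar>x - y\<bar> powr h"
        using frac_ge_0[of x] frac_ge_0[of y] frac_lt_1[of x] frac_lt_1[of y] s by (intro mono) linarith+
      moreover have "C * \<bar>frac y - 0\<bar> powr h \<le> C * \<bar>x - y\<bar> powr h"
        using frac_ge_0[of x] frac_ge_0[of y] frac_lt_1[of x] frac_lt_1[of y] s by (intro mono) linarith+
      ultimately show ?thesis using g0 by linarith
    qed
  qed
  show ?thesis using *[of x y] *[of y x] by (cases "x \<le> y") (auto simp: abs_minus_commute)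
qed

text \<open>Split the series where b^(-n) reaches the size of |s - t|. Below that index the Hoelder
  bound on \<open>g\<close> gives a growing geometric sum dominated by its end; above it boundedness
  of \<open>g\<close> gives a decaying one. Both are of order \<open>\<alpha> ^ N\<close>, that is,
  of order |s - t|^K.\<close>

lemma weierstrass_series_holder:
  fixes g :: "real \<Rightarrow> real"
  assumes g: "holder_on h {0..1} g" "g 0 = 0" "g 1 = 0"
    and b: "b > 1" and K: "0 < K" "K < h"
  shows "holder_on K {0..1} (\<lambda>t. \<Sum>n. (b powr (-K)) ^ n * g (frac (b ^ n * t)))"
proof -
  obtain C where C: "C \<ge> 0" "\<And>x y. x \<in> {0..1} \<Longrightarrow> y \<in> {0..1} \<Longrightarrow> \<bar>g x - g y\<bar> \<le> C * \<bar>x - y\<bar> powr h"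
    using g(1) by (auto simp: holder_on_def dist_real_def)
  have h: "h > 0" using K by simp
  define \<alpha> where "\<alpha> = b powr (-K)"
  have \<alpha>: "0 < \<alpha>" "\<alpha> < 1" using b K by (auto simp: \<alpha>_def powr_less_one)
  define G where "G x = g (frac x)" for x
  have Gh: "\<bar>G x - G y\<bar> \<le> 2 * C * \<bar>x - y\<bar> powr h" for x y
    unfolding G_def using C h g(2,3) by (rule periodic_extension_holder)
  have Gb: "\<bar>G x\<bar> \<le> C" for x
  proof -
    have "\<bar>g (frac x) - g 0\<bar> \<le> C * \<bar>frac x - 0\<bar> powr h"
      using frac_lt_1[of x] by (intro C) (auto simp: less_imp_le)
    also have "\<dots> \<le> C * 1 powr h"
      using frac_lt_1[of x] C h by (intro mult_left_mono powr_mono2) (auto simp: less_imp_le)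
    finally show ?thesis using g by (simp add: G_def)
  qed
  have Gb2: "\<bar>G x - G y\<bar> \<le> 2 * C" for x y using Gb[of x] Gb[of y] by linarith
  have summ: "summable (\<lambda>n. \<alpha> ^ n * f n)" if "\<And>n. \<bar>f n\<bar> \<le> c" for f :: "nat \<Rightarrow> real" and c
  proof (rule summable_comparison_test')
    show "summable (\<lambda>n. \<alpha> ^ n * c)" using \<alpha> by (intro summable_mult2 summable_geometric) auto
    show "norm (\<alpha> ^ n * f n) \<le> \<alpha> ^ n * c" for n using that[of n] \<alpha> by (simp add: abs_mult)
  qed
  \<comment> \<open>Ratio of the initial part, equal to b^(h - K); it exceeds 1 because the summands
    are smoother than the claimed exponent.\<close>
  define \<rho> where "\<rho> = \<alpha> * b powr h"
  have "\<rho> = b powr (h - K)" using b by (simp add: \<rho>_def \<alpha>_def powr_add[symmetric])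
  then have \<rho>: "\<rho> > 1" using b K by simp
  define D where "D = 2 * C * (1 / (\<rho> - 1) + 1 / (1 - \<alpha>)) * b powr K"
  have D: "D \<ge> 0" using C \<rho> \<alpha> by (simp add: D_def)
  have main: "\<bar>(\<Sum>n. \<alpha> ^ n * G (b ^ n * s)) - (\<Sum>n. \<alpha> ^ n * G (b ^ n * t))\<bar> \<le> D * \<bar>s - t\<bar> powr K"
    if st: "s \<in> {0..1}" "t \<in> {0..1}" "s \<noteq> t" for s t
  proof -
    define d where "d = \<bar>s - t\<bar>"
    have d: "0 < d" "d \<le> 1" using st by (auto simp: d_def)
    \<comment> \<open>The index with b^(-(N + 1)) < d \<le> b^(-N).\<close>
    define N where "N = nat \<lfloor>- log b d\<rfloor>"
    have "log b d \<le> 0" using d b by (simp add: log_le_zero_cancel_iff)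
    then have N: "real N \<le> - log b d" "- log b d < real N + 1" by (auto simp: N_def)
    have dh: "d powr h \<le> b powr (- (N * h))"
    proof -
      have "d = b powr (log b d)" using d b by simp
      also have "\<dots> powr h = b powr (log b d * h)" by (simp add: powr_powr)
      also have "\<dots> \<le> b powr (- (N * h))"
        using mult_right_mono[OF N(1), of h] h b by (intro powr_mono) auto
      finally show ?thesis .
    qed
    have \<alpha>N: "\<alpha> ^ N \<le> b powr K * d powr K"
    proof -
      have "\<alpha> ^ N = b powr (- K * N)" using b by (simp add: \<alpha>_def powr_powr powr_realpow[symmetric])
      also have "\<dots> \<le> b powr (K + log b d * K)"
        using mult_right_mono[of "- log b d" "real N + 1" K] N(2) K b
        by (intro powr_mono) (auto simp: algebra_simps)
      also have "\<dots> = b powr K * (b powr (log b d)) powr K" by (simp add: powr_add powr_powr)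
      also have "\<dots> = b powr K * d powr K" using d b by simp
      finally show ?thesis .
    qed
    define f where "f n = G (b ^ n * s) - G (b ^ n * t)" for n
    have fb: "\<bar>f n\<bar> \<le> 2 * C" for n unfolding f_def by (rule Gb2)
    have fh: "\<bar>\<alpha> ^ n * f n\<bar> \<le> 2 * C * d powr h * \<rho> ^ n" for n
    proof -
      have "\<bar>f n\<bar> \<le> 2 * C * \<bar>b ^ n * s - b ^ n * t\<bar> powr h" unfolding f_def by (rule Gh)
      also have "\<bar>b ^ n * s - b ^ n * t\<bar> = b ^ n * d"
        using b by (simp add: d_def right_diff_distrib[symmetric] abs_mult)
      also have "(b ^ n * d) powr h = (b powr h) ^ n * d powr h"
        using b d by (simp add: powr_mult powr_powr powr_realpow[symmetric] mult.commute)
      finally have "\<alpha> ^ n * \<bar>f n\<bar> \<le> \<alpha> ^ n * (2 * C * ((b powr h) ^ n * d powr h))"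
        using \<alpha> by (intro mult_left_mono) auto
      then show ?thesis using \<alpha> by (simp add: abs_mult \<rho>_def power_mult_distrib mult_ac)
    qed
    have "(\<Sum>n. \<alpha> ^ n * G (b ^ n * s)) - (\<Sum>n. \<alpha> ^ n * G (b ^ n * t)) = (\<Sum>n. \<alpha> ^ n * f n)"
      unfolding f_def by (subst suminf_diff) (auto simp: right_diff_distrib intro: summ[OF Gb])
    also have "\<dots> = (\<Sum>n. \<alpha> ^ (n + N) * f (n + N)) + (\<Sum>n<N. \<alpha> ^ n * f n)"
      by (rule suminf_split_initial_segment[OF summ[OF fb]])
    also have "\<bar>\<dots>\<bar> \<le> 2 * C * \<alpha> ^ N / (1 - \<alpha>) + 2 * C * \<alpha> ^ N / (\<rho> - 1)"
    proof (rule order_trans[OF abs_triangle_ineq], rule add_mono)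
      have "norm (\<Sum>n. \<alpha> ^ (n + N) * f (n + N)) \<le> (\<Sum>n. 2 * C * \<alpha> ^ N * \<alpha> ^ n)"
      proof (rule norm_suminf_le)
        show "norm (\<alpha> ^ (n + N) * f (n + N)) \<le> 2 * C * \<alpha> ^ N * \<alpha> ^ n" for n
          using mult_right_mono[OF fb[of "n + N"], of "\<alpha> ^ (n + N)"] \<alpha> by (simp add: abs_mult power_add mult_ac)
      qed (use \<alpha> in \<open>intro summable_mult summable_geometric, auto\<close>)
      also have "\<dots> = 2 * C * \<alpha> ^ N / (1 - \<alpha>)"
        using \<alpha> by (subst suminf_mult) (auto simp: suminf_geometric summable_geometric)
      finally show "\<bar>\<Sum>n. \<alpha> ^ (n + N) * f (n + N)\<bar> \<le> 2 * C * \<alpha> ^ N / (1 - \<alpha>)" by simp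
      have "\<bar>\<Sum>n<N. \<alpha> ^ n * f n\<bar> \<le> (\<Sum>n<N. 2 * C * d powr h * \<rho> ^ n)"
        using fh by (intro order_trans[OF sum_abs sum_mono])
      also have "\<dots> = 2 * C * d powr h * ((\<rho> ^ N - 1) / (\<rho> - 1))"
        using \<rho> by (simp add: sum_distrib_left[symmetric] geometric_sum)
      also have "\<dots> \<le> 2 * C * d powr h * (\<rho> ^ N / (\<rho> - 1))"
        using C \<rho> by (intro mult_left_mono divide_right_mono) auto
      also have "\<dots> \<le> 2 * C * b powr (- (N * h)) * (\<rho> ^ N / (\<rho> - 1))"
        using C \<rho> dh by (intro mult_right_mono mult_left_mono) auto
      also have "\<dots> = 2 * C * \<alpha> ^ N / (\<rho> - 1)"
      proof -
        have "b powr (- (N * h)) * (b powr h) ^ N = 1"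
          using b by (simp add: powr_minus powr_powr powr_realpow[symmetric] mult.commute)
        then have "b powr (- (N * h)) * \<rho> ^ N = \<alpha> ^ N" by (simp add: \<rho>_def power_mult_distrib)
        then show ?thesis by (metis (no_types, lifting) mult.assoc times_divide_eq_right)
      qed
      finally show "\<bar>\<Sum>n<N. \<alpha> ^ n * f n\<bar> \<le> 2 * C * \<alpha> ^ N / (\<rho> - 1)" .
    qed
    also have "\<dots> = 2 * C * (1 / (\<rho> - 1) + 1 / (1 - \<alpha>)) * \<alpha> ^ N" by (simp add: algebra_simps)
    also have "\<dots> \<le> 2 * C * (1 / (\<rho> - 1) + 1 / (1 - \<alpha>)) * (b powr K * d powr K)"
      using \<alpha>N C \<rho> \<alpha> by (intro mult_left_mono) auto
    finally show ?thesis by (simp add: D_def d_def mult.assoc)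
  qed
  show ?thesis
    unfolding holder_on_def dist_real_def
  proof (intro exI[of _ D] conjI ballI D)
    fix s t :: real assume "s \<in> {0..1}" "t \<in> {0..1}"
    then show "\<bar>(\<Sum>n. (b powr (-K)) ^ n * g (frac (b ^ n * s))) - (\<Sum>n. (b powr (-K)) ^ n * g (frac (b ^ n * t)))\<bar> \<le> D * \<bar>s - t\<bar> powr K"
      using main[of s t] by (cases "s = t") (simp_all add: G_def \<alpha>_def)
  qed
qed

section \<open>A Cantor set of digit expansions\<close>

text \<open>Numbers with \<open>l * q\<close> base-\<open>b\<close> digits such that every window of \<open>l\<close> digits contains a nonzero one;
  the window may be truncated at the least significant end, and \<open>s\<close> ranges beyond \<open>l * q\<close> because
  \<open>l\<close> leading zeros are prepended later.\<close>

definition restricted_blocks :: "nat \<Rightarrow> nat \<Rightarrow> nat \<Rightarrow> nat set" where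
  "restricted_blocks b l q = {k. k < b ^ (l * q) \<and> (\<forall>s\<in>{1..<l * q + l}. b ^ s \<le> (k mod b ^ s) * b ^ l)}"

lemma finite_restricted_blocks: "finite (restricted_blocks b l q)"
  by (rule finite_subset[of _ "{..<b ^ (l * q)}"]) (auto simp: restricted_blocks_def)

text \<open>In base \<open>b\<close> the number \<open>m\<close> has l digits, of which the first
  and the last are 1 and the others, encoded by \<open>j\<close>, are free. For u \<le> l the last
  digit makes the residue nonzero; for l < u < 2 l the first digit makes it at least b^(l - 1),
  which is at least b^(u - l).\<close>

lemma restricted_blocks_digit:
  fixes b l j m :: nat
  assumes b: "2 \<le> b" and l: "2 \<le> l" and j: "j < b ^ (l - 2)" and m: "m = b ^ (l - 1) + 1 + b * j"
  shows "m < b ^ l" and "\<And>u. 1 \<le> u \<Longrightarrow> u < 2 * l \<Longrightarrow> b ^ u \<le> (m mod b ^ u) * b ^ l"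
proof -
  obtain n where n: "l = Suc (Suc n)" using l by (metis add_2_eq_Suc le_Suc_ex)
  have l1: "b ^ (l - 1) = b * b ^ (l - 2)" "b ^ l = b * b ^ (l - 1)" by (simp_all add: n)
  have "b * Suc j \<le> b * b ^ (l - 2)" using j by (intro mult_le_mono) auto
  then have "m + b \<le> 2 * b ^ (l - 1) + 1" unfolding l1(1)[symmetric] by (simp add: m)
  moreover have "2 * b ^ (l - 1) \<le> b ^ l" using b by (simp add: l1)
  ultimately show m_less: "m < b ^ l" using b by linarith
  fix u :: nat assume u: "1 \<le> u" "u < 2 * l"
  show "b ^ u \<le> (m mod b ^ u) * b ^ l"
  proof (cases "u \<le> l")
    case True
    have "m = 1 + b * (b ^ (l - 2) + j)" by (simp add: m n distrib_left)
    then have "m mod b = 1 mod b" by (simp only: mod_mult_self2)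
    then have "m mod b = 1" using b by simp
    moreover have "m mod b ^ u mod b = m mod b" using u by (intro mod_mod_cancel) (auto intro: dvd_power)
    ultimately have "m mod b ^ u \<noteq> 0" by (metis mod_0 zero_neq_one)
    then have "1 * b ^ u \<le> (m mod b ^ u) * b ^ l"
      using True b by (intro mult_le_mono power_increasing) auto
    then show ?thesis by simp
  next
    case False
    then have "b ^ l \<le> b ^ u" using b by (intro power_increasing) auto
    then have "m mod b ^ u = m" using m_less by simp
    moreover have "b ^ u \<le> b ^ ((l - 1) + l)" using u b by (intro power_increasing) auto
    moreover have "b ^ (l - 1) * b ^ l \<le> m * b ^ l" by (intro mult_right_mono) (auto simp: m)
    ultimately show ?thesis unfolding power_add by (metis order_trans)
  qed
qed

text \<open>Words of length l that begin and end with 1 may be concatenated freely: a run of zeros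
  lies inside one word and has length at most l - 2. Each word leaves l - 2 free digits. The
  induction prepends a word at the most significant end.\<close>

lemma card_restricted_blocks:
  assumes b: "2 \<le> b" and l: "2 \<le> l"
  shows "(b ^ (l - 2)) ^ Suc q \<le> card (restricted_blocks b l (Suc q))"
proof -
  define T where "T = (\<lambda>j. b ^ (l - 1) + 1 + b * j) ` {..<b ^ (l - 2)}"
  have cT: "card T = b ^ (l - 2)"
    unfolding T_def using b by (subst card_image) (auto simp: inj_on_def)
  have T: "m < b ^ l" "\<And>u. 1 \<le> u \<Longrightarrow> u < 2 * l \<Longrightarrow> b ^ u \<le> (m mod b ^ u) * b ^ l" if "m \<in> T" for m
    using that restricted_blocks_digit[OF b l] by (auto simp: T_def)
  show ?thesis
  proof (induction q)
    case 0
    have "T \<subseteq> restricted_blocks b l (Suc 0)"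
      using T by (auto simp: restricted_blocks_def mult_2)
    then have "card T \<le> card (restricted_blocks b l (Suc 0))" by (intro card_mono finite_restricted_blocks)
    then show ?case by (simp add: cT)
  next
    case (Suc q)
    define p where "p = l * Suc q"
    define f where "f = (\<lambda>(m, k). m * b ^ p + k)"
    have bp: "0 < b ^ p" using b by simp
    have dm: "f (m, k) div b ^ p = m" "f (m, k) mod b ^ p = k" if "k \<in> restricted_blocks b l (Suc q)" for m k
      using that bp by (auto simp: f_def restricted_blocks_def p_def)
    have inj: "inj_on f (T \<times> restricted_blocks b l (Suc q))"
    proof (rule inj_onI, clarify)
      fix m k m' k' assume "k \<in> restricted_blocks b l (Suc q)" "k' \<in> restricted_blocks b l (Suc q)" "f (m, k) = f (m', k')"
      then show "m = m' \<and> k = k'" using dm by metis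
    qed
    have sub: "f ` (T \<times> restricted_blocks b l (Suc q)) \<subseteq> restricted_blocks b l (Suc (Suc q))"
    proof (clarify)
      fix m k assume m: "m \<in> T" and k: "k \<in> restricted_blocks b l (Suc q)"
      have klt: "k < b ^ p" using k by (simp add: restricted_blocks_def p_def)
      have "f (m, k) < Suc m * b ^ p" using klt by (simp add: f_def)
      also have "\<dots> \<le> b ^ l * b ^ p" using T(1)[OF m] by (intro mult_le_mono) auto
      also have "\<dots> = b ^ (l * Suc (Suc q))" by (simp add: p_def power_add)
      finally have 1: "f (m, k) < b ^ (l * Suc (Suc q))" .
      have 2: "b ^ s \<le> (f (m, k) mod b ^ s) * b ^ l" if s: "1 \<le> s" "s < l * Suc (Suc q) + l" for s
      proof (cases "s \<le> p")
        case True
        then have "b ^ s dvd b ^ p" by (rule le_imp_power_dvd)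
        then have "f (m, k) mod b ^ s = k mod b ^ s"
          using dm(2)[OF k] by (metis mod_mod_cancel)
        moreover have "s < l * Suc q + l" using True l by (simp add: p_def)
        ultimately show ?thesis using k s by (auto simp: restricted_blocks_def)
      next
        case False
        \<comment> \<open>The window now starts in the prepended word or in the zeros before it; the
          latter is why u runs up to 2 l - 1.\<close>
        define u where "u = s - p"
        have u: "s = p + u" "1 \<le> u" "u < 2 * l" using False s by (auto simp: u_def p_def)
        have "f (m, k) mod b ^ s = b ^ p * (m mod b ^ u) + k"
          unfolding u(1) power_add mod_mult2_eq using dm[OF k] by simp
        then have "b ^ p * ((m mod b ^ u) * b ^ l) \<le> (f (m, k) mod b ^ s) * b ^ l"
          by (simp add: distrib_right mult.assoc)
        moreover have "b ^ p * b ^ u \<le> b ^ p * ((m mod b ^ u) * b ^ l)"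
          using T(2)[OF m u(2,3)] by (rule mult_le_mono2)
        moreover have "b ^ s = b ^ p * b ^ u" by (simp add: u(1) power_add)
        ultimately show ?thesis by linarith
      qed
      show "f (m, k) \<in> restricted_blocks b l (Suc (Suc q))"
        using 1 2 by (auto simp: restricted_blocks_def)
    qed
    have "(b ^ (l - 2)) ^ Suc (Suc q) \<le> card T * card (restricted_blocks b l (Suc q))"
      using Suc by (simp add: cT)
    also have "\<dots> = card (f ` (T \<times> restricted_blocks b l (Suc q)))"
      using inj by (simp add: card_image card_cartesian_product)
    also have "\<dots> \<le> card (restricted_blocks b l (Suc (Suc q)))"
      using sub by (intro card_mono finite_restricted_blocks)
    finally show ?case .
  qed
qed

section \<open>Numbers whose base-\<open>B\<close> digits are admissible blocks\<close>

definition block_point :: "real \<Rightarrow> (nat \<Rightarrow> nat) \<Rightarrow> real" where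
  "block_point B k = (\<Sum>i. real (k i) / B ^ Suc i)"

definition block_base :: "nat \<Rightarrow> nat \<Rightarrow> real" where
  "block_base b l = real b ^ (l * l)"

text \<open>As a base-\<open>B\<close> digit such a number occupies l * l base-\<open>b\<close>
  digits; being below \<open>b ^ (l * (l - 1))\<close> amounts to the l leading zeros.\<close>

definition admissible_blocks :: "nat \<Rightarrow> nat \<Rightarrow> nat set" where
  "admissible_blocks b l = restricted_blocks b l (l - 1)"

context
  fixes b l :: nat
  assumes b: "2 \<le> b" and l: "2 \<le> l"
begin

private abbreviation B :: real where "B \<equiv> block_base b l"
private abbreviation S :: "nat set" where "S \<equiv> admissible_blocks b l"

lemma block_length_eq: "l * (l - 1) + l = l * l" using l by (simp add: algebra_simps)

lemma block_base_gt_1: "B > 1"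
  unfolding block_base_def using b l by (intro one_less_power) auto

lemma inverse_power_le_half: "(1 / real b ^ l) \<le> 1 / 2"
proof -
  have "(2::real) \<le> real b ^ 1" using b by simp
  also have "\<dots> \<le> real b ^ l" using b l by (intro power_increasing) auto
  finally show ?thesis by (intro divide_left_mono) (use b in auto)
qed

lemma admissible_blocks_le: "(real k + 1) / B \<le> 1 / real b ^ l" if "k \<in> S"
proof -
  have "k + 1 \<le> b ^ (l * (l - 1))" using that by (simp add: admissible_blocks_def restricted_blocks_def)
  then have "real (k + 1) \<le> real (b ^ (l * (l - 1)))" by (simp only: of_nat_le_iff)
  then have "(real k + 1) * real b ^ l \<le> real b ^ (l * (l - 1)) * real b ^ l" by (intro mult_right_mono) auto
  also have "\<dots> = B" unfolding block_base_def power_add[symmetric] block_length_eq ..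
  finally show ?thesis using b block_base_gt_1 by (simp add: field_simps)
qed

lemma admissible_blocks_mod: "real b ^ s / real b ^ l \<le> real (k mod b ^ s)" if "k \<in> S" "1 \<le> s" "s < l * l"
proof -
  have "b ^ s \<le> (k mod b ^ s) * b ^ l" using that block_length_eq by (auto simp: admissible_blocks_def restricted_blocks_def)
  then have "real (b ^ s) \<le> real ((k mod b ^ s) * b ^ l)" by (simp only: of_nat_le_iff)
  then show ?thesis using b by (simp add: field_simps)
qed

lemma admissible_blocks_ge_1: "1 \<le> k" if "k \<in> S"
proof (rule ccontr)
  assume "\<not> 1 \<le> k"
  then have "k = 0" by simp
  moreover have "2 * 2 \<le> l * l" using l by (intro mult_le_mono) auto
  ultimately have "real b ^ 1 / real b ^ l \<le> 0" using admissible_blocks_mod[OF that, of 1] by simp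
  moreover have "real b ^ 1 / real b ^ l > 0" using b by simp
  ultimately show False by linarith
qed

lemma summable_block_point: "summable (\<lambda>i. real (k i) / B ^ Suc i)" if "\<And>i. k i \<in> S" for k
proof (rule summable_comparison_test')
  show "summable (\<lambda>i. (1 / B) ^ i)" using block_base_gt_1 by (intro summable_geometric) auto
  fix i
  have "real (k i) / B \<le> 1"
  proof -
    have "real (k i) / B \<le> (real (k i) + 1) / B" using block_base_gt_1 by (intro divide_right_mono) auto
    then show ?thesis using admissible_blocks_le[OF that[of i]] inverse_power_le_half by linarith
  qed
  then have "real (k i) / B * (1 / B) ^ i \<le> 1 * (1 / B) ^ i" using block_base_gt_1 by (intro mult_right_mono) auto
  then show "norm (real (k i) / B ^ Suc i) \<le> (1 / B) ^ i" using block_base_gt_1 by (simp add: power_divide)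
qed

lemma block_point_unfold:
  assumes "\<And>i. k i \<in> S"
  shows "block_point B k = (real (k 0) + block_point B (\<lambda>i. k (Suc i))) / B"
proof -
  have "block_point B k = real (k 0) / B + (\<Sum>i. real (k (Suc i)) / B ^ Suc (Suc i))"
    unfolding block_point_def using suminf_split_head[OF summable_block_point[of k]] assms by simp
  also have "(\<Sum>i. real (k (Suc i)) / B ^ Suc (Suc i)) = (\<Sum>i. real (k (Suc i)) / B ^ Suc i / B)"
    by (simp add: mult.commute)
  also have "\<dots> = block_point B (\<lambda>i. k (Suc i)) / B"
    unfolding block_point_def using summable_block_point[of "\<lambda>i. k (Suc i)"] assms by (intro suminf_divide) auto
  finally show ?thesis by (simp add: add_divide_distrib)
qed

lemma block_point_bounds:
  assumes "\<And>i. k i \<in> S"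
  shows "0 \<le> block_point B k" "block_point B k \<le> 1 / real b ^ l"
proof -
  show "0 \<le> block_point B k"
    unfolding block_point_def using block_base_gt_1 by (intro suminf_nonneg summable_block_point assms) auto
  \<comment> \<open>An upper bound for a digit divided by \<open>B\<close>. The subtracted 1/B
    absorbs the carry from the geometric tail.\<close>
  define c where "c = (1 / real b ^ l) - 1 / B"
  have s: "summable (\<lambda>i. c * (1 / B) ^ i)" using block_base_gt_1 by (intro summable_mult summable_geometric) auto
  have "block_point B k \<le> (\<Sum>i. c * (1 / B) ^ i)"
    unfolding block_point_def
  proof (intro suminf_le summable_block_point assms s)
    fix i
    have "real (k i) / B \<le> c" using admissible_blocks_le[OF assms[of i]] by (simp add: c_def add_divide_distrib)
    then have "real (k i) / B * (1 / B) ^ i \<le> c * (1 / B) ^ i" using block_base_gt_1 by (intro mult_right_mono) auto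
    then show "real (k i) / B ^ Suc i \<le> c * (1 / B) ^ i" by (simp add: power_divide)
  qed
  also have "\<dots> = c * (1 / (1 - 1 / B))"
    using block_base_gt_1 by (subst suminf_mult) (auto simp: suminf_geometric summable_geometric)
  also have "\<dots> \<le> 1 / real b ^ l"
  proof -
    have "c \<le> (1 / real b ^ l) * (1 - 1 / B)"
      using inverse_power_le_half block_base_gt_1 mult_right_mono[of "1 / real b ^ l" 1 "1 / B"] by (simp add: c_def right_diff_distrib)
    then show ?thesis using block_base_gt_1 by (simp add: pos_divide_le_eq)
  qed
  finally show "block_point B k \<le> 1 / real b ^ l" .
qed

lemma block_point_in_unit:
  assumes "\<And>i. k i \<in> S"
  shows "block_point B k \<in> {0..<1}"
  using block_point_bounds[of k] assms inverse_power_le_half by auto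

text \<open>Multiplication by \<open>B\<close> moves one digit into the integer part. What remains
  is a block point again and hence below 1, so no carry can occur.\<close>

lemma frac_block_point:
  assumes "\<And>i. k i \<in> S"
  shows "frac (B ^ i * block_point B k) = block_point B (\<lambda>j. k (i + j))"
proof (induction i)
  case 0
  show ?case using block_point_in_unit[OF assms] by (simp add: frac_eq)
next
  case (Suc i)
  have Bint: "B = of_int (int b ^ (l * l))" by (simp add: block_base_def)
  have "B ^ Suc i * block_point B k = B * of_int \<lfloor>B ^ i * block_point B k\<rfloor> + B * frac (B ^ i * block_point B k)"
    by (simp add: frac_def algebra_simps)
  also have "B * frac (B ^ i * block_point B k) = real (k i) + block_point B (\<lambda>j. k (Suc i + j))"
    unfolding Suc using block_point_unfold[of "\<lambda>j. k (i + j)"] assms block_base_gt_1 by (simp add: field_simps)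
  finally have "B ^ Suc i * block_point B k = of_int (int b ^ (l * l) * \<lfloor>B ^ i * block_point B k\<rfloor> + int (k i)) + block_point B (\<lambda>j. k (Suc i + j))"
    unfolding Bint[symmetric] by (simp add: Bint)
  then show ?case
    using block_point_in_unit[of "\<lambda>j. k (Suc i + j)"] assms by (simp add: frac_unique_iff)
qed

lemma block_point_diff:
  assumes "\<And>i. k i \<in> S" "\<And>i. k' i \<in> S" "\<And>i. i < j \<Longrightarrow> k i = k' i"
  shows "block_point B k - block_point B k' = (block_point B (\<lambda>i. k (j + i)) - block_point B (\<lambda>i. k' (j + i))) / B ^ j"
  using assms(3)
proof (induction j)
  case (Suc j)
  have "block_point B (\<lambda>i. k (j + i)) = (real (k j) + block_point B (\<lambda>i. k (Suc j + i))) / B"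
      "block_point B (\<lambda>i. k' (j + i)) = (real (k' j) + block_point B (\<lambda>i. k' (Suc j + i))) / B"
    using block_point_unfold[of "\<lambda>i. k (j + i)"] block_point_unfold[of "\<lambda>i. k' (j + i)"] assms(1,2) by simp_all
  moreover have "k j = k' j" using Suc.prems by simp
  ultimately have "block_point B (\<lambda>i. k (j + i)) - block_point B (\<lambda>i. k' (j + i))
    = (block_point B (\<lambda>i. k (Suc j + i)) - block_point B (\<lambda>i. k' (Suc j + i))) / B"
    by (simp only: diff_divide_distrib[symmetric] add_diff_cancel_left)
  then show ?case using Suc by (simp add: mult.commute)
qed simp

text \<open>At the first differing digit the integers are at least 1 apart, while the tails lie in
  [0, 1/2] and can undo at most half of this.\<close>

lemma block_point_dist_ge:
  assumes "\<And>i. k i \<in> S" "\<And>i. k' i \<in> S" "\<And>i. i < j \<Longrightarrow> k i = k' i" "k j \<noteq> k' j"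
  shows "1 / 2 / B ^ Suc j \<le> \<bar>block_point B k - block_point B k'\<bar>"
proof -
  have "\<bar>real (k j) - real (k' j)\<bar> \<ge> 1" using assms(4) by linarith
  moreover have "block_point B (\<lambda>i. k (Suc (j + i))) \<in> {0..1/2}" "block_point B (\<lambda>i. k' (Suc (j + i))) \<in> {0..1/2}"
    using block_point_bounds[of "\<lambda>i. k (Suc (j + i))"] block_point_bounds[of "\<lambda>i. k' (Suc (j + i))"] assms inverse_power_le_half by force+
  ultimately have *: "1 / 2 \<le> \<bar>(real (k j) + block_point B (\<lambda>i. k (Suc (j + i)))) - (real (k' j) + block_point B (\<lambda>i. k' (Suc (j + i))))\<bar>"
    unfolding atLeastAtMost_iff by linarith
  have "block_point B k - block_point B k' = ((real (k j) + block_point B (\<lambda>i. k (Suc (j + i)))) - (real (k' j) + block_point B (\<lambda>i. k' (Suc (j + i))))) / B ^ Suc j"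
  proof -
    have "block_point B (\<lambda>i. k (j + i)) = (real (k j) + block_point B (\<lambda>i. k (Suc (j + i)))) / B"
      "block_point B (\<lambda>i. k' (j + i)) = (real (k' j) + block_point B (\<lambda>i. k' (Suc (j + i)))) / B"
      using block_point_unfold[of "\<lambda>i. k (j + i)"] block_point_unfold[of "\<lambda>i. k' (j + i)"] assms(1,2) by simp_all
    then have "block_point B (\<lambda>i. k (j + i)) - block_point B (\<lambda>i. k' (j + i))
      = ((real (k j) + block_point B (\<lambda>i. k (Suc (j + i)))) - (real (k' j) + block_point B (\<lambda>i. k' (Suc (j + i))))) / B"
      by (simp only: diff_divide_distrib[symmetric])
    moreover have "block_point B k - block_point B k' = (block_point B (\<lambda>i. k (j + i)) - block_point B (\<lambda>i. k' (j + i))) / B ^ j"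
      using assms(1-3) by (rule block_point_diff)
    ultimately show ?thesis
      by (simp only: diff_divide_distrib[symmetric] divide_divide_eq_left power_Suc)
  qed
  also have "\<bar>\<dots>\<bar> \<ge> 1 / 2 / B ^ Suc j"
    unfolding abs_divide using * block_base_gt_1 by (intro order_trans[OF divide_right_mono[OF *]]) (auto simp del: power_Suc)
  finally show ?thesis .
qed

text \<open>A shift that ends inside block i exposes its last \<open>l * l - r\<close> digits. They
  contain no full window of l zeros at their head, even when the window runs past the end of the
  block into the zeros of the next one, because the truncated window already has a nonzero
  digit.\<close>

lemma frac_block_point_mult:
  assumes "\<And>i. k i \<in> S" and r: "0 < r" "r < l * l"
  shows "1 / real b ^ l \<le> frac (real b ^ (l * l * i + r) * block_point B k)"
proof -
  \<comment> \<open>The number of base-\<open>b\<close> digits of block i that are still behind the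
    point.\<close>
  define s where "s = l * l - r"
  have s: "1 \<le> s" "s < l * l" "l * l = r + s" using r by (auto simp: s_def)
  define \<theta> where "\<theta> = block_point B (\<lambda>j. k (Suc i + j))"
  have \<theta>: "0 \<le> \<theta>" "\<theta> < 1" using block_point_in_unit[of "\<lambda>j. k (Suc i + j)"] assms by (auto simp: \<theta>_def)
  have bs: "real b ^ s > 0" using b by simp
  have 1: "frac (B ^ i * block_point B k) = (real (k i) + \<theta>) / B"
    unfolding frac_block_point[OF assms(1)] \<theta>_def using block_point_unfold[of "\<lambda>j. k (i + j)"] assms by simp
  define z where "z = int b ^ r * \<lfloor>B ^ i * block_point B k\<rfloor> + int (k i div b ^ s)"
  have "real b ^ (l * l * i + r) * block_point B k = real b ^ r * (B ^ i * block_point B k)"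
    by (simp add: block_base_def power_add power_mult)
  also have "\<dots> = real b ^ r * of_int \<lfloor>B ^ i * block_point B k\<rfloor> + real b ^ r * frac (B ^ i * block_point B k)"
    by (simp add: frac_def algebra_simps)
  also have "real b ^ r * frac (B ^ i * block_point B k) = (real (k i) + \<theta>) / real b ^ s"
    unfolding 1 using b by (simp add: block_base_def s(3) power_add)
  also have "real (k i) = real b ^ s * real (k i div b ^ s) + real (k i mod b ^ s)"
    by (metis mult_div_mod_eq of_nat_add of_nat_mult of_nat_power)
  also have "(real b ^ s * real (k i div b ^ s) + real (k i mod b ^ s) + \<theta>) / real b ^ s
      = real (k i div b ^ s) + (real (k i mod b ^ s) + \<theta>) / real b ^ s"
    using bs by (simp add: add_divide_distrib)
  finally have eq: "real b ^ (l * l * i + r) * block_point B k = of_int z + (real (k i mod b ^ s) + \<theta>) / real b ^ s"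
    by (simp add: z_def)
  have "k i mod b ^ s + 1 \<le> b ^ s" using b by (simp add: Suc_le_eq)
  then have "real (k i mod b ^ s + 1) \<le> real (b ^ s)" by (simp only: of_nat_le_iff)
  then have lt: "(real (k i mod b ^ s) + \<theta>) / real b ^ s < 1" using \<theta> bs by (simp add: divide_less_eq)
  have "frac (real b ^ (l * l * i + r) * block_point B k) = (real (k i mod b ^ s) + \<theta>) / real b ^ s"
    unfolding eq using lt \<theta> by (simp add: frac_unique_iff)
  moreover have "real b ^ s / real b ^ l / real b ^ s \<le> (real (k i mod b ^ s) + \<theta>) / real b ^ s"
    using admissible_blocks_mod[OF assms(1)[of i] s(1,2)] \<theta> by (intro divide_right_mono) auto
  moreover have "real b ^ s / real b ^ l / real b ^ s = 1 / real b ^ l" using b by simp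
  ultimately show ?thesis by linarith
qed

lemma trapezoid_at_0_1:
  assumes "m \<in> S"
  shows "trapezoid B (real m) 0 = 0" "trapezoid B (real m) 1 = 0"
proof -
  show "trapezoid B (real m) 0 = 0"
    using admissible_blocks_ge_1[OF assms] block_base_gt_1 by (intro trapezoid_eq_0) auto
  have "(real m + 3 / 4) / B \<le> (real m + 1) / B" using block_base_gt_1 by (intro divide_right_mono) auto
  then have "(real m + 3 / 4) / B \<le> 1" using admissible_blocks_le[OF assms] inverse_power_le_half by linarith
  then show "trapezoid B (real m) 1 = 0" using block_base_gt_1 by (intro trapezoid_eq_0) auto
qed

text \<open>Shifts into the interior of a block land at or above \<open>b^(-l)\<close>, beyond the
  support. At a block boundary the point is \<open>(k i + \<theta>) / B\<close> with \<theta> in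
  [0, 1/2]: on the plateau if \<open>k i = m\<close>, outside the support otherwise. So the
  trapezoid acts on the Cantor set as an exact indicator of one block.\<close>

lemma trapezoid_block_point:
  assumes "\<And>i. k i \<in> S" "m \<in> S" "r < l * l"
  shows "trapezoid B (real m) (frac (real b ^ (l * l * i + r) * block_point B k)) = (if r = 0 \<and> k i = m then 1 else 0)"
proof (cases "r = 0")
  case False
  have "(real m + 3 / 4) / B \<le> (real m + 1) / B" using block_base_gt_1 by (intro divide_right_mono) auto
  also have "\<dots> \<le> 1 / real b ^ l" by (rule admissible_blocks_le[OF assms(2)])
  also have "\<dots> \<le> frac (real b ^ (l * l * i + r) * block_point B k)"
    using False assms by (intro frac_block_point_mult) auto
  finally show ?thesis using False block_base_gt_1 by (simp add: trapezoid_eq_0)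
next
  case True
  define \<theta> where "\<theta> = block_point B (\<lambda>j. k (Suc i + j))"
  have \<theta>: "0 \<le> \<theta>" "\<theta> \<le> 1/2" using block_point_bounds[of "\<lambda>j. k (Suc i + j)"] assms inverse_power_le_half by (auto simp: \<theta>_def intro: order_trans)
  have eq: "frac (real b ^ (l * l * i + r) * block_point B k) = (real (k i) + \<theta>) / B"
    using frac_block_point[OF assms(1), of i] block_point_unfold[of "\<lambda>j. k (i + j)"] assms
    by (simp add: \<theta>_def True block_base_def power_mult)
  consider "k i = m" | "k i > m" | "k i < m" by linarith
  then show ?thesis
  proof cases
    case 1
    then show ?thesis unfolding eq using \<theta> block_base_gt_1 True
      by (simp add: trapezoid_eq_1 divide_right_mono)
  next
    case 2
    then have "(real m + 3/4) / B \<le> (real (k i) + \<theta>) / B" using \<theta> block_base_gt_1 by (intro divide_right_mono) auto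
    then show ?thesis unfolding eq using 2 block_base_gt_1 by (simp add: trapezoid_eq_0)
  next
    case 3
    then have "(real (k i) + \<theta>) / B \<le> (real m - 1/4) / B" using \<theta> block_base_gt_1 by (intro divide_right_mono) auto
    then show ?thesis unfolding eq using 3 block_base_gt_1 by (simp add: trapezoid_eq_0)
  qed
qed

end

section \<open>Expected energy of the graph\<close>

text \<open>For |x| \<le> u the kernel is at most u^(-\<gamma>), which gives the 2; the two tails
  are bounded by |x|^(-\<gamma>), integrable since \<gamma> > 1, and give 2/(\<gamma> - 1).\<close>

lemma nn_integral_riesz_kernel_le:
  fixes u \<gamma> :: real
  assumes "u > 0" "\<gamma> > 1"
  shows "(\<integral>\<^sup>+x. ennreal (sqrt (u\<^sup>2 + x\<^sup>2) powr (-\<gamma>)) \<partial>lborel) \<le> ennreal ((2 + 2 / (\<gamma> - 1)) * u powr (1 - \<gamma>))"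
proof -
  define T where "T x = ennreal (x powr (-\<gamma>)) * indicator {u..} x" for x :: real
  have [measurable]: "T \<in> borel_measurable borel" unfolding T_def by measurable
  have T: "(\<integral>\<^sup>+x. T x \<partial>lborel) = ennreal (u powr (1 - \<gamma>) / (\<gamma> - 1))"
  proof -
    have "- (u powr (-\<gamma> + 1)) / (-\<gamma> + 1) = u powr (1 - \<gamma>) / (\<gamma> - 1)"
      using assms by (simp add: field_simps)
    then show ?thesis using nn_integral_powr_atLeast[of "-\<gamma>" u] assms by (simp add: T_def)
  qed
  have T': "(\<integral>\<^sup>+x. T (- x) \<partial>lborel) = ennreal (u powr (1 - \<gamma>) / (\<gamma> - 1))"
    using nn_integral_real_affine[of T "-1" 0] by (simp add: T)
  have "(\<integral>\<^sup>+x. ennreal (sqrt (u\<^sup>2 + x\<^sup>2) powr (-\<gamma>)) \<partial>lborel)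
      \<le> (\<integral>\<^sup>+x. ennreal (u powr (-\<gamma>)) * indicator {-u..u} x + (T x + T (- x)) \<partial>lborel)"
  proof (intro nn_integral_mono)
    fix x :: real
    have "0 < u\<^sup>2 + x\<^sup>2" using assms by (simp add: add_pos_nonneg)
    have r: "sqrt (u\<^sup>2 + x\<^sup>2) powr (-\<gamma>) \<le> u powr (-\<gamma>)"
      using assms by (intro powr_mono2') (auto intro: real_le_rsqrt)
    have r2: "sqrt (u\<^sup>2 + x\<^sup>2) powr (-\<gamma>) \<le> \<bar>x\<bar> powr (-\<gamma>)" if "x \<noteq> 0"
      using assms that by (intro powr_mono2') (auto intro: real_le_rsqrt)
    consider "\<bar>x\<bar> \<le> u" | "x > u" | "x < - u" by linarith
    then show "ennreal (sqrt (u\<^sup>2 + x\<^sup>2) powr (-\<gamma>)) \<le> ennreal (u powr (-\<gamma>)) * indicator {-u..u} x + (T x + T (- x))"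
    proof cases
      case 1
      then have "x \<in> {-u..u}" by auto
      then show ?thesis using r by (simp add: ennreal_leI add_increasing2)
    next
      case 2
      then have "ennreal (sqrt (u\<^sup>2 + x\<^sup>2) powr (-\<gamma>)) \<le> T x" using r2 assms by (auto simp: T_def intro!: ennreal_leI)
      then show ?thesis by (simp add: add_increasing add_increasing2)
    next
      case 3
      then have "ennreal (sqrt (u\<^sup>2 + x\<^sup>2) powr (-\<gamma>)) \<le> T (- x)" using r2 assms by (auto simp: T_def intro!: ennreal_leI)
      then show ?thesis by (simp add: add_increasing)
    qed
  qed
  also have "\<dots> = ennreal (u powr (-\<gamma>)) * ennreal (2 * u) + (ennreal (u powr (1 - \<gamma>) / (\<gamma> - 1)) + ennreal (u powr (1 - \<gamma>) / (\<gamma> - 1)))"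
    using assms by (simp add: nn_integral_add nn_integral_cmult_indicator T T')
  also have "\<dots> = ennreal (u powr (-\<gamma>) * (2 * u) + (u powr (1 - \<gamma>) / (\<gamma> - 1) + u powr (1 - \<gamma>) / (\<gamma> - 1)))"
    using assms by (simp add: ennreal_mult[symmetric] ennreal_plus[symmetric] del: ennreal_plus)
  also have "u powr (-\<gamma>) * (2 * u) + (u powr (1 - \<gamma>) / (\<gamma> - 1) + u powr (1 - \<gamma>) / (\<gamma> - 1)) = (2 + 2 / (\<gamma> - 1)) * u powr (1 - \<gamma>)"
  proof -
    have "u powr (1 - \<gamma>) = u powr (-\<gamma>) * u" using assms powr_add[of u "-\<gamma>" 1] by simp
    then show ?thesis by (simp add: algebra_simps)
  qed
  finally show ?thesis .
qed

text \<open>The density of a Gaussian variable is bounded by the inverse of its standard deviation,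
  so averaging over the vertical distance replaces one factor 1/u of the kernel by 1/s.\<close>

lemma gaussian_riesz_kernel_le:
  assumes "prob_space M" "gaussian_rv M X" "(\<integral>\<omega>. X \<omega> \<partial>M) = 0" "(\<integral>\<omega>. (X \<omega>)\<^sup>2 \<partial>M) = v"
    and s: "0 < s" "s\<^sup>2 \<le> v" and u: "0 < u" "1 < \<gamma>"
  shows "(\<integral>\<^sup>+\<omega>. ennreal (sqrt (u\<^sup>2 + (X \<omega>)\<^sup>2) powr (-\<gamma>)) \<partial>M) \<le> ennreal ((2 + 2 / (\<gamma> - 1)) * u powr (1 - \<gamma>) / s)"
proof -
  have "0 < s\<^sup>2" using s by simp
  then have v: "v > 0" using s by linarith
  have sv: "s \<le> sqrt v" using s by (simp add: real_le_rsqrt)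
  have D: "distributed M lborel X (normal_density 0 (sqrt v))"
    using gaussian_rv_centered_cases[OF assms(1-4)] v by auto
  have dens: "normal_density 0 (sqrt v) x \<le> 1 / s" for x
  proof -
    have "v \<le> 2 * pi * v" using v pi_gt3 by simp
    then have "s \<le> sqrt (2 * pi * v)" using sv by (meson order_trans real_sqrt_le_mono)
    then have "1 / sqrt (2 * pi * v) * exp (- x\<^sup>2 / (2 * v)) \<le> 1 / s * 1"
      using s v by (intro mult_mono frac_le) auto
    then show ?thesis using v by (simp add: normal_density_def)
  qed
  have "(\<integral>\<^sup>+\<omega>. ennreal (sqrt (u\<^sup>2 + (X \<omega>)\<^sup>2) powr (-\<gamma>)) \<partial>M)
      = (\<integral>\<^sup>+x. ennreal (normal_density 0 (sqrt v) x) * ennreal (sqrt (u\<^sup>2 + x\<^sup>2) powr (-\<gamma>)) \<partial>lborel)"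
    by (rule distributed_nn_integral[OF D, symmetric]) measurable
  also have "\<dots> \<le> (\<integral>\<^sup>+x. ennreal (1 / s) * ennreal (sqrt (u\<^sup>2 + x\<^sup>2) powr (-\<gamma>)) \<partial>lborel)"
    using dens by (intro nn_integral_mono mult_right_mono ennreal_leI) auto
  also have "\<dots> = ennreal (1 / s) * (\<integral>\<^sup>+x. ennreal (sqrt (u\<^sup>2 + x\<^sup>2) powr (-\<gamma>)) \<partial>lborel)"
    by (rule nn_integral_cmult) measurable
  also have "\<dots> \<le> ennreal (1 / s) * ennreal ((2 + 2 / (\<gamma> - 1)) * u powr (1 - \<gamma>))"
    using u by (intro mult_left_mono nn_integral_riesz_kernel_le) auto
  also have "\<dots> = ennreal ((2 + 2 / (\<gamma> - 1)) * u powr (1 - \<gamma>) / s)"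
    using s u by (simp add: ennreal_mult[symmetric])
  finally show ?thesis .
qed

text \<open>The points \<open>x n\<close> and \<open>y n\<close> may coincide with each other or
  with 1, whereas the Gaussian property is stated for sums over sets. The coefficients are therefore
  collected point by point; they do not depend on \<open>g\<close>, so the same ones serve for the
  process and for the test function.\<close>

lemma difference_sum_as_combination:
  fixes x y :: "nat \<Rightarrow> real"
  obtains F c where "finite F" "F = insert 1 (x ` {..<P} \<union> y ` {..<P})"
    "\<And>g. (\<Sum>u\<in>F. c u * g u) = (\<Sum>n<P. a n * (g (x n) - g (y n))) - s * (g (1::real) :: real)"
proof -
  define F where "F = insert 1 (x ` {..<P} \<union> y ` {..<P})"
  define c where "c u = (\<Sum>n<P. a n * ((if x n = u then 1 else 0) - (if y n = u then 1 else 0))) - s * (if u = 1 then 1 else 0)" for u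
  have fin: "finite F" by (simp add: F_def)
  have "(\<Sum>u\<in>F. c u * g u) = (\<Sum>n<P. a n * (g (x n) - g (y n))) - s * g 1" for g
  proof -
    have "(\<Sum>u\<in>F. c u * g u) = (\<Sum>u\<in>F. (\<Sum>n<P. a n * ((if x n = u then g u else 0) - (if y n = u then g u else 0))))
        - (\<Sum>u\<in>F. s * (if u = 1 then g u else 0))"
      unfolding sum_subtractf[symmetric] c_def left_diff_distrib sum_distrib_right
      by (intro sum.cong arg_cong2[of _ _ _ _ "(-)"]) auto
    also have "(\<Sum>u\<in>F. (\<Sum>n<P. a n * ((if x n = u then g u else 0) - (if y n = u then g u else 0))))
        = (\<Sum>n<P. a n * ((\<Sum>u\<in>F. if x n = u then g u else 0) - (\<Sum>u\<in>F. if y n = u then g u else 0)))"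
      by (subst sum.swap) (simp only: sum_distrib_left[symmetric] sum_subtractf[symmetric])
    also have "\<dots> = (\<Sum>n<P. a n * (g (x n) - g (y n)))"
      using fin by (intro sum.cong refl) (auto simp: F_def)
    also have "(\<Sum>u\<in>F. s * (if u = 1 then g u else 0)) = s * g 1"
      using fin by (simp add: sum_distrib_left[symmetric] F_def)
    finally show ?thesis .
  qed
  with fin show ?thesis by (intro that[of F c]) (auto simp: F_def)
qed

text \<open>Testing the Gaussian variable against a Cameron--Martin function \<open>h\<close> that vanishes at 0 and 1
  bounds its variance from below, whatever \<open>\<kappa>\<close> is.\<close>

lemma bridge_sum_kernel_le:
  fixes x y :: "nat \<Rightarrow> real"
  assumes fbm: "fractional_brownian_motion M H W" and M: "prob_space M"
    and D: "D > 0" "\<And>F c. finite F \<Longrightarrow> F \<subseteq> {0..} \<Longrightarrow>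
      (\<Sum>t\<in>F. c t * (h t - h 0))\<^sup>2 \<le> D * (\<Sum>s\<in>F. \<Sum>t\<in>F. c s * c t * fbm_cov H s t)"
    and h: "h 0 = 0" "h 1 = 0"
    and xy: "\<And>n. x n \<in> {0..1}" "\<And>n. y n \<in> {0..1}"
    and L: "0 < L" "L \<le> (\<Sum>n<P. a n * (h (x n) - h (y n)))"
    and u: "0 < u" "1 < \<gamma>"
  shows "(\<integral>\<^sup>+\<omega>. ennreal (sqrt (u\<^sup>2 + (\<Sum>n<P. a n * (fractional_bridge \<kappa> W (x n) \<omega> - fractional_bridge \<kappa> W (y n) \<omega>))\<^sup>2) powr (-\<gamma>)) \<partial>M)
    \<le> ennreal ((2 + 2 / (\<gamma> - 1)) * u powr (1 - \<gamma>) * sqrt D / L)"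
proof -
  \<comment> \<open>The whole influence of \<kappa> is one extra weight at the node 1, which a test
    function vanishing at 1 does not see.\<close>
  define s where "s = (\<Sum>n<P. a n * (\<kappa> (x n) - \<kappa> (y n)))"
  obtain F c where F: "finite F" "F = insert 1 (x ` {..<P} \<union> y ` {..<P})"
    and c: "\<And>g. (\<Sum>u\<in>F. c u * g u) = (\<Sum>n<P. a n * (g (x n) - g (y n))) - s * (g (1::real) :: real)"
    using difference_sum_as_combination[of x P y a s] by blast
  have F1: "F \<subseteq> {0..1}" using xy by (auto simp: F)
  have X: "(\<Sum>n<P. a n * (fractional_bridge \<kappa> W (x n) \<omega> - fractional_bridge \<kappa> W (y n) \<omega>)) = (\<Sum>u\<in>F. c u * W u \<omega>)" for \<omega>
  proof -
    have "(\<Sum>n<P. a n * (fractional_bridge \<kappa> W (x n) \<omega> - fractional_bridge \<kappa> W (y n) \<omega>))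
        = (\<Sum>n<P. a n * (W (x n) \<omega> - W (y n) \<omega>)) - s * W 1 \<omega>"
      unfolding s_def sum_distrib_right sum_subtractf[symmetric]
      by (intro sum.cong refl) (simp add: fractional_bridge_def algebra_simps)
    then show ?thesis using c[of "\<lambda>u. W u \<omega>"] by simp
  qed
  define v where "v = (\<Sum>s\<in>F. \<Sum>t\<in>F. c s * c t * fbm_cov H s t)"
  note comb = fbm_combination[OF fbm M F(1) F1, of c, folded fbm_cov_def, folded v_def]
  have "L\<^sup>2 \<le> (\<Sum>n<P. a n * (h (x n) - h (y n)))\<^sup>2" using L by (intro power_mono) auto
  also have "\<dots> = (\<Sum>t\<in>F. c t * (h t - h 0))\<^sup>2" using c[of h] h by simp
  also have "\<dots> \<le> D * v" unfolding v_def using F F1 by (intro D(2)) auto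
  finally have "(L / sqrt D)\<^sup>2 \<le> v" using D(1) by (simp add: power_divide divide_le_eq mult.commute)
  then have "(\<integral>\<^sup>+\<omega>. ennreal (sqrt (u\<^sup>2 + (\<Sum>u\<in>F. c u * W u \<omega>)\<^sup>2) powr (-\<gamma>)) \<partial>M)
      \<le> ennreal ((2 + 2 / (\<gamma> - 1)) * u powr (1 - \<gamma>) / (L / sqrt D))"
    using D(1) L(1) u by (intro gaussian_riesz_kernel_le[OF M comb]) auto
  then show ?thesis unfolding X by simp
qed

section \<open>Kernel estimate for two points of the Cantor set\<close>

lemma fractional_bridge_bounded:
  assumes "fractional_brownian_motion M H W" "\<kappa> ` {0..1} \<subseteq> {0..1}" "\<omega> \<in> space M"
  obtains c where "\<And>u. u \<in> {0..1} \<Longrightarrow> \<bar>fractional_bridge \<kappa> W u \<omega>\<bar> \<le> c"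
proof -
  have "continuous_on {0..1} (\<lambda>t. W t \<omega>)" using assms by (auto simp: fractional_brownian_motion_def)
  then have "compact ((\<lambda>t. W t \<omega>) ` {0..1})" by (intro compact_continuous_image) auto
  then obtain c where "\<forall>u\<in>{0..1}. \<bar>W u \<omega>\<bar> \<le> c"
    by (auto dest!: compact_imp_bounded simp: bounded_iff)
  then have c: "\<And>u. u \<in> {0..1} \<Longrightarrow> \<bar>W u \<omega>\<bar> \<le> c" by blast
  have "\<bar>fractional_bridge \<kappa> W u \<omega>\<bar> \<le> c + 1 * c" if "u \<in> {0..1}" for u
  proof -
    have "\<bar>\<kappa> u * W 1 \<omega>\<bar> \<le> 1 * c"
      unfolding abs_mult using assms(2) that c[of 1] by (intro mult_mono) (auto simp: image_subset_iff)
    then show ?thesis unfolding fractional_bridge_def using c[OF that] by linarith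
  qed
  then show ?thesis by (rule that)
qed

lemma wiener_weierstrass_summable:
  assumes "fractional_brownian_motion M H W" "\<kappa> ` {0..1} \<subseteq> {0..1}" "\<omega> \<in> space M" "0 < \<alpha>" "\<alpha> < 1"
  shows "summable (\<lambda>n. \<alpha> ^ n * fractional_bridge \<kappa> W (frac (real b ^ n * t)) \<omega>)"
proof -
  obtain c where c: "\<And>u. u \<in> {0..1} \<Longrightarrow> \<bar>fractional_bridge \<kappa> W u \<omega>\<bar> \<le> c"
    using fractional_bridge_bounded[OF assms(1-3)] by blast
  show ?thesis
  proof (rule summable_comparison_test')
    show "summable (\<lambda>n. \<alpha> ^ n * c)" using assms by (intro summable_mult2 summable_geometric) auto
    fix n
    have "\<bar>fractional_bridge \<kappa> W (frac (real b ^ n * t)) \<omega>\<bar> \<le> c"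
      by (intro c) (auto simp: frac_lt_1 less_imp_le)
    then show "norm (\<alpha> ^ n * fractional_bridge \<kappa> W (frac (real b ^ n * t)) \<omega>) \<le> \<alpha> ^ n * c"
      using assms by (simp add: abs_mult)
  qed
qed

text \<open>Grouping the indices by blocks leaves the sum of \<open>a ^ i * e i\<close> with
  \<open>e i\<close> in {-1, 0, 1}. Blocks before j cancel, block j gives 1, and the later blocks
  can take away at most half of it since \<open>a \<le> 1 / 3\<close>.\<close>

lemma sum_trapezoid_block_points_ge:
  fixes b l j :: nat
  defines "S \<equiv> admissible_blocks b l" and "B \<equiv> block_base b l"
  assumes b: "2 \<le> b" and l: "2 \<le> l"
    and k: "\<And>i. k i \<in> S" "\<And>i. k' i \<in> S" "\<And>i. i < j \<Longrightarrow> k i = k' i" "k j \<noteq> k' j"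
    and \<alpha>: "0 < \<alpha>" "\<alpha> ^ (l * l) \<le> 1 / 3" and Q: "j < Q"
  shows "\<alpha> ^ (l * l * j) / 2 \<le> (\<Sum>n<Q * (l * l). \<alpha> ^ n *
    (trapezoid B (real (k j)) (frac (real b ^ n * block_point B k)) - trapezoid B (real (k j)) (frac (real b ^ n * block_point B k'))))"
proof -
  define M where "M = l * l"
  define a where "a = \<alpha> ^ M"
  have a: "0 < a" "a \<le> 1 / 3" using \<alpha> by (auto simp: a_def M_def)
  have M: "0 < M" using l by (simp add: M_def)
  define f where "f n = \<alpha> ^ n * (trapezoid B (real (k j)) (frac (real b ^ n * block_point B k)) - trapezoid B (real (k j)) (frac (real b ^ n * block_point B k')))" for n
  define e where "e i = (if k i = k j then 1 else 0) - (if k' i = k j then 1 else 0 :: real)" for i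
  have f: "f (M * i + r) = (if r = 0 then a ^ i * e i else 0)" if "r < M" for i r
    using trapezoid_block_point[OF b l, of k "k j" r i] trapezoid_block_point[OF b l, of k' "k j" r i] that k
    by (auto simp: f_def e_def S_def B_def M_def a_def power_mult[symmetric])
  have "(\<Sum>n<Q * M. f n) = (\<Sum>i<Q. sum f {i * M..<i * M + M})" by (rule sum.nat_group[symmetric])
  also have "\<dots> = (\<Sum>i<Q. a ^ i * e i)"
  proof (intro sum.cong refl)
    fix i
    have "sum f {i * M..<i * M + M} = (\<Sum>r<M. f (M * i + r))"
      by (rule sum.reindex_bij_witness[where i = "\<lambda>r. M * i + r" and j = "\<lambda>n. n - M * i"]) (auto simp: mult.commute)
    also have "\<dots> = (\<Sum>r<M. if r = 0 then a ^ i * e i else 0)" by (intro sum.cong refl f) auto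
    also have "\<dots> = a ^ i * e i" using M by simp
    finally show "sum f {i * M..<i * M + M} = a ^ i * e i" .
  qed
  also have "\<dots> = (\<Sum>i<j. a ^ i * e i) + (\<Sum>i=j..<Q. a ^ i * e i)"
    using Q by (metis atLeast0LessThan less_imp_le sum.atLeastLessThan_concat zero_le)
  also have "(\<Sum>i<j. a ^ i * e i) = 0" using k(3) by (intro sum.neutral) (auto simp: e_def)
  also have "(\<Sum>i=j..<Q. a ^ i * e i) = a ^ j * e j + (\<Sum>i=Suc j..<Q. a ^ i * e i)"
    using Q by (rule sum.atLeast_Suc_lessThan)
  also have "e j = 1" using k(4) by (auto simp: e_def)
  finally have eq: "(\<Sum>n<Q * M. f n) = a ^ j + (\<Sum>i=Suc j..<Q. a ^ i * e i)" by simp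
  have "(\<Sum>i=Suc j..<Q. a ^ i * e i) \<ge> - (a ^ j / 2)"
  proof -
    have "(\<Sum>i=Suc j..<Q. a ^ i * e i) \<ge> (\<Sum>i=Suc j..<Q. - (a ^ i))"
    proof (intro sum_mono)
      fix i
      have "a ^ i * (- 1) \<le> a ^ i * e i" using a by (intro mult_left_mono) (auto simp: e_def)
      then show "- (a ^ i) \<le> a ^ i * e i" by simp
    qed
    moreover have "(\<Sum>i=Suc j..<Q. a ^ i) \<le> a ^ j / 2"
    proof -
      \<comment> \<open>The extra term \<open>a ^ (j + d) / 2\<close> carries the induction: one
        step needs 3/2 times \<open>a\<close> to be at most 1/2, which is where 1/3 comes
        from.\<close>
      have *: "(\<Sum>i=Suc j..<Suc j + d. a ^ i) + a ^ (j + d) / 2 \<le> a ^ j / 2" for d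
      proof (induction d)
        case (Suc d)
        have "a ^ (j + d) * a \<le> a ^ (j + d) * (1 / 3)" using a by (intro mult_left_mono) auto
        then show ?case using Suc by (simp add: mult.commute)
      qed simp
      obtain d where d: "Q = Suc j + d" using Q less_imp_Suc_add by fastforce
      have "0 \<le> a ^ (j + d)" using a by simp
      then show ?thesis unfolding d using *[of d] by linarith
    qed
    ultimately show ?thesis by (simp add: sum_negf)
  qed
  with eq have "a ^ j / 2 \<le> (\<Sum>n<Q * M. f n)" by linarith
  then show ?thesis unfolding f_def M_def a_def power_mult[symmetric] .
qed

text \<open>The infinite series is never shown to be Gaussian. Its partial sums over whole blocks
  are finite combinations of the process and satisfy the bound uniformly as soon as they include
  block j; Fatou's lemma carries it to the limit.\<close>

lemma bridge_kernel_le: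
  fixes \<kappa> :: "real \<Rightarrow> real" and b l j :: nat
  defines "S \<equiv> admissible_blocks b l" and "B \<equiv> block_base b l"
  assumes fbm: "fractional_brownian_motion M H W" and M: "prob_space M"
    and \<kappa>: "\<kappa> ` {0..1} \<subseteq> {0..1}"
    and D: "D > 0" "\<And>m F c. finite F \<Longrightarrow> F \<subseteq> {0..} \<Longrightarrow>
      (\<Sum>t\<in>F. c t * (trapezoid B m t - trapezoid B m 0))\<^sup>2 \<le> D * (\<Sum>s\<in>F. \<Sum>t\<in>F. c s * c t * fbm_cov H s t)"
    and b: "2 \<le> b" and l: "2 \<le> l"
    and k: "\<And>i. k i \<in> S" "\<And>i. k' i \<in> S" "\<And>i. i < j \<Longrightarrow> k i = k' i" "k j \<noteq> k' j"
    and \<alpha>: "0 < \<alpha>" "\<alpha> < 1" "\<alpha> ^ (l * l) \<le> 1 / 3" and \<gamma>: "1 < \<gamma>"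
  defines "Y \<equiv> wiener_weierstrass_bridge \<alpha> b \<kappa> W"
  shows "(\<integral>\<^sup>+\<omega>. inverse (ennreal (dist (block_point B k, Y (block_point B k) \<omega>) (block_point B k', Y (block_point B k') \<omega>) powr \<gamma>)) \<partial>M)
    \<le> ennreal ((2 + 2 / (\<gamma> - 1)) * (1 / 2 / B ^ Suc j) powr (1 - \<gamma>) * sqrt D / (\<alpha> ^ (l * l * j) / 2))"
proof -
  interpret prob_space M by fact
  define t where "t = block_point B k"
  define t' where "t' = block_point B k'"
  define d where "d = \<bar>t - t'\<bar>"
  define C where "C = (2 + 2 / (\<gamma> - 1)) * (1 / 2 / B ^ Suc j) powr (1 - \<gamma>) * sqrt D / (\<alpha> ^ (l * l * j) / 2)"
  have B1: "B > 1" unfolding B_def using b l by (rule block_base_gt_1)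
  have d: "1 / 2 / B ^ Suc j \<le> d"
    unfolding d_def t_def t'_def B_def using k by (intro block_point_dist_ge b l) (auto simp: S_def)
  have dl: "0 < 1 / 2 / B ^ Suc j" using B1 by simp
  with d have d0: "d > 0" by linarith
  define g where "g n \<omega> = \<alpha> ^ n * (fractional_bridge \<kappa> W (frac (real b ^ n * t)) \<omega> - fractional_bridge \<kappa> W (frac (real b ^ n * t')) \<omega>)" for n \<omega>
  define Z where "Z Q \<omega> = (\<Sum>n<Q * (l * l). g n \<omega>)" for Q \<omega>
  have fr: "frac x \<in> {0..1}" for x :: real using frac_lt_1[of x] by (auto simp: less_imp_le)
  have lim: "(\<lambda>Q. Z Q \<omega>) \<longlonglongrightarrow> Y t \<omega> - Y t' \<omega>" if "\<omega> \<in> space M" for \<omega>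
  proof -
    note s = wiener_weierstrass_summable[OF fbm \<kappa> that \<alpha>(1,2), of b]
    have "(\<lambda>n. g n \<omega>) sums (Y t \<omega> - Y t' \<omega>)"
      unfolding g_def Y_def wiener_weierstrass_bridge_def right_diff_distrib
      by (intro sums_diff summable_sums s)
    then have "(\<lambda>P. \<Sum>n<P. g n \<omega>) \<longlonglongrightarrow> Y t \<omega> - Y t' \<omega>" by (simp add: sums_def)
    moreover have "filterlim (\<lambda>Q. Q * (l * l)) sequentially sequentially"
      using l by (intro mult_nat_right_at_top) auto
    ultimately show ?thesis unfolding Z_def by (rule filterlim_compose)
  qed
  define f where "f Q \<omega> = ennreal (sqrt (d\<^sup>2 + (Z Q \<omega>)\<^sup>2) powr (-\<gamma>))" for Q \<omega>
  have Zm: "Z Q \<in> borel_measurable M" for Q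
  proof -
    have [measurable]: "W u \<in> borel_measurable M" if "u \<in> {0..1}" for u
      using fbm_combination(1)[OF fbm M, of "{u}" "\<lambda>_. 1"] that by (simp add: gaussian_rv_def)
    have [measurable]: "W (frac x) \<in> borel_measurable M" "W 1 \<in> borel_measurable M" for x
      using fr by auto
    show ?thesis unfolding Z_def g_def fractional_bridge_def by measurable
  qed
  have fm: "f Q \<in> borel_measurable M" for Q
    unfolding f_def using Zm by measurable
  have fC: "(\<integral>\<^sup>+\<omega>. f Q \<omega> \<partial>M) \<le> ennreal C" if "j < Q" for Q
  proof -
    have kj: "k j \<in> admissible_blocks b l" using k by (simp add: S_def)
    have "(\<integral>\<^sup>+\<omega>. f Q \<omega> \<partial>M) \<le> ennreal ((2 + 2 / (\<gamma> - 1)) * d powr (1 - \<gamma>) * sqrt D / (\<alpha> ^ (l * l * j) / 2))"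
      unfolding f_def Z_def g_def
    proof (rule bridge_sum_kernel_le[OF fbm M D(1), where h = "trapezoid B (real (k j))"])
      show "trapezoid B (real (k j)) 0 = 0" "trapezoid B (real (k j)) 1 = 0"
        unfolding B_def by (rule trapezoid_at_0_1[OF b l kj])+
      show "\<alpha> ^ (l * l * j) / 2 \<le> (\<Sum>n<Q * (l * l). \<alpha> ^ n * (trapezoid B (real (k j)) (frac (real b ^ n * t)) - trapezoid B (real (k j)) (frac (real b ^ n * t'))))"
        unfolding t_def t'_def B_def
        using k \<alpha> that by (intro sum_trapezoid_block_points_ge b l) (auto simp: S_def)
    qed (use D(2) fr \<alpha> d0 \<gamma> in auto)
    also have "\<dots> \<le> ennreal C"
    proof (intro ennreal_leI)
      have "d powr (1 - \<gamma>) \<le> (1 / 2 / B ^ Suc j) powr (1 - \<gamma>)"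
        using d dl \<gamma> by (intro powr_mono2') auto
      then show "(2 + 2 / (\<gamma> - 1)) * d powr (1 - \<gamma>) * sqrt D / (\<alpha> ^ (l * l * j) / 2) \<le> C"
        unfolding C_def using \<gamma> D(1) \<alpha> by (intro divide_right_mono mult_right_mono mult_left_mono) auto
    qed
    finally show ?thesis .
  qed
  have "(\<integral>\<^sup>+\<omega>. inverse (ennreal (dist (t, Y t \<omega>) (t', Y t' \<omega>) powr \<gamma>)) \<partial>M) = (\<integral>\<^sup>+\<omega>. liminf (\<lambda>Q. f Q \<omega>) \<partial>M)"
  proof (rule nn_integral_cong)
    fix \<omega> assume \<omega>: "\<omega> \<in> space M"
    have pos: "d\<^sup>2 + x\<^sup>2 > 0" for x using d0 by (simp add: add_pos_nonneg)
    have "(\<lambda>Q. f Q \<omega>) \<longlonglongrightarrow> ennreal (sqrt (d\<^sup>2 + (Y t \<omega> - Y t' \<omega>)\<^sup>2) powr (-\<gamma>))"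
      unfolding f_def using pos[of "Y t \<omega> - Y t' \<omega>"] by (intro tendsto_ennrealI tendsto_intros lim \<omega>) auto
    then have "liminf (\<lambda>Q. f Q \<omega>) = ennreal (sqrt (d\<^sup>2 + (Y t \<omega> - Y t' \<omega>)\<^sup>2) powr (-\<gamma>))"
      by (intro lim_imp_Liminf) auto
    moreover have "dist (t, Y t \<omega>) (t', Y t' \<omega>) = sqrt (d\<^sup>2 + (Y t \<omega> - Y t' \<omega>)\<^sup>2)"
      by (simp add: dist_Pair_Pair dist_real_def d_def)
    moreover have "0 < sqrt (d\<^sup>2 + (Y t \<omega> - Y t' \<omega>)\<^sup>2) powr \<gamma>"
      using d0 by simp
    ultimately show "inverse (ennreal (dist (t, Y t \<omega>) (t', Y t' \<omega>) powr \<gamma>)) = liminf (\<lambda>Q. f Q \<omega>)"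
      by (simp only: inverse_ennreal powr_minus)
  qed
  also have "\<dots> \<le> liminf (\<lambda>Q. \<integral>\<^sup>+\<omega>. f Q \<omega> \<partial>M)" by (rule nn_integral_liminf[OF fm])
  also have "\<dots> \<le> ennreal C"
  proof -
    have "eventually (\<lambda>Q. (\<integral>\<^sup>+\<omega>. f Q \<omega> \<partial>M) \<le> ennreal C) sequentially"
      using eventually_gt_at_top[of j] by eventually_elim (rule fC)
    then have "liminf (\<lambda>Q. \<integral>\<^sup>+\<omega>. f Q \<omega> \<partial>M) \<le> liminf (\<lambda>Q. ennreal C)" by (rule Liminf_mono)
    then show ?thesis by (simp add: Liminf_const)
  qed
  finally show ?thesis unfolding t_def t'_def C_def .
qed

section \<open>Random block sequences and joint measurability\<close>

lemma emeasure_PiM_uniform_prefix: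
  fixes S :: "'b set"
  assumes S: "finite S" "S \<noteq> {}" and w: "\<And>i. w i \<in> S"
  defines "N \<equiv> PiM UNIV (\<lambda>_::nat. uniform_count_measure S)"
  shows "{v \<in> space N. \<forall>i<j. w i = v i} \<in> sets N"
    and "emeasure N {v \<in> space N. \<forall>i<j. w i = v i} = ennreal ((1 / real (card S)) ^ j)"
proof -
  interpret U: prob_space "uniform_count_measure S" by (rule prob_space_uniform_count_measure[OF S])
  interpret product_prob_space "\<lambda>_::nat. uniform_count_measure S" UNIV ..
  have eq: "{v \<in> space N. \<forall>i<j. w i = v i} = {v \<in> space N. \<forall>i\<in>{..<j}. v i \<in> {w i}}" by auto
  have sets1: "{w i} \<in> sets (uniform_count_measure S)" for i using w by (simp add: sets_uniform_count_measure)
  show "{v \<in> space N. \<forall>i<j. w i = v i} \<in> sets N"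
    unfolding eq unfolding N_def
    by (intro sets.sets_Collect_finite_All sets_Collect_single')
      (auto simp: sets_uniform_count_measure space_uniform_count_measure)
  have "emeasure N {v \<in> space N. \<forall>i\<in>{..<j}. v i \<in> {w i}} = (\<Prod>i<j. emeasure (uniform_count_measure S) {w i})"
    unfolding N_def using sets1 by (intro emeasure_PiM_Collect) auto
  also have "\<dots> = (\<Prod>i<j. ennreal (1 / real (card S)))"
    using w S by (intro prod.cong refl) (simp add: emeasure_uniform_count_measure)
  also have "\<dots> = ennreal ((1 / real (card S)) ^ j)" by (simp add: ennreal_power)
  finally show "emeasure N {v \<in> space N. \<forall>i<j. w i = v i} = ennreal ((1 / real (card S)) ^ j)" unfolding eq .
qed

text \<open>Sampling the path on the grid of step 1/(n + 1) gives a jointly measurable function,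
  because the index takes countably many values; by continuity the samples converge. The argument is
  clamped to [0,1], since outside nothing is known about the process.\<close>

lemma fbm_jointly_measurable:
  assumes fbm: "fractional_brownian_motion M H W" and M: "prob_space M"
  shows "(\<lambda>(x, \<omega>). W (max 0 (min 1 x)) \<omega>) \<in> borel_measurable (borel \<Otimes>\<^sub>M M)"
proof (rule borel_measurable_LIMSEQ_real)
  define c where "c x = max 0 (min 1 x)" for x :: real
  define i where "i n x = nat \<lfloor>real (Suc n) * c x\<rfloor>" for n and x :: real
  have c01: "c x \<in> {0..1}" for x by (auto simp: c_def)
  have [measurable]: "c \<in> borel_measurable borel" unfolding c_def by measurable
  have Wm: "W u \<in> borel_measurable M" if "u \<in> {0..1}" for u
    using fbm_combination(1)[OF fbm M, of "{u}" "\<lambda>_. 1"] that by (simp add: gaussian_rv_def)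
  have [measurable]: "W (min 1 (real m / real (Suc n))) \<in> borel_measurable M" for m n
    by (rule Wm) auto
  show "(\<lambda>p. W (min 1 (real (i n (fst p)) / real (Suc n))) (snd p)) \<in> borel_measurable (borel \<Otimes>\<^sub>M M)" for n
  proof (rule measurable_compose_countable[where g = "\<lambda>p. i n (fst p)" and f = "\<lambda>m p. W (min 1 (real m / real (Suc n))) (snd p)"])
    show "(\<lambda>p. i n (fst p)) \<in> borel \<Otimes>\<^sub>M M \<rightarrow>\<^sub>M count_space UNIV" unfolding i_def by measurable
  qed measurable
  fix p :: "real \<times> _" assume "p \<in> space (borel \<Otimes>\<^sub>M M)"
  then obtain x \<omega> where p: "p = (x, \<omega>)" "\<omega> \<in> space M" by (auto simp: space_pair_measure)
  have cont: "continuous_on {0..1} (\<lambda>t. W t \<omega>)" using fbm p by (auto simp: fractional_brownian_motion_def)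
  have "(\<lambda>n. min 1 (real (i n x) / real (Suc n))) \<longlonglongrightarrow> min 1 (c x)"
  proof (intro tendsto_min tendsto_const)
    show "(\<lambda>n. real (i n x) / real (Suc n)) \<longlonglongrightarrow> c x"
    proof (rule tendsto_sandwich[where f = "\<lambda>n. c x - 1 / real (Suc n)" and h = "\<lambda>_. c x"])
      have "(\<lambda>n. c x - 1 / real (Suc n)) \<longlonglongrightarrow> c x - 0"
        by (intro tendsto_diff tendsto_const LIMSEQ_Suc[OF lim_1_over_n, unfolded of_nat_Suc[symmetric]])
      then show "(\<lambda>n. c x - 1 / real (Suc n)) \<longlonglongrightarrow> c x" by simp
      have fl: "real (i n x) = of_int \<lfloor>real (Suc n) * c x\<rfloor>" for n
        using c01[of x] by (simp add: i_def)
      have "z - 1 \<le> of_int \<lfloor>z\<rfloor>" "of_int \<lfloor>z\<rfloor> \<le> z" for z :: real by linarith+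
      then have *: "real (Suc n) * c x - 1 \<le> real (i n x)" "real (i n x) \<le> real (Suc n) * c x" for n
        unfolding fl by blast+
      have "(real (Suc n) * c x - 1) / real (Suc n) \<le> real (i n x) / real (Suc n)" for n
        using * by (intro divide_right_mono) auto
      moreover have "(real (Suc n) * c x - 1) / real (Suc n) = c x - 1 / real (Suc n)" for n
        by (simp add: diff_divide_distrib del: of_nat_Suc)
      ultimately show "\<forall>\<^sub>F n in sequentially. c x - 1 / real (Suc n) \<le> real (i n x) / real (Suc n)" by simp
      have "real (i n x) / real (Suc n) \<le> c x" for n
        using *(2)[of n] by (simp add: pos_divide_le_eq mult.commute del: of_nat_Suc)
      then show "\<forall>\<^sub>F n in sequentially. real (i n x) / real (Suc n) \<le> c x" by simp
    qed auto
  qed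
  then have "(\<lambda>n. min 1 (real (i n x) / real (Suc n))) \<longlonglongrightarrow> c x" using c01[of x] by simp
  then have "(\<lambda>n. W (min 1 (real (i n x) / real (Suc n))) \<omega>) \<longlonglongrightarrow> W (c x) \<omega>"
    using c01[of x] by (intro continuous_on_tendsto_compose[OF cont]) auto
  then show "(\<lambda>n. W (min 1 (real (i n (fst p)) / real (Suc n))) (snd p)) \<longlonglongrightarrow> (case p of (x, \<omega>) \<Rightarrow> W (max 0 (min 1 x)) \<omega>)"
    by (simp add: p c_def)
qed

lemma bridge_jointly_measurable:
  assumes fbm: "fractional_brownian_motion M H W" and M: "prob_space M"
    and \<kappa>: "continuous_on {0..1} \<kappa>" and [measurable]: "t \<in> borel_measurable N"
  shows "(\<lambda>(w, \<omega>). wiener_weierstrass_bridge \<alpha> b \<kappa> W (t w) \<omega>) \<in> borel_measurable (N \<Otimes>\<^sub>M M)"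
proof -
  define c where "c x = max 0 (min 1 x)" for x :: real
  have cf: "c (frac x) = frac x" for x using frac_lt_1[of x] by (simp add: c_def)
  note [measurable] = fbm_jointly_measurable[OF fbm M, folded c_def]
  have "continuous_on UNIV (\<lambda>x. \<kappa> (c x))"
    by (rule continuous_on_compose2[OF \<kappa>]) (auto simp: c_def intro!: continuous_intros)
  then have [measurable]: "(\<lambda>x. \<kappa> (c x)) \<in> borel_measurable borel" by (rule borel_measurable_continuous_onI)
  have [measurable]: "W 1 \<in> borel_measurable M"
    using fbm_combination(1)[OF fbm M, of "{1}" "\<lambda>_. 1"] by (simp add: gaussian_rv_def)
  have [measurable]: "(frac :: real \<Rightarrow> real) \<in> borel_measurable borel"
    unfolding frac_def[abs_def] by measurable
  have "(\<lambda>p. \<Sum>n. \<alpha> ^ n * (W (c (frac (real b ^ n * t (fst p)))) (snd p) - \<kappa> (c (frac (real b ^ n * t (fst p)))) * W 1 (snd p)))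
      \<in> borel_measurable (N \<Otimes>\<^sub>M M)"
  proof -
    have [measurable]: "(\<lambda>p. W (c (frac (real b ^ n * t (fst p)))) (snd p)) \<in> borel_measurable (N \<Otimes>\<^sub>M M)" for n
    proof -
      have "(\<lambda>p. (frac (real b ^ n * t (fst p)), snd p)) \<in> N \<Otimes>\<^sub>M M \<rightarrow>\<^sub>M borel \<Otimes>\<^sub>M M" by measurable
      from measurable_compose[OF this fbm_jointly_measurable[OF fbm M, folded c_def]] show ?thesis by simp
    qed
    have [measurable]: "(\<lambda>p. \<kappa> (c (frac (real b ^ n * t (fst p))))) \<in> borel_measurable (N \<Otimes>\<^sub>M M)" for n
    proof -
      have "(\<lambda>p. frac (real b ^ n * t (fst p))) \<in> borel_measurable (N \<Otimes>\<^sub>M M)" by measurable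
      from measurable_compose[OF this \<open>(\<lambda>x. \<kappa> (c x)) \<in> borel_measurable borel\<close>] show ?thesis .
    qed
    show ?thesis by measurable
  qed
  then show ?thesis
    unfolding cf wiener_weierstrass_bridge_def fractional_bridge_def by (simp add: case_prod_beta)
qed

text \<open>The sequences sharing the first j entries with \<open>w\<close> have probability tending
  to 0. This disposes of the diagonal, where the energy kernel is infinite.\<close>

lemma AE_uniform_product_neq:
  fixes S :: "'b set"
  assumes S: "finite S" "card S \<ge> 2" and w: "\<And>i. w i \<in> S"
  shows "AE v in PiM UNIV (\<lambda>_::nat. uniform_count_measure S). v \<noteq> w"
proof -
  define N where "N = PiM UNIV (\<lambda>_::nat. uniform_count_measure S)"
  have S0: "S \<noteq> {}" using S by auto
  define A where "A j = {v \<in> space N. \<forall>i<j. w i = v i}" for j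
  have A: "A j \<in> sets N" "emeasure N (A j) = ennreal ((1 / real (card S)) ^ j)" for j
    unfolding A_def N_def by (rule emeasure_PiM_uniform_prefix[OF S(1) S0 w])+
  have lim: "(\<lambda>j. ennreal ((1 / real (card S)) ^ j)) \<longlonglongrightarrow> ennreal 0"
    using S by (intro tendsto_ennrealI LIMSEQ_power_zero) auto
  have "emeasure N (\<Inter>j. A j) \<le> ennreal ((1 / real (card S)) ^ j)" for j
    unfolding A(2)[symmetric] using A(1) by (intro emeasure_mono) auto
  then have "emeasure N (\<Inter>j. A j) \<le> ennreal 0"
    by (intro LIMSEQ_le_const[OF lim]) auto
  moreover have "(\<Inter>j. A j) \<in> sets N" using A(1) by (intro sets.countable_INT) auto
  ultimately have "(\<Inter>j. A j) \<in> null_sets N" by (intro null_setsI) auto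
  then have "AE v in N. v \<notin> (\<Inter>j. A j)" by (rule AE_not_in)
  moreover have "AE v in N. v \<in> space N" by (rule AE_space)
  ultimately show ?thesis unfolding N_def[symmetric]
    by eventually_elim (auto simp: A_def)
qed

section \<open>Lower and upper bounds for the dimension\<close>

lemma exists_block_length:
  fixes \<alpha> s :: real
  assumes "0 < \<alpha>" "\<alpha> < 1" "0 \<le> s" "s < 1"
  obtains l :: nat where "2 \<le> l" "\<alpha> ^ (l * l) \<le> 1 / 3" "s * real (l * l) < real ((l - 2) * (l - 1))"
proof -
  obtain m where m: "\<alpha> ^ m < 1 / 3" using real_arch_pow_inv[of "1/3" \<alpha>] assms by auto
  obtain n :: nat where n: "3 / (1 - s) < real n" using reals_Archimedean2 by blast
  \<comment> \<open>Since (l - 2)(l - 1) = l^2 - 3 l + 2, the entropy condition holds once (1 - s) l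
    exceeds 3, which \<open>n\<close> provides; \<open>m\<close> takes care of the power of
    \<alpha>.\<close>
  define l where "l = max 2 (max m n)"
  have l: "2 \<le> l" "m \<le> l" "n \<le> l" by (auto simp: l_def)
  have "l * 1 \<le> l * l" using l(1) by (intro mult_le_mono) auto
  then have "m \<le> l * l" using l(2) by linarith
  then have "\<alpha> ^ (l * l) \<le> \<alpha> ^ m" using assms by (intro power_decreasing) auto
  moreover have "s * real (l * l) < real ((l - 2) * (l - 1))"
  proof -
    have "3 / (1 - s) < real l" using n l(3) by linarith
    then have "3 < (1 - s) * real l" using assms by (simp add: field_simps)
    then have "3 * real l \<le> (1 - s) * real l * real l" by (intro mult_right_mono) auto
    moreover have "real ((l - 2) * (l - 1)) = real l * real l - 3 * real l + 2"
    proof -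
      have "real (l - 2) = real l - 2" "real (l - 1) = real l - 1" using l(1) by (simp_all add: of_nat_diff)
      then show ?thesis unfolding of_nat_mult by (simp add: algebra_simps)
    qed
    ultimately show ?thesis by (simp add: algebra_simps)
  qed
  ultimately show ?thesis using that[of l] l(1) m by linarith
qed

text \<open>The points of the graph over a random block sequence, with independent uniform blocks,
  carry a random measure. Its expected energy is computed by first averaging over the path for a
  fixed pair and then summing over the first block in which the pair differs. Finite expectation
  makes the energy finite for almost every path.\<close>

lemma bridge_graph_dim_ge:
  assumes M: "prob_space M" and H: "0 < H" "H < 1" and fbm: "fractional_brownian_motion M H W"
    and \<kappa>: "\<kappa> ` {0..1} \<subseteq> {0..1}" "continuous_on {0..1} \<kappa>"
    and b: "2 \<le> b" and K: "0 < K" and \<gamma>: "1 < \<gamma>" "\<gamma> < 2 - K"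
  defines "\<alpha> \<equiv> real b powr (-K)"
  shows "AE \<omega> in M. ereal \<gamma> \<le> hausdorff_dim (path_graph (\<lambda>t. wiener_weierstrass_bridge \<alpha> b \<kappa> W t \<omega>))"
proof -
  have \<alpha>: "0 < \<alpha>" "\<alpha> < 1" using b K by (auto simp: \<alpha>_def powr_less_one)
  obtain l :: nat where l: "2 \<le> l" "\<alpha> ^ (l * l) \<le> 1 / 3" "(\<gamma> - 1 + K) * real (l * l) < real ((l - 2) * (l - 1))"
    using exists_block_length[of \<alpha> "\<gamma> - 1 + K"] \<alpha> \<gamma> K by auto
  define B where "B = block_base b l"
  define S where "S = admissible_blocks b l"
  define Y where "Y = wiener_weierstrass_bridge \<alpha> b \<kappa> W"
  have B1: "B > 1" unfolding B_def using b l(1) by (rule block_base_gt_1)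
  have finS: "finite S" by (simp add: S_def admissible_blocks_def finite_restricted_blocks)
  \<comment> \<open>Growth of the expected kernel per common block:
    \<open>B powr (\<gamma> - 1)\<close> from the horizontal distance and \<open>B powr K\<close>,
    the inverse of \<open>\<alpha> ^ (l * l)\<close>, from the standard deviation.\<close>
  define q where "q = B powr (\<gamma> - 1 + K)"
  have q1: "q > 1" using B1 \<gamma> K by (simp add: q_def)
  have cardS: "q < real (card S)"
  proof -
    have "q = real b powr ((\<gamma> - 1 + K) * real (l * l))"
      using b by (simp add: q_def B_def block_base_def powr_realpow[symmetric] powr_powr mult.commute del: of_nat_mult)
    also have "\<dots> < real b powr (real ((l - 2) * (l - 1)))" using l(3) b by (intro powr_less_mono) auto
    also have "\<dots> = real (b ^ ((l - 2) * (l - 1)))" using b by (simp add: powr_realpow del: of_nat_mult)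
    also have "\<dots> \<le> real (card S)"
    proof -
      have "l - 1 = Suc (l - 2)" using l(1) by simp
      then have "(b ^ (l - 2)) ^ (l - 1) \<le> card S"
        unfolding S_def admissible_blocks_def using card_restricted_blocks[OF b l(1), of "l - 2"] by simp
      then show ?thesis by (simp only: of_nat_le_iff power_mult)
    qed
    finally show ?thesis .
  qed
  have card2: "card S \<ge> 2" using cardS q1 by linarith
  then have S0: "S \<noteq> {}" by auto
  obtain D where D: "D > 0" "\<And>m F c. finite F \<Longrightarrow> F \<subseteq> {0..} \<Longrightarrow>
      (\<Sum>t\<in>F. c t * (trapezoid B m t - trapezoid B m 0))\<^sup>2 \<le> D * (\<Sum>s\<in>F. \<Sum>t\<in>F. c s * c t * fbm_cov H s t)"
    using trapezoid_fbm_cov_bound[OF H, of B] B1 by auto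
  define C where "C = (2 + 2 / (\<gamma> - 1)) * (2 * B) powr (\<gamma> - 1) * sqrt D * 2"
  have C0: "C \<ge> 0" using \<gamma> D(1) by (simp add: C_def)
  have v: "(2 + 2 / (\<gamma> - 1)) * (1 / 2 / B ^ Suc j) powr (1 - \<gamma>) * sqrt D / (\<alpha> ^ (l * l * j) / 2) = C * q ^ j" for j
  proof -
    have "(1 / 2 / B ^ Suc j) powr (1 - \<gamma>) = (2 * B * B ^ j) powr (\<gamma> - 1)"
    proof -
      have inv: "inverse z powr (1 - \<gamma>) = z powr (\<gamma> - 1)" for z :: real
        using powr_minus[of z "\<gamma> - 1"] by (simp add: inverse_powr)
      have "1 / 2 / B ^ Suc j = inverse (2 * B * B ^ j)" by (simp add: field_simps)
      then show ?thesis by (simp only: inv)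
    qed
    also have "\<dots> = (2 * B) powr (\<gamma> - 1) * (B powr (\<gamma> - 1)) ^ j"
      using B1 by (simp add: powr_mult powr_power powr_powr powr_realpow[symmetric] mult.commute)
    finally have 1: "(1 / 2 / B ^ Suc j) powr (1 - \<gamma>) = (2 * B) powr (\<gamma> - 1) * (B powr (\<gamma> - 1)) ^ j" .
    have "\<alpha> ^ (l * l) = B powr (-K)"
      using b by (simp add: \<alpha>_def B_def block_base_def powr_realpow[symmetric] powr_powr mult.commute del: of_nat_mult)
    then have 2: "\<alpha> ^ (l * l * j) = inverse ((B powr K) ^ j)"
      by (simp add: power_mult[of \<alpha>] powr_minus power_inverse)
    have 3: "q ^ j = (B powr (\<gamma> - 1)) ^ j * (B powr K) ^ j"
      by (simp add: q_def powr_add power_mult_distrib)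
    show ?thesis unfolding 1 2 3 C_def by (simp add: field_simps)
  qed
  define N where "N = PiM UNIV (\<lambda>_::nat. uniform_count_measure S)"
  interpret U: prob_space "uniform_count_measure S" by (rule prob_space_uniform_count_measure[OF finS S0])
  interpret N: prob_space N unfolding N_def by (intro prob_space_PiM) unfold_locales
  interpret M: prob_space M by fact
  have wS: "w i \<in> S" if "w \<in> space N" for w i
    using that by (auto simp: N_def space_PiM space_uniform_count_measure PiE_def Pi_def)
  define t where "t = block_point B"
  have t01: "t w \<in> {0..1}" if "w \<in> space N" for w
    using block_point_in_unit[OF b l(1), of w] wS[OF that] by (simp add: t_def B_def S_def)
  have tm [measurable]: "t \<in> borel_measurable N"
  proof -
    have [measurable]: "(\<lambda>k. real k) \<in> borel_measurable (uniform_count_measure S)"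
      by (simp add: measurable_cong_sets[OF sets_uniform_count_measure_count_space refl])
    show ?thesis unfolding t_def block_point_def N_def by measurable
  qed
  define X where "X w \<omega> = (t w, Y (t w) \<omega>)" for w \<omega>
  have "(\<lambda>(w, \<omega>). Y (t w) \<omega>) \<in> borel_measurable (N \<Otimes>\<^sub>M M)"
    unfolding Y_def using fbm M \<kappa>(2) tm by (rule bridge_jointly_measurable)
  then have Xm: "(\<lambda>p. X (fst p) (snd p)) \<in> borel_measurable (N \<Otimes>\<^sub>M M)"
    unfolding X_def by (intro borel_measurable_Pair) (auto simp: case_prod_beta)
  define F where "F \<omega> w w' = inverse (ennreal (dist (X w \<omega>) (X w' \<omega>) powr \<gamma>))" for \<omega> w w'
  have Fm: "(\<lambda>p. F (fst p) (fst (snd p)) (snd (snd p))) \<in> borel_measurable (M \<Otimes>\<^sub>M (N \<Otimes>\<^sub>M N))"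
  proof -
    have "(\<lambda>p. (fst (snd p), fst p)) \<in> M \<Otimes>\<^sub>M (N \<Otimes>\<^sub>M N) \<rightarrow>\<^sub>M N \<Otimes>\<^sub>M M" by measurable
    from measurable_compose[OF this Xm]
    have "(\<lambda>p. X (fst (snd p)) (fst p)) \<in> borel_measurable (M \<Otimes>\<^sub>M (N \<Otimes>\<^sub>M N))" by simp
    moreover have "(\<lambda>p. (snd (snd p), fst p)) \<in> M \<Otimes>\<^sub>M (N \<Otimes>\<^sub>M N) \<rightarrow>\<^sub>M N \<Otimes>\<^sub>M M" by measurable
    from measurable_compose[OF this Xm]
    have "(\<lambda>p. X (snd (snd p)) (fst p)) \<in> borel_measurable (M \<Otimes>\<^sub>M (N \<Otimes>\<^sub>M N))" by simp
    ultimately show ?thesis unfolding F_def by measurable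
  qed
  interpret NN: pair_prob_space N N ..
  interpret MN: pair_sigma_finite M "N \<Otimes>\<^sub>M N" ..
  define E where "E = (\<Sum>j. ennreal (C * (q / real (card S)) ^ j))"
  have E: "E < \<infinity>"
    unfolding E_def using C0 q1 cardS
    by (subst suminf_ennreal2) (auto intro!: summable_mult summable_geometric)
  have inner: "(\<integral>\<^sup>+w'. \<integral>\<^sup>+\<omega>. F \<omega> w w' \<partial>M \<partial>N) \<le> E" if w: "w \<in> space N" for w
  proof -
    have term_le: "f n \<le> suminf f" for f :: "nat \<Rightarrow> ennreal" and n
      using sum_le_suminf[of f "{n}"] by simp
    define A where "A j = {v \<in> space N. \<forall>i<j. w i = v i}" for j
    have A: "A j \<in> sets N" "emeasure N (A j) = ennreal ((1 / real (card S)) ^ j)" for j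
      unfolding A_def N_def by (rule emeasure_PiM_uniform_prefix[OF finS S0 wS[OF w]])+
    have "AE w' in N. w' \<noteq> w"
      unfolding N_def using finS card2 wS[OF w] by (rule AE_uniform_product_neq)
    \<comment> \<open>The sum dominates because \<open>w'\<close> lies in \<open>A j\<close> for the
      first index j of disagreement. Using the cylinders \<open>A j\<close> instead of the exact
      event only enlarges the bound, and their measures are explicit.\<close>
    then have "AE w' in N. (\<integral>\<^sup>+\<omega>. F \<omega> w w' \<partial>M) \<le> (\<Sum>j. ennreal (C * q ^ j) * indicator (A j) w')"
      using AE_space
    proof eventually_elim
      case (elim w')
      define j where "j = (LEAST i. w i \<noteq> w' i)"
      have ex: "\<exists>i. w i \<noteq> w' i" using elim by auto
      have j: "w j \<noteq> w' j" unfolding j_def by (rule LeastI_ex[OF ex])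
      have agree: "w i = w' i" if "i < j" for i
        using not_less_Least[OF that[unfolded j_def]] by blast
      have "(\<integral>\<^sup>+\<omega>. F \<omega> w w' \<partial>M) \<le> ennreal (C * q ^ j)"
        unfolding F_def X_def t_def Y_def v[symmetric] B_def
      proof (rule bridge_kernel_le[where H = H and D = D and k = w and k' = w' and j = j and b = b and l = l])
        show "(\<Sum>t\<in>G. c t * (trapezoid (block_base b l) m t - trapezoid (block_base b l) m 0))\<^sup>2
          \<le> D * (\<Sum>s\<in>G. \<Sum>t\<in>G. c s * c t * fbm_cov H s t)" if "finite G" "G \<subseteq> {0..}" for m G c
          using D(2)[OF that, of c m] by (simp only: B_def)
        show "w i \<in> admissible_blocks b l" "w' i \<in> admissible_blocks b l" for i
          using wS[OF w] wS[OF elim(2)] by (simp_all only: S_def)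
      qed (fact fbm M \<kappa>(1) D(1) b l(1) j agree \<alpha> l(2) \<gamma>(1))+
      also have "\<dots> = ennreal (C * q ^ j) * indicator (A j) w'" using elim agree by (simp add: A_def)
      also have "\<dots> \<le> (\<Sum>j. ennreal (C * q ^ j) * indicator (A j) w')"
        by (rule term_le)
      finally show ?case .
    qed
    then have "(\<integral>\<^sup>+w'. \<integral>\<^sup>+\<omega>. F \<omega> w w' \<partial>M \<partial>N) \<le> (\<integral>\<^sup>+w'. (\<Sum>j. ennreal (C * q ^ j) * indicator (A j) w') \<partial>N)"
      by (rule nn_integral_mono_AE)
    also have "\<dots> = (\<Sum>j. ennreal (C * q ^ j) * emeasure N (A j))"
      using A(1) by (subst nn_integral_suminf) (auto simp: nn_integral_cmult_indicator)
    also have "\<dots> = E"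
      unfolding E_def A(2) using C0 q1 by (simp add: ennreal_mult[symmetric] power_divide)
    finally show ?thesis .
  qed
  \<comment> \<open>Tonelli moves the expectation over the path inside the integrals over pairs;
    this is what joint measurability is for.\<close>
  have "(\<integral>\<^sup>+\<omega>. (\<integral>\<^sup>+w. \<integral>\<^sup>+w'. F \<omega> w w' \<partial>N \<partial>N) \<partial>M) = (\<integral>\<^sup>+\<omega>. (\<integral>\<^sup>+p. F \<omega> (fst p) (snd p) \<partial>(N \<Otimes>\<^sub>M N)) \<partial>M)"
  proof (rule nn_integral_cong)
    fix \<omega> assume "\<omega> \<in> space M"
    then have "(\<lambda>p. F \<omega> (fst p) (snd p)) \<in> borel_measurable (N \<Otimes>\<^sub>M N)"
      using measurable_compose[OF measurable_Pair1' Fm] by (simp add: split_beta')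
    from N.nn_integral_fst[OF this] show "(\<integral>\<^sup>+w. \<integral>\<^sup>+w'. F \<omega> w w' \<partial>N \<partial>N) = (\<integral>\<^sup>+p. F \<omega> (fst p) (snd p) \<partial>(N \<Otimes>\<^sub>M N))" by simp
  qed
  also have "\<dots> = (\<integral>\<^sup>+p. (\<integral>\<^sup>+\<omega>. F \<omega> (fst p) (snd p) \<partial>M) \<partial>(N \<Otimes>\<^sub>M N))"
  proof -
    have "(\<lambda>(\<omega>, p). F \<omega> (fst p) (snd p)) \<in> borel_measurable (M \<Otimes>\<^sub>M (N \<Otimes>\<^sub>M N))"
      using Fm by (simp add: split_beta')
    then show ?thesis by (rule MN.Fubini'[symmetric])
  qed
  also have "\<dots> = (\<integral>\<^sup>+w. \<integral>\<^sup>+w'. (\<integral>\<^sup>+\<omega>. F \<omega> w w' \<partial>M) \<partial>N \<partial>N)"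
  proof -
    have "(\<lambda>(p, \<omega>). F \<omega> (fst p) (snd p)) \<in> borel_measurable ((N \<Otimes>\<^sub>M N) \<Otimes>\<^sub>M M)"
      using measurable_compose[OF measurable_pair_swap' Fm] by (simp add: split_beta')
    then have "(\<lambda>p. \<integral>\<^sup>+\<omega>. F \<omega> (fst p) (snd p) \<partial>M) \<in> borel_measurable (N \<Otimes>\<^sub>M N)"
      by (rule M.borel_measurable_nn_integral)
    from N.nn_integral_fst[OF this] show ?thesis by simp
  qed
  also have "\<dots> \<le> (\<integral>\<^sup>+w. E \<partial>N)" by (intro nn_integral_mono inner)
  also have "\<dots> < \<infinity>" using E by (simp add: N.emeasure_space_1)
  finally have fin: "(\<integral>\<^sup>+\<omega>. (\<integral>\<^sup>+w. \<integral>\<^sup>+w'. F \<omega> w w' \<partial>N \<partial>N) \<partial>M) < \<infinity>" .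
  have "AE \<omega> in M. (\<integral>\<^sup>+w. \<integral>\<^sup>+w'. F \<omega> w w' \<partial>N \<partial>N) \<noteq> \<infinity>"
  proof (rule nn_integral_noteq_infinite)
    have "(\<lambda>p. (fst (fst p), (snd (fst p), snd p))) \<in> (M \<Otimes>\<^sub>M N) \<Otimes>\<^sub>M N \<rightarrow>\<^sub>M M \<Otimes>\<^sub>M (N \<Otimes>\<^sub>M N)" by measurable
    from measurable_compose[OF this Fm]
    have "(\<lambda>((\<omega>, w), w'). F \<omega> w w') \<in> borel_measurable ((M \<Otimes>\<^sub>M N) \<Otimes>\<^sub>M N)" by (simp add: split_beta')
    then have "(\<lambda>(\<omega>, w). \<integral>\<^sup>+w'. F \<omega> w w' \<partial>N) \<in> borel_measurable (M \<Otimes>\<^sub>M N)"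
      using N.borel_measurable_nn_integral[of "\<lambda>p w'. F (fst p) (snd p) w'" "M \<Otimes>\<^sub>M N"] by (simp add: split_beta')
    then show "(\<lambda>\<omega>. \<integral>\<^sup>+w. \<integral>\<^sup>+w'. F \<omega> w w' \<partial>N \<partial>N) \<in> borel_measurable M"
      by (rule N.borel_measurable_nn_integral)
  qed (use fin in auto)
  then show ?thesis
    using AE_space
  proof eventually_elim
    case (elim \<omega>)
    show ?case
    proof (rule hausdorff_dim_ge_of_energy[OF N.prob_space_axioms, of "\<lambda>w. X w \<omega>"])
      show "(\<lambda>w. X w \<omega>) \<in> borel_measurable N"
        using measurable_compose[OF measurable_Pair2'[OF elim(2)] Xm] by simp
      show "X w \<omega> \<in> path_graph (\<lambda>t. wiener_weierstrass_bridge \<alpha> b \<kappa> W t \<omega>)" if "w \<in> space N" for w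
        using t01[OF that] by (auto simp: path_graph_def X_def Y_def)
      show "0 < \<gamma>" using \<gamma> by simp
      show "(\<integral>\<^sup>+w. \<integral>\<^sup>+w'. inverse (ennreal (dist (X w \<omega>) (X w' \<omega>) powr \<gamma>)) \<partial>N \<partial>N) < \<infinity>"
        using elim(1) by (simp add: F_def less_top)
    qed
  qed
qed

lemma bridge_graph_dim_le:
  assumes M: "prob_space M" and H: "H < 1" and fbm: "fractional_brownian_motion M H W"
    and \<kappa>: "\<kappa> 0 = 0" "\<kappa> 1 = 1" "holder_on \<tau> {0..1} \<kappa>" "H < \<tau>"
    and b: "2 \<le> b" and K: "0 < K" "K < H"
  shows "AE \<omega> in M. hausdorff_dim (path_graph (\<lambda>t. wiener_weierstrass_bridge (real b powr (-K)) b \<kappa> W t \<omega>)) \<le> ereal (2 - K)"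
proof -
  define h where "h = (K + H) / 2"
  have h: "K < h" "h < H" "0 < h" using K by (auto simp: h_def)
  have "AE \<omega> in M. holder_on h {0..1} (\<lambda>t. W t \<omega>)"
    using fbm M h H by (intro fbm_AE_holder) auto
  \<comment> \<open>That the process starts at 0 is not prescribed but follows almost surely from
    variance 0. It makes the bridge vanish at 0, so that its periodic extension is
    continuous.\<close>
  moreover have "AE \<omega> in M. W 0 \<omega> = 0"
  proof -
    note comb = fbm_combination[OF fbm M, of "{0}" "\<lambda>_. 1", simplified]
    show ?thesis using gaussian_rv_centered_cases[OF M comb] by simp
  qed
  ultimately show ?thesis
  proof eventually_elim
    case (elim \<omega>)
    obtain C1 where C1: "C1 \<ge> 0" "\<And>x y. x \<in> {0..1} \<Longrightarrow> y \<in> {0..1} \<Longrightarrow> \<bar>W x \<omega> - W y \<omega>\<bar> \<le> C1 * \<bar>x - y\<bar> powr h"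
      using elim(1) by (auto simp: holder_on_def dist_real_def)
    have "holder_on h {0..1} \<kappa>" by (rule holder_on_exponent_mono[OF \<kappa>(3)]) (use h \<kappa>(4) in linarith)+
    then obtain C2 where C2: "C2 \<ge> 0" "\<And>x y. x \<in> {0..1} \<Longrightarrow> y \<in> {0..1} \<Longrightarrow> \<bar>\<kappa> x - \<kappa> y\<bar> \<le> C2 * \<bar>x - y\<bar> powr h"
      by (auto simp: holder_on_def dist_real_def)
    have "holder_on h {0..1} (\<lambda>u. fractional_bridge \<kappa> W u \<omega>)"
      unfolding holder_on_def dist_real_def
    proof (intro exI[of _ "C1 + C2 * \<bar>W 1 \<omega>\<bar>"] conjI ballI)
      fix x y :: real assume xy: "x \<in> {0..1}" "y \<in> {0..1}"
      have "\<bar>(\<kappa> x - \<kappa> y) * W 1 \<omega>\<bar> \<le> C2 * \<bar>x - y\<bar> powr h * \<bar>W 1 \<omega>\<bar>"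
        unfolding abs_mult using C2(2)[OF xy] by (intro mult_right_mono) auto
      moreover have "fractional_bridge \<kappa> W x \<omega> - fractional_bridge \<kappa> W y \<omega> = (W x \<omega> - W y \<omega>) - (\<kappa> x - \<kappa> y) * W 1 \<omega>"
        by (simp add: fractional_bridge_def algebra_simps)
      ultimately have "\<bar>fractional_bridge \<kappa> W x \<omega> - fractional_bridge \<kappa> W y \<omega>\<bar> \<le> C1 * \<bar>x - y\<bar> powr h + C2 * \<bar>x - y\<bar> powr h * \<bar>W 1 \<omega>\<bar>"
        using C1(2)[OF xy] by linarith
      then show "\<bar>fractional_bridge \<kappa> W x \<omega> - fractional_bridge \<kappa> W y \<omega>\<bar> \<le> (C1 + C2 * \<bar>W 1 \<omega>\<bar>) * \<bar>x - y\<bar> powr h"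
        by (simp add: algebra_simps)
    qed (use C1 C2 in auto)
    then have "holder_on K {0..1} (\<lambda>t. \<Sum>n. (real b powr (-K)) ^ n * fractional_bridge \<kappa> W (frac (real b ^ n * t)) \<omega>)"
      using b K h \<kappa> elim(2) by (intro weierstrass_series_holder[where h = h]) (auto simp: fractional_bridge_def)
    then show ?case
      using K H unfolding wiener_weierstrass_bridge_def by (intro hausdorff_dim_path_graph_le) auto
  qed
qed

theorem theorem2p6:
  fixes M :: "'w measure" and W :: "real \<Rightarrow> 'w \<Rightarrow> real" and \<kappa> :: "real \<Rightarrow> real"
    and H \<tau> \<alpha> K :: real and b :: nat
  assumes "prob_space M"
    and "0 < H" "H < 1"
    and "fractional_brownian_motion M H W"
    and "\<kappa> ` {0..1} \<subseteq> {0..1}" "\<kappa> 0 = 0" "\<kappa> 1 = 1"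
    and "H < \<tau>" "\<tau> \<le> 1" "holder_on \<tau> {0..1} \<kappa>"
    and "0 < \<alpha>" "\<alpha> < 1"
    and "2 \<le> b"
    and K_def: "K = min 1 (- log (real b) \<alpha>)"
    and "K < H" "1 / 2 < H"
  shows "AE \<omega> in M.
    hausdorff_dim (path_graph (\<lambda>t. wiener_weierstrass_bridge \<alpha> b \<kappa> W t \<omega>)) = ereal (2 - K)"
proof -
  \<comment> \<open>Since K < H < 1, the minimum is attained by the logarithm, and \<alpha> becomes
    a power of b.\<close>
  have K: "K = - log (real b) \<alpha>" "K < 1" using K_def \<open>K < H\<close> \<open>H < 1\<close> by auto
  have "log (real b) \<alpha> < 0" using assms by (simp add: log_less_zero_cancel_iff)
  then have K0: "0 < K" using K by simp
  have \<alpha>: "\<alpha> = real b powr (-K)" using K assms by simp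
  have cont: "continuous_on {0..1} \<kappa>" using assms by (intro holder_on_imp_continuous_on[of \<tau>]) auto
  \<comment> \<open>Countably many orders increasing to 2 - K, so that one null set serves all of
    them. The shift by 2 keeps the first one above 1.\<close>
  define \<gamma> where "\<gamma> n = 2 - K - (1 - K) / real (n + 2)" for n
  have \<gamma>: "1 < \<gamma> n" "\<gamma> n < 2 - K" for n
  proof -
    have "(1 - K) / real (n + 2) < (1 - K) / 1" using K by (intro divide_strict_left_mono) auto
    then show "1 < \<gamma> n" by (simp add: \<gamma>_def)
    show "\<gamma> n < 2 - K" using K by (simp add: \<gamma>_def)
  qed
  have "AE \<omega> in M. \<forall>n. ereal (\<gamma> n) \<le> hausdorff_dim (path_graph (\<lambda>t. wiener_weierstrass_bridge \<alpha> b \<kappa> W t \<omega>))"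
    unfolding AE_all_countable \<alpha>
    by (intro allI bridge_graph_dim_ge[OF assms(1-5) cont \<open>2 \<le> b\<close> K0] \<gamma>)
  moreover have "AE \<omega> in M. hausdorff_dim (path_graph (\<lambda>t. wiener_weierstrass_bridge \<alpha> b \<kappa> W t \<omega>)) \<le> ereal (2 - K)"
    unfolding \<alpha> by (rule bridge_graph_dim_le[OF assms(1,3,4,6,7,10,8) \<open>2 \<le> b\<close> K0 \<open>K < H\<close>])
  ultimately show ?thesis
  proof eventually_elim
    case (elim \<omega>)
    have "(\<lambda>n. 2 - K - (1 - K) / real (n + 2)) \<longlonglongrightarrow> 2 - K - 0"
      by (intro tendsto_diff tendsto_const LIMSEQ_ignore_initial_segment lim_const_over_n)
    then have lim: "(\<lambda>n. ereal (\<gamma> n)) \<longlonglongrightarrow> ereal (2 - K)" by (simp add: \<gamma>_def)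
    have "ereal (2 - K) \<le> hausdorff_dim (path_graph (\<lambda>t. wiener_weierstrass_bridge \<alpha> b \<kappa> W t \<omega>))"
      by (rule LIMSEQ_le_const2[OF lim]) (use elim(1) in auto)
    with elim(2) show ?case by (rule antisym)
  qed
qed

end
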